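(* Let $n>1$ be an integer, let $X$ be a Banach space, let $T:X\to X$ be an $n$-Ritt operator, and put $A=I-T$. Then the following are equivalent: (1) $T$ admits a bounded $H^\infty(\mathbb{B}_{n,\gamma})$ functional calculus for some $\gamma\in(0,\frac{\pi}{n})$; (2) $A$ admits a bounded $H^\infty(S_{n,\theta})$ functional calculus for some $\theta\in(0,\frac{\pi}{n})$.
   Context: Fix an integer $n>1$ and a complex Banach space $X$. $B(X)$ denotes the bounded operators on $X$, $\sigma(\cdot)$ the spectrum, $R(z,A)=(zI-A)^{-1}$ the resolvent. For $a\in\mathbb{C}$ and $E\subseteq\mathbb{C}$, $aE=\{az:z\in E\}$ and $1-E=\{1-z:z\in E\}$. $\|f\|_{\infty,\Omega}=\sup_{z\in\Omega}|f(z)|$. **Sectors.** For $\omega\in(0,\frac{\pi}{n})$ let $\Sigma_\omega=\{z\in\mathbb{C}\setminus\{0\}:|\arg z|<\omega\}$, $\Sigma_{j,\omega}=e^{2ij\pi/n}\Sigma_\omega$ for $0\le j\le n-1$, and $S_{n,\omega}=\bigcup_{j=0}^{n-1}\Sigma_{j,\omega}$. **$n$-sectorial operators.** A closed densely defined operator $A:D(A)\subseteq X\to X$ is $n$-sectorial of type $\omega\in(0,\frac{\pi}{n})$ if $\sigma(A)\subseteq\overline{S}_{n,\omega}$ and, for every $\nu\in(\omega,\frac{\pi}{n})$, the set $\{zR(z,A):z\in\mathbb{C}\setminus\overline{S}_{n,\nu}\}$ is bounded in $B(X)$. **Functional calculus for $n$-sectorial operators.** $H_0^\infty(S_{n,\theta})$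 is the algebra of bounded holomorphic $f:S_{n,\theta}\to\mathbb{C}$ for which there are $c,s>0$ (depending on $f$) with $|f(z)|\le c\frac{|z|^s}{1+|z|^{2s}}$ for all $z\in S_{n,\theta}$. If $A$ is $n$-sectorial of type $\omega<\theta$ and $f\in H_0^\infty(S_{n,\theta})$, then $$f(A)=\frac{1}{2\pi i}\int_{\Gamma_{S_{n,\nu}}}f(z)R(z,A)\,dz,\qquad \nu\in(\omega,\theta),$$ where $\Gamma_{S_{n,\nu}}$ is the concatenation of the boundaries of the sectors $\Sigma_{j,\nu}$, $0\le j\le n-1$, each oriented anticlockwise (for $j=0$: along $te^{i\nu}$ from $t=\infty$ to $t=0$, then along $te^{-i\nu}$ from $t=0$ to $t=\infty$). The integral converges absolutely and does not depend on $\nu$. "$A$ admits a bounded $H^\infty(S_{n,\theta})$ functional calculus" means: $A$ is $n$-sectorial of some type $\omega\in(0,\theta)$ and there is $C>0$ with $\|f(A)\|\le C\|f\|_{\infty,S_{n,\theta}}$ for all $f\in H_0^\infty(S_{n,\theta})$. **$n$-Stolz domains.** For $\gamma\in(0,\frac{\pi}{n})$ let $\mathcal{B}_\gamma$ be the interior of the convex hull of the point $1$ and the disc $D(0,\sin\gamma)$. Put $\Delta_\gamma=1-\mathcal{B}_\gamma$, $\Delta_{j,\gamma}=e^{2ij\pi/n}\Delta_\gamma$, and $\mathbb{B}_{n,\gamma}=1-\bigcup_{j=0}^{n-1}\Delta_{j,\gamma}$. **$n$-Ritt operators.** A bounded operator $T:X\to X$ is $n$-Ritt of type $\alpha\in(0,\frac{\pi}{n})$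 if $\sigma(T)\subseteq\overline{\mathbb{B}}_{n,\alpha}$ and, for every $\beta\in(\alpha,\frac{\pi}{n})$, the set $\{(\lambda-1)R(\lambda,T):\lambda\in\mathbb{C}\setminus\overline{\mathbb{B}}_{n,\beta}\}$ is bounded in $B(X)$. $T$ is $n$-Ritt if it is $n$-Ritt of some type $\alpha\in(0,\frac{\pi}{n})$. **Functional calculus for $n$-Ritt operators.** $H_0^\infty(\mathbb{B}_{n,\gamma})$ is the algebra of bounded holomorphic $\phi:\mathbb{B}_{n,\gamma}\to\mathbb{C}$ for which there are $c,s>0$ (depending on $\phi$) with $|\phi(\lambda)|\le c|1-\lambda|^s$ for all $\lambda\in\mathbb{B}_{n,\gamma}$. If $T$ is $n$-Ritt of type $\alpha<\gamma$ and $\phi\in H_0^\infty(\mathbb{B}_{n,\gamma})$, then $$\phi(T)=\frac{1}{2\pi i}\int_{\Gamma_{\mathbb{B}_{n,\beta}}}\phi(\lambda)R(\lambda,T)\,d\lambda,\qquad \beta\in(\alpha,\gamma),$$ where $\Gamma_{\mathbb{B}_{n,\beta}}$ is the concatenation of the boundaries of the $n$ sets $1-\Delta_{j,\beta}$, $0\le j\le n-1$, each oriented counterclockwise. The integral converges absolutely and does not depend on $\beta$. "$T$ admits a bounded $H^\infty(\mathbb{B}_{n,\gamma})$ functional calculus" means: $T$ is $n$-Ritt of some type $\alpha\in(0,\gamma)$ and there is $K>0$ with $\|\phi(T)\|\le K\|\phi\|_{\infty,\mathbb{B}_{n,\gamma}}$ for all $\phi\in H_0^\infty(\mathbb{B}_{n,\gamma})$.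 *)

theory Defs
  imports "HOL-Complex_Analysis.Complex_Analysis"
begin

section \<open>Complex Banach spaces and their bounded operators\<close>

class complex_banach = banach +
  fixes scaleC :: "complex \<Rightarrow> 'a \<Rightarrow> 'a"  (infixr "*\<^sub>C" 75)
  assumes scaleC_add_right: "a *\<^sub>C (x + y) = a *\<^sub>C x + a *\<^sub>C y"
    and scaleC_add_left: "(a + b) *\<^sub>C x = a *\<^sub>C x + b *\<^sub>C x"
    and scaleC_scaleC: "a *\<^sub>C b *\<^sub>C x = (a * b) *\<^sub>C x"
    and scaleC_of_real: "complex_of_real r *\<^sub>C x = r *\<^sub>R x"
    and norm_scaleC: "norm (a *\<^sub>C x) = cmod a * norm x"

instantiation complex :: complex_banach
begin

definition scaleC_complex :: "complex \<Rightarrow> complex \<Rightarrow> complex" where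
  "scaleC_complex a x = a * x"

instance
  by standard (auto simp: scaleC_complex_def algebra_simps norm_mult scaleR_conv_of_real)

end

lemma bounded_linear_scaleC_right: "bounded_linear (\<lambda>x::'a::complex_banach. a *\<^sub>C x)"
proof (rule bounded_linear_intro[where K = "cmod a"])
  fix r :: real and x :: 'a
  show "a *\<^sub>C r *\<^sub>R x = r *\<^sub>R a *\<^sub>C x"
    by (simp flip: scaleC_of_real add: scaleC_scaleC mult.commute)
qed (simp_all add: scaleC_add_right norm_scaleC mult.commute)

instantiation blinfun :: (real_normed_vector, complex_banach) complex_banach
begin

definition scaleC_blinfun ::
    "complex \<Rightarrow> ('a \<Rightarrow>\<^sub>L 'b) \<Rightarrow> ('a \<Rightarrow>\<^sub>L 'b)" where
  "scaleC_blinfun a S = Blinfun (\<lambda>x. a *\<^sub>C blinfun_apply S x)"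

lemma blinfun_apply_scaleC: "blinfun_apply (a *\<^sub>C S) x = a *\<^sub>C blinfun_apply S x"
  for S :: "'a \<Rightarrow>\<^sub>L 'b"
  unfolding scaleC_blinfun_def
  by (subst bounded_linear_Blinfun_apply)
     (auto intro: bounded_linear_compose[OF bounded_linear_scaleC_right] blinfun.bounded_linear_right)

instance
proof
  fix a b :: complex and r :: real and S S' :: "'a \<Rightarrow>\<^sub>L 'b"
  show "a *\<^sub>C (S + S') = a *\<^sub>C S + a *\<^sub>C S'"
    by (rule blinfun_eqI) (simp add: blinfun_apply_scaleC blinfun.add_left scaleC_add_right)
  show "(a + b) *\<^sub>C S = a *\<^sub>C S + b *\<^sub>C S"
    by (rule blinfun_eqI) (simp add: blinfun_apply_scaleC blinfun.add_left scaleC_add_left)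
  show "a *\<^sub>C b *\<^sub>C S = (a * b) *\<^sub>C S"
    by (rule blinfun_eqI) (simp add: blinfun_apply_scaleC scaleC_scaleC)
  show "complex_of_real r *\<^sub>C S = r *\<^sub>R S"
    by (rule blinfun_eqI) (simp add: blinfun_apply_scaleC scaleC_of_real blinfun.scaleR_left)
  have le: "norm (c *\<^sub>C U) \<le> cmod c * norm U" for c and U :: "'a \<Rightarrow>\<^sub>L 'b"
    by (rule norm_blinfun_bound)
       (auto simp: blinfun_apply_scaleC norm_scaleC mult.assoc intro!: mult_left_mono norm_blinfun)
  show "norm (a *\<^sub>C S) = cmod a * norm S"
  proof (cases "a = 0")
    case True
    then show ?thesis using le[of a S] by simp
  next
    case False
    have one: "1 *\<^sub>C S = S"
      by (rule blinfun_eqI)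
         (use scaleC_of_real[of 1] in \<open>simp add: blinfun_apply_scaleC\<close>)
    have "inverse a *\<^sub>C a *\<^sub>C S = (inverse a * a) *\<^sub>C S"
      by (rule blinfun_eqI) (simp add: blinfun_apply_scaleC scaleC_scaleC)
    also have "\<dots> = S" using False one by simp
    finally have "inverse a *\<^sub>C a *\<^sub>C S = S" .
    then have "norm S \<le> cmod (inverse a) * norm (a *\<^sub>C S)"
      using le[of "inverse a" "a *\<^sub>C S"] by simp
    then have "cmod a * norm S \<le> norm (a *\<^sub>C S)"
      using False by (simp add: norm_divide field_simps)
    then show ?thesis using le[of a S] by simp
  qed
qed

end

text \<open>The type \<open>'a \<Rightarrow>\<^sub>L 'a\<close> contains all bounded real-linear maps; \<open>B(X)\<close> is its closed
  subspace of complex-linear ones, with the same operator norm.\<close>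

definition bounded_ops :: "('a::complex_banach \<Rightarrow>\<^sub>L 'a) set" where
  "bounded_ops = {S. \<forall>c x. blinfun_apply S (c *\<^sub>C x) = c *\<^sub>C blinfun_apply S x}"

section \<open>Unbounded operators, spectrum and resolvent\<close>

text \<open>A partially defined operator is given by its domain \<open>D\<close> and a total function \<open>A\<close>
  whose values outside \<open>D\<close> are never used.\<close>

definition closed_densely_defined :: "'a::complex_banach set \<Rightarrow> ('a \<Rightarrow> 'a) \<Rightarrow> bool" where
  "closed_densely_defined D A \<longleftrightarrow>
     0 \<in> D \<and>
     (\<forall>x\<in>D. \<forall>y\<in>D. x + y \<in> D \<and> A (x + y) = A x + A y) \<and>
     (\<forall>c. \<forall>x\<in>D. c *\<^sub>C x \<in> D \<and> A (c *\<^sub>C x) = c *\<^sub>C A x) \<and>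
     closed {(x, A x) | x. x \<in> D} \<and>
     closure D = UNIV"

definition is_resolvent ::
    "'a::complex_banach set \<Rightarrow> ('a \<Rightarrow> 'a) \<Rightarrow> complex \<Rightarrow> ('a \<Rightarrow>\<^sub>L 'a) \<Rightarrow> bool" where
  "is_resolvent D A z S \<longleftrightarrow>
     S \<in> bounded_ops \<and>
     (\<forall>x. blinfun_apply S x \<in> D \<and> z *\<^sub>C blinfun_apply S x - A (blinfun_apply S x) = x) \<and>
     (\<forall>x\<in>D. blinfun_apply S (z *\<^sub>C x - A x) = x)"

definition spectrum :: "'a::complex_banach set \<Rightarrow> ('a \<Rightarrow> 'a) \<Rightarrow> complex set" where
  "spectrum D A = {z. \<not> (\<exists>S. is_resolvent D A z S)}"

definition resolvent ::
    "'a::complex_banach set \<Rightarrow> ('a \<Rightarrow> 'a) \<Rightarrow> complex \<Rightarrow> ('a \<Rightarrow>\<^sub>L 'a)" where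
  "resolvent D A z = (THE S. is_resolvent D A z S)"

definition sup_norm_on :: "complex set \<Rightarrow> (complex \<Rightarrow> complex) \<Rightarrow> real" where
  "sup_norm_on \<Omega> f = (SUP z\<in>\<Omega>. cmod (f z))"

definition rot :: "nat \<Rightarrow> nat \<Rightarrow> complex" where
  "rot n j = cis (2 * real j * pi / real n)"

section \<open>\<open>n\<close>-sectorial operators\<close>

definition sector :: "real \<Rightarrow> complex set" where
  "sector \<omega> = {z. z \<noteq> 0 \<and> \<bar>Arg z\<bar> < \<omega>}"

definition n_sector :: "nat \<Rightarrow> real \<Rightarrow> complex set" where
  "n_sector n \<omega> = (\<Union>j<n. (\<lambda>z. rot n j * z) ` sector \<omega>)"

definition n_sectorial ::
    "nat \<Rightarrow> real \<Rightarrow> 'a::complex_banach set \<Rightarrow> ('a \<Rightarrow> 'a) \<Rightarrow> bool" where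
  "n_sectorial n \<omega> D A \<longleftrightarrow>
     0 < \<omega> \<and> \<omega> < pi / real n \<and>
     closed_densely_defined D A \<and>
     spectrum D A \<subseteq> closure (n_sector n \<omega>) \<and>
     (\<forall>\<nu>. \<omega> < \<nu> \<and> \<nu> < pi / real n \<longrightarrow>
        bounded ((\<lambda>z. z *\<^sub>C resolvent D A z) ` (- closure (n_sector n \<nu>))))"

definition H0_sector :: "nat \<Rightarrow> real \<Rightarrow> (complex \<Rightarrow> complex) set" where
  "H0_sector n \<theta> = {f. f holomorphic_on n_sector n \<theta> \<and> bounded (f ` n_sector n \<theta>) \<and>
     (\<exists>c>0. \<exists>s>0. \<forall>z\<in>n_sector n \<theta>.
        cmod (f z) \<le> c * (cmod z powr s / (1 + cmod z powr (2 * s))))}"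

text \<open>\<open>ray_integral w F\<close> is the integral of \<open>F z dz\<close> along the ray \<open>z = tw\<close>, traversed from
  \<open>t = 0\<close> to \<open>t = \<infinity>\<close>.\<close>

definition ray_integral :: "complex \<Rightarrow> (complex \<Rightarrow> 'b::complex_banach) \<Rightarrow> 'b" where
  "ray_integral w F = integral {0<..} (\<lambda>t. w *\<^sub>C F (of_real t * w))"

text \<open>\<open>f(A)\<close>, computed with the contour of angle \<open>\<nu>\<close>: each sector boundary comes in from
  infinity along its upper ray and leaves along its lower ray.\<close>

definition sectorial_calculus ::
    "nat \<Rightarrow> real \<Rightarrow> 'a::complex_banach set \<Rightarrow> ('a \<Rightarrow> 'a) \<Rightarrow> (complex \<Rightarrow> complex) \<Rightarrow> ('a \<Rightarrow>\<^sub>L 'a)" where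
  "sectorial_calculus n \<nu> D A f =
     (1 / (2 * of_real pi * \<i>)) *\<^sub>C
     (\<Sum>j<n. - ray_integral (rot n j * cis \<nu>) (\<lambda>z. f z *\<^sub>C resolvent D A z)
             + ray_integral (rot n j * cis (- \<nu>)) (\<lambda>z. f z *\<^sub>C resolvent D A z))"

text \<open>Since \<open>f(A)\<close> does not depend on \<open>\<nu>\<close>, the estimate is required for
  every admissible \<open>\<nu>\<close>, with one constant.\<close>

definition sectorial_bounded_calculus ::
    "nat \<Rightarrow> real \<Rightarrow> 'a::complex_banach set \<Rightarrow> ('a \<Rightarrow> 'a) \<Rightarrow> bool" where
  "sectorial_bounded_calculus n \<theta> D A \<longleftrightarrow>
     (\<exists>\<omega>. 0 < \<omega> \<and> \<omega> < \<theta> \<and> n_sectorial n \<omega> D A \<and>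
       (\<exists>C>0. \<forall>f\<in>H0_sector n \<theta>. \<forall>\<nu>. \<omega> < \<nu> \<and> \<nu> < \<theta> \<longrightarrow>
          norm (sectorial_calculus n \<nu> D A f) \<le> C * sup_norm_on (n_sector n \<theta>) f))"

section \<open>\<open>n\<close>-Ritt operators\<close>

definition stolz :: "real \<Rightarrow> complex set" where
  "stolz \<gamma> = interior (convex hull (insert 1 (ball 0 (sin \<gamma>))))"

definition stolz_shift :: "real \<Rightarrow> complex set" where
  "stolz_shift \<gamma> = (\<lambda>z. 1 - z) ` stolz \<gamma>"

definition n_stolz :: "nat \<Rightarrow> real \<Rightarrow> complex set" where
  "n_stolz n \<gamma> = (\<lambda>z. 1 - z) ` (\<Union>j<n. (\<lambda>z. rot n j * z) ` stolz_shift \<gamma>)"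

definition n_Ritt_of_type :: "nat \<Rightarrow> real \<Rightarrow> ('a::complex_banach \<Rightarrow>\<^sub>L 'a) \<Rightarrow> bool" where
  "n_Ritt_of_type n \<alpha> T \<longleftrightarrow>
     0 < \<alpha> \<and> \<alpha> < pi / real n \<and>
     T \<in> bounded_ops \<and>
     spectrum UNIV (blinfun_apply T) \<subseteq> closure (n_stolz n \<alpha>) \<and>
     (\<forall>\<beta>. \<alpha> < \<beta> \<and> \<beta> < pi / real n \<longrightarrow>
        bounded ((\<lambda>z. (z - 1) *\<^sub>C resolvent UNIV (blinfun_apply T) z) ` (- closure (n_stolz n \<beta>))))"

definition n_Ritt :: "nat \<Rightarrow> ('a::complex_banach \<Rightarrow>\<^sub>L 'a) \<Rightarrow> bool" where
  "n_Ritt n T \<longleftrightarrow> (\<exists>\<alpha>. 0 < \<alpha> \<and> \<alpha> < pi / real n \<and> n_Ritt_of_type n \<alpha> T)"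

definition H0_stolz :: "nat \<Rightarrow> real \<Rightarrow> (complex \<Rightarrow> complex) set" where
  "H0_stolz n \<gamma> = {\<phi>. \<phi> holomorphic_on n_stolz n \<gamma> \<and> bounded (\<phi> ` n_stolz n \<gamma>) \<and>
     (\<exists>c>0. \<exists>s>0. \<forall>z\<in>n_stolz n \<gamma>. cmod (\<phi> z) \<le> c * cmod (1 - z) powr s)}"

text \<open>The counterclockwise boundary of \<open>stolz \<beta>\<close> for \<open>0 < \<beta> < \<pi>/2\<close>. The tangents from \<open>1\<close> to the
  circle of radius \<open>sin \<beta>\<close> about \<open>0\<close> touch it at the arguments \<open>\<plusminus>(\<pi>/2 - \<beta>)\<close>.\<close>

definition stolz_path :: "real \<Rightarrow> real \<Rightarrow> complex" where
  "stolz_path \<beta> =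
     linepath 1 (of_real (sin \<beta>) * cis (pi / 2 - \<beta>)) +++
     part_circlepath 0 (sin \<beta>) (pi / 2 - \<beta>) (3 * pi / 2 + \<beta>) +++
     linepath (of_real (sin \<beta>) * cis (3 * pi / 2 + \<beta>)) 1"

definition n_stolz_path :: "nat \<Rightarrow> nat \<Rightarrow> real \<Rightarrow> real \<Rightarrow> complex" where
  "n_stolz_path n j \<beta> = (\<lambda>t. 1 - rot n j * (1 - stolz_path \<beta> t))"

text \<open>The Banach-space-valued analogue of \<^const>\<open>contour_integral\<close>.\<close>

definition vector_contour_integral ::
    "(real \<Rightarrow> complex) \<Rightarrow> (complex \<Rightarrow> 'b::complex_banach) \<Rightarrow> 'b" where
  "vector_contour_integral g F =
     integral {0..1} (\<lambda>t. vector_derivative g (at t within {0..1}) *\<^sub>C F (g t))"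

definition Ritt_calculus ::
    "nat \<Rightarrow> real \<Rightarrow> ('a::complex_banach \<Rightarrow>\<^sub>L 'a) \<Rightarrow> (complex \<Rightarrow> complex) \<Rightarrow> ('a \<Rightarrow>\<^sub>L 'a)" where
  "Ritt_calculus n \<beta> T \<phi> =
     (1 / (2 * of_real pi * \<i>)) *\<^sub>C
     (\<Sum>j<n. vector_contour_integral (n_stolz_path n j \<beta>)
               (\<lambda>z. \<phi> z *\<^sub>C resolvent UNIV (blinfun_apply T) z))"

text \<open>As in the sectorial case, \<open>\<phi>(T)\<close> does not depend on \<open>\<beta>\<close>.\<close>

definition Ritt_bounded_calculus :: "nat \<Rightarrow> real \<Rightarrow> ('a::complex_banach \<Rightarrow>\<^sub>L 'a) \<Rightarrow> bool" where
  "Ritt_bounded_calculus n \<gamma> T \<longleftrightarrow>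
     (\<exists>\<alpha>. 0 < \<alpha> \<and> \<alpha> < \<gamma> \<and> n_Ritt_of_type n \<alpha> T \<and>
       (\<exists>K>0. \<forall>\<phi>\<in>H0_stolz n \<gamma>. \<forall>\<beta>. \<alpha> < \<beta> \<and> \<beta> < \<gamma> \<longrightarrow>
          norm (Ritt_calculus n \<beta> T \<phi>) \<le> K * sup_norm_on (n_stolz n \<gamma>) \<phi>))"

end

theory Submission
  imports Defs "HOL-Real_Asymp.Real_Asymp"
begin

text \<open>Write \<open>z = 1 - \<lambda>\<close>. Then \<open>R(z, A) = - R(1 - z, T)\<close>, so with \<open>f z = \<phi> (1 - z)\<close> the operator \<open>\<phi>(T)\<close> is the
integral of \<open>f(z) R(z, A)\<close> along the boundaries of the domains \<open>\<Delta>\<^sub>j\<close>, the images of \<open>stolz_shift\<close> under the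
rotations \<open>rot n j\<close>; each \<open>\<Delta>\<^sub>j\<close> is a bounded piece, at the vertex \<open>0\<close>, of one of the \<open>n\<close> sectors (\<open>Ritt_calculus_eq_stolz_integral\<close>). For \<open>f\<close> in
\<open>H0_sector\<close> these integrals equal those along the sector boundaries: between the arc of \<open>\<Delta>\<^sub>j\<close> and
infinity the resolvent is holomorphic, and \<open>f(z) R(z, A)\<close> decays faster than \<open>1/z\<close>
(\<open>sectorial_calculus_eq_stolz_integral\<close>). So \<open>f(A) = \<phi>(T)\<close>, and since \<open>\<phi>\<close> is a restriction of \<open>f\<close>, a
bounded calculus for \<open>T\<close> gives one for \<open>A\<close> with the same angle and the same constant.

For the converse, \<open>f\<close> lives on the \<open>\<Delta>\<^sub>j\<close> only and has to be replaced by a function on sectors. On each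
\<open>\<Delta>\<^sub>j\<close> it is split as \<open>f = h + g\<close>, where \<open>h\<close> belongs to \<open>H0_sector\<close>, its sup norm is at most \<open>C\<close> times
that of \<open>\<phi>\<close>, and \<open>g\<close> is at most \<open>C |z|\<close> times that sup norm (\<open>H0_stolz_decomposition\<close>). The integral of
\<open>g(z) R(z, A)\<close> is then bounded trivially, because \<open>z R(z, A)\<close> is bounded and the contour has
finite length, while the integral of \<open>h(z) R(z, A)\<close> is \<open>h(A)\<close> and is controlled by the hypothesis. The
function \<open>h\<close> is the part of Cauchy's integral over a triangle with vertex \<open>0\<close> that comes from the two
sides meeting at \<open>0\<close>, which is holomorphic on the whole smaller sector, plus a multiple of
\<open>1/(1 + z)\<close> that makes it vanish at \<open>0\<close> (\<open>sector_decomposition\<close>).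

Both calculi are independent of the angle of the contour. This is needed twice: the estimate for
\<open>\<phi>(T)\<close> has to be uniform over all contour angles, and the type of \<open>T\<close> may exceed the angle in the
hypothesis on \<open>A\<close>, so that the contour suitable for comparing the calculi is not the one for which \<open>h(A)\<close> is
estimated. All operator-valued integrals are treated by real calculus: Cauchy's theorem is proved on smooth
curvilinear quadrilaterals by exchanging two integrations, and improper integrals are evaluated through
antiderivatives.\<close>

section \<open>Complex scalar multiplication as a bounded bilinear map\<close>

lemma bounded_bilinear_scaleC:
  "bounded_bilinear (\<lambda>(a::complex) (x::'a::complex_banach). a *\<^sub>C x)"
proof
  fix r :: real and a :: complex and x :: 'a
  have eq: "(complex_of_real r * a) *\<^sub>C x = r *\<^sub>R (a *\<^sub>C x)"
    by (metis scaleC_of_real scaleC_scaleC)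
  show "(r *\<^sub>R a) *\<^sub>C x = r *\<^sub>R (a *\<^sub>C x)"
    using eq by (simp add: scaleR_conv_of_real)
  show "a *\<^sub>C (r *\<^sub>R x) = r *\<^sub>R (a *\<^sub>C x)"
    using eq by (simp add: mult.commute flip: scaleC_of_real add: scaleC_scaleC)
  show "\<exists>K. \<forall>(a::complex) (b::'a). norm (a *\<^sub>C b) \<le> norm a * norm b * K"
    by (rule exI[of _ 1]) (simp add: norm_scaleC)
qed (simp_all add: scaleC_add_right scaleC_add_left)

interpretation scaleC: bounded_bilinear "\<lambda>(a::complex) (x::'a::complex_banach). a *\<^sub>C x"
  by (rule bounded_bilinear_scaleC)

lemma scaleC_one [simp]: "1 *\<^sub>C (x::'a::complex_banach) = x"
  using scaleC_of_real[of 1 x] by simp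

declare scaleC.zero_left [simp] scaleC.zero_right [simp]

section \<open>Improper integrals dominated by powers\<close>

lemma integral_powr_interval:
  fixes M \<sigma> :: real
  assumes "\<sigma> \<noteq> 0" "0 < x" "x \<le> y"
  shows "((\<lambda>t. M * t powr (\<sigma> - 1)) has_integral (M / \<sigma> * y powr \<sigma> - M / \<sigma> * x powr \<sigma>)) {x..y}"
proof (rule fundamental_theorem_of_calculus[OF assms(3)])
  fix t assume t: "t \<in> {x..y}"
  have "((\<lambda>t. M / \<sigma> * t powr \<sigma>) has_real_derivative (M * t powr (\<sigma> - 1))) (at t)"
    using t assms by (auto intro!: derivative_eq_intros simp: field_simps)
  then show "((\<lambda>t. M / \<sigma> * t powr \<sigma>) has_vector_derivative M * t powr (\<sigma> - 1)) (at t within {x..y})"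
    by (simp add: has_real_derivative_iff_has_vector_derivative has_vector_derivative_at_within)
qed

lemma norm_integral_le_powr:
  fixes f :: "real \<Rightarrow> 'b::banach"
  assumes "\<sigma> \<noteq> 0" "0 < x" "x \<le> y" and cont: "continuous_on {x..y} f"
    and bd: "\<And>t. x \<le> t \<Longrightarrow> t \<le> y \<Longrightarrow> norm (f t) \<le> M * t powr (\<sigma> - 1)"
  shows "norm (integral {x..y} f) \<le> M / \<sigma> * y powr \<sigma> - M / \<sigma> * x powr \<sigma>"
proof -
  have I: "((\<lambda>t. M * t powr (\<sigma> - 1)) has_integral (M / \<sigma> * y powr \<sigma> - M / \<sigma> * x powr \<sigma>)) {x..y}"
    by (rule integral_powr_interval) (use assms in auto)
  have "norm (integral {x..y} f) \<le> integral {x..y} (\<lambda>t. M * t powr (\<sigma> - 1))"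
    by (rule integral_norm_bound_integral)
       (use I bd in \<open>auto intro: integrable_continuous_real cont simp: has_integral_integrable\<close>)
  with integral_unique[OF I] show ?thesis by linarith
qed

text \<open>The integral from \<open>t\<close> to \<open>a\<close> is a uniformly continuous function of \<open>t > 0\<close>, because its increments are dominated by those
of a multiple of \<open>t powr \<sigma>\<close>. Its continuous extension to \<open>0\<close> is an antiderivative of \<open>- f\<close> in the interior, and the
fundamental theorem of calculus applies. This works for values in any Banach space.\<close>

lemma improper_integral_at_0:
  fixes f :: "real \<Rightarrow> 'b::banach"
  assumes "\<sigma> > 0" "a > 0" and cont: "continuous_on {0<..a} f"
    and bd: "\<And>t. 0 < t \<Longrightarrow> t \<le> a \<Longrightarrow> norm (f t) \<le> M * t powr (\<sigma> - 1)"
  shows "f integrable_on {0..a}"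
    and "((\<lambda>\<epsilon>. integral {\<epsilon>..a} f) \<longlongrightarrow> integral {0..a} f) (at_right 0)"
    and "norm (integral {0..a} f) \<le> M / \<sigma> * a powr \<sigma>"
proof -
  define \<Phi> where "\<Phi> t = integral {t..a} f" for t
  define p where "p t = M / \<sigma> * t powr \<sigma>" for t :: real
  have c': "continuous_on {x..y} f" if "0 < x" "y \<le> a" for x y
    by (rule continuous_on_subset[OF cont]) (use that in auto)
  have M: "M \<ge> 0"
    using norm_ge_zero[of "f a"] bd[of a] \<open>a > 0\<close>
    by (metis order_trans order_refl powr_gt_zero zero_le_mult_iff not_less order_less_le)
  have diff: "norm (\<Phi> x - \<Phi> y) \<le> p y - p x" if "0 < x" "x \<le> y" "y \<le> a" for x y
  proof -
    have "integral {x..y} f + integral {y..a} f = integral {x..a} f"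
      by (rule Henstock_Kurzweil_Integration.integral_combine)
         (use that in \<open>auto intro: integrable_continuous_real c'\<close>)
    then have "\<Phi> x - \<Phi> y = integral {x..y} f" by (simp add: \<Phi>_def algebra_simps)
    then show ?thesis
      unfolding p_def using norm_integral_le_powr[of \<sigma> x y f M] that assms(1) c' bd by auto
  qed
  have dist: "dist (\<Phi> x) (\<Phi> y) \<le> dist (p x) (p y)" if "x \<in> {0<..a}" "y \<in> {0<..a}" for x y
  proof (cases "x \<le> y")
    case True
    then show ?thesis using diff[of x y] that by (auto simp: dist_norm)
  next
    case False
    then show ?thesis using diff[of y x] that by (auto simp: dist_norm norm_minus_commute)
  qed
  have "continuous_on {0..a} p"
    unfolding p_def using assms(1)
    by (intro continuous_intros continuous_on_powr') auto
  then have "uniformly_continuous_on {0..a} p"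
    by (intro compact_uniformly_continuous) auto
  then have "uniformly_continuous_on {0<..a} p"
    unfolding uniformly_continuous_on_def
    by (metis atLeastAtMost_iff greaterThanAtMost_iff less_imp_le)
  then have uc: "\<exists>d>0. \<forall>x\<in>{0<..a}. \<forall>x'\<in>{0<..a}. dist x' x < d \<longrightarrow> dist (p x') (p x) < e" if "e > 0" for e
    using that by (simp add: uniformly_continuous_on_def)
  have "uniformly_continuous_on {0<..a} \<Phi>"
    unfolding uniformly_continuous_on_def
  proof (intro allI impI)
    fix e :: real assume "e > 0"
    then obtain d where "d > 0"
      and d: "\<And>x x'. x \<in> {0<..a} \<Longrightarrow> x' \<in> {0<..a} \<Longrightarrow> dist x' x < d \<Longrightarrow> dist (p x') (p x) < e"
      using uc by meson
    then show "\<exists>d>0. \<forall>x\<in>{0<..a}. \<forall>x'\<in>{0<..a}. dist x' x < d \<longrightarrow> dist (\<Phi> x') (\<Phi> x) < e"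
      by (intro exI[of _ d] conjI ballI impI order_le_less_trans[OF dist]) auto
  qed
  then obtain g where g: "uniformly_continuous_on (closure {0<..a}) g" "\<And>x. x \<in> {0<..a} \<Longrightarrow> \<Phi> x = g x"
    using uniformly_continuous_on_extension_on_closure by metis
  have gc: "continuous_on {0..a} g"
    using uniformly_continuous_imp_continuous[OF g(1)] \<open>a > 0\<close> by simp
  have der: "(g has_vector_derivative - f x) (at x)" if x: "x \<in> {0<..<a}" for x
  proof -
    have "((\<lambda>u. integral {u..a} f) has_vector_derivative - f x) (at x within {x/2..a})"
      by (rule integral_has_vector_derivative') (use x in \<open>auto intro: c'\<close>)
    then have "(\<Phi> has_vector_derivative - f x) (at x within {x/2..a})"
      by (simp add: \<Phi>_def[abs_def])
    then have "(\<Phi> has_vector_derivative - f x) (at x within {x/2<..<a})"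
      by (rule has_vector_derivative_within_subset) auto
    then have "(\<Phi> has_vector_derivative - f x) (at x)"
      using x by (subst (asm) at_within_open) auto
    then show ?thesis
      by (rule has_vector_derivative_transform_within_open[of _ _ _ "{0<..<a}"]) (use x g(2) in auto)
  qed
  have "((\<lambda>x. - f x) has_integral g a - g 0) {0..a}"
    by (rule fundamental_theorem_of_calculus_interior) (use der gc \<open>a > 0\<close> in auto)
  then have "((\<lambda>x. - (- f x)) has_integral - (g a - g 0)) {0..a}"
    by (rule has_integral_neg)
  then have I: "(f has_integral g 0 - g a) {0..a}" by simp
  have ga: "g a = 0" using g(2)[of a] \<open>a > 0\<close> by (simp add: \<Phi>_def)
  show "f integrable_on {0..a}" using I by blast
  have "(g \<longlongrightarrow> g 0) (at 0 within {0..a})"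
    using gc \<open>a > 0\<close> by (auto simp: continuous_on)
  then have "(g \<longlongrightarrow> g 0) (at_right 0)"
    using \<open>a > 0\<close> by (simp add: at_within_Icc_at_right)
  moreover have ev: "\<forall>\<^sub>F x in at_right 0. g x = integral {x..a} f"
    unfolding eventually_at_right_field using g(2) \<open>a > 0\<close> by (auto simp: \<Phi>_def intro!: exI[of _ a])
  ultimately have lim: "((\<lambda>\<epsilon>. integral {\<epsilon>..a} f) \<longlongrightarrow> g 0) (at_right 0)"
    by (rule Lim_transform_eventually)
  then show "((\<lambda>\<epsilon>. integral {\<epsilon>..a} f) \<longlongrightarrow> integral {0..a} f) (at_right 0)"
    using I ga by (simp add: integral_unique)
  have evb: "\<forall>\<^sub>F x in at_right 0. norm (integral {x..a} f) \<le> M / \<sigma> * a powr \<sigma>"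
    unfolding eventually_at_right_field
  proof (intro exI[of _ a] conjI \<open>a > 0\<close> allI impI)
    fix x assume "0 < x" "x < a"
    then have "norm (integral {x..a} f) \<le> p a - p x"
      using diff[of x a] by (simp add: \<Phi>_def)
    also have "\<dots> \<le> p a" using M \<open>\<sigma> > 0\<close> by (simp add: p_def)
    finally show "norm (integral {x..a} f) \<le> M / \<sigma> * a powr \<sigma>" by (simp add: p_def)
  qed
  have "norm (g 0) \<le> M / \<sigma> * a powr \<sigma>"
    by (rule tendsto_upperbound[OF tendsto_norm[OF lim] evb]) simp
  then show "norm (integral {0..a} f) \<le> M / \<sigma> * a powr \<sigma>"
    using I ga by (simp add: integral_unique)
qed

text \<open>The integrals over \<open>{a..R}\<close> form a Cauchy family as \<open>R\<close> grows, since the dominating power is integrable at infinity.\<close>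

lemma improper_integral_at_top:
  fixes f :: "real \<Rightarrow> 'b::banach"
  assumes "\<sigma> > 0" "a > 0" and cont: "continuous_on {a..} f"
    and bd: "\<And>t. a \<le> t \<Longrightarrow> norm (f t) \<le> M * t powr (- \<sigma> - 1)"
  shows "f integrable_on {a..}"
    and "((\<lambda>R. integral {a..R} f) \<longlongrightarrow> integral {a..} f) at_top"
proof -
  define \<Phi> where "\<Phi> t = integral {a..t} f" for t
  have c': "continuous_on {x..y} f" if "a \<le> x" for x y
    by (rule continuous_on_subset[OF cont]) (use that in auto)
  have M: "M \<ge> 0"
    using norm_ge_zero[of "f a"] bd[of a] \<open>a > 0\<close>
    by (metis order_trans order_refl powr_gt_zero zero_le_mult_iff not_less order_less_le)
  have diff: "norm (\<Phi> x - \<Phi> y) \<le> M / \<sigma> * x powr (-\<sigma>)" if "a \<le> x" "x \<le> y" for x y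
  proof -
    have "integral {a..x} f + integral {x..y} f = integral {a..y} f"
      by (rule Henstock_Kurzweil_Integration.integral_combine)
         (use that in \<open>auto intro: integrable_continuous_real c'\<close>)
    then have "\<Phi> y - \<Phi> x = integral {x..y} f" by (simp add: \<Phi>_def algebra_simps)
    moreover have "norm (integral {x..y} f) \<le> M / (-\<sigma>) * y powr (-\<sigma>) - M / (-\<sigma>) * x powr (-\<sigma>)"
      by (rule norm_integral_le_powr) (use that assms c' in auto)
    moreover have "M / (-\<sigma>) * y powr (-\<sigma>) \<le> 0" using M \<open>\<sigma> > 0\<close> by simp
    ultimately show ?thesis by (simp add: norm_minus_commute[of "\<Phi> x"])
  qed
  have lim0: "((\<lambda>x. M / \<sigma> * x powr (-\<sigma>)) \<longlongrightarrow> 0) at_top"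
    using tendsto_mult_right_zero[OF tendsto_neg_powr[OF _ filterlim_ident], of "-\<sigma>" "M/\<sigma>"] \<open>\<sigma> > 0\<close>
    by simp
  have "Cauchy (\<lambda>k. \<Phi> (a + real k))"
  proof (rule metric_CauchyI)
    fix e :: real assume "e > 0"
    have "((\<lambda>k. M / \<sigma> * (a + real k) powr (-\<sigma>)) \<longlongrightarrow> 0) at_top"
      by (rule filterlim_compose[OF lim0]) real_asymp
    then have "\<forall>\<^sub>F k in at_top. M / \<sigma> * (a + real k) powr (-\<sigma>) < e"
      using \<open>e > 0\<close> by (simp add: order_tendsto_iff)
    then obtain N where N: "\<And>k. k \<ge> N \<Longrightarrow> M / \<sigma> * (a + real k) powr (-\<sigma>) < e"
      by (auto simp: eventually_at_top_linorder)
    have "dist (\<Phi> (a + real m)) (\<Phi> (a + real k)) < e" if "N \<le> m" "m \<le> k" for m k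
      using diff[of "a + real m" "a + real k"] N[of m] that by (auto simp: dist_norm)
    then show "\<exists>N. \<forall>m\<ge>N. \<forall>k\<ge>N. dist (\<Phi> (a + real m)) (\<Phi> (a + real k)) < e"
      by (metis dist_commute linorder_linear)
  qed
  then obtain L where L: "(\<lambda>k. \<Phi> (a + real k)) \<longlonglongrightarrow> L"
    using Cauchy_convergent convergent_def by blast
  have dL: "norm (\<Phi> x - L) \<le> M / \<sigma> * x powr (-\<sigma>)" if "a \<le> x" for x
  proof -
    have "((\<lambda>k. norm (\<Phi> x - \<Phi> (a + real k))) \<longlongrightarrow> norm (\<Phi> x - L)) at_top"
      by (intro tendsto_intros L)
    moreover have "\<forall>\<^sub>F k in at_top. norm (\<Phi> x - \<Phi> (a + real k)) \<le> M / \<sigma> * x powr (-\<sigma>)"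
    proof -
      have "\<forall>\<^sub>F k in at_top. x \<le> a + real k" by real_asymp
      then show ?thesis by eventually_elim (use diff that in auto)
    qed
    ultimately show ?thesis by (rule tendsto_upperbound) simp
  qed
  have limL: "(\<Phi> \<longlongrightarrow> L) at_top"
  proof -
    have "\<forall>\<^sub>F x in at_top. norm (\<Phi> x - L) \<le> M / \<sigma> * x powr (-\<sigma>)"
      using eventually_ge_at_top[of a] by eventually_elim (use dL in auto)
    then have "((\<lambda>x. \<Phi> x - L) \<longlongrightarrow> 0) at_top"
      by (rule Lim_null_comparison) (rule lim0)
    then show ?thesis by (simp add: LIM_zero_iff)
  qed
  have sub: "(\<lambda>x. if x \<in> {a..} then f x else 0) integrable_on {c..d} \<and>
      integral {c..d} (\<lambda>x. if x \<in> {a..} then f x else 0) = integral {max a c..d} f" for c d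
  proof -
    have e: "{a..} \<inter> {c..d} = {max a c..d}" by auto
    have "f integrable_on {max a c..d}"
      by (rule integrable_continuous_real) (rule c', simp)
    then show ?thesis
      unfolding integrable_restrict_Int integral_restrict_Int e by simp
  qed
  have "(f has_integral L) {a..}"
    unfolding has_integral_alt'[of f]
  proof (intro conjI allI impI)
    fix c d show "(\<lambda>x. if x \<in> {a..} then f x else 0) integrable_on cbox c d"
      using sub by simp
  next
    fix e :: real assume "e > 0"
    then have "\<forall>\<^sub>F x in at_top. dist (\<Phi> x) L < e"
      using limL by (simp add: tendsto_iff)
    then obtain N where N: "\<And>x. x \<ge> N \<Longrightarrow> dist (\<Phi> x) L < e"
      by (auto simp: eventually_at_top_linorder)
    show "\<exists>B>0. \<forall>c d. ball 0 B \<subseteq> cbox c d \<longrightarrow>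
        norm (integral (cbox c d) (\<lambda>x. if x \<in> {a..} then f x else 0) - L) < e"
    proof (intro exI[of _ "max 1 (\<bar>N\<bar> + 1)"] conjI allI impI)
      fix c d :: real assume B: "ball 0 (max 1 (\<bar>N\<bar> + 1)) \<subseteq> cbox c d"
      have "0 \<in> ball 0 (max 1 (\<bar>N\<bar> + 1))" "\<bar>N\<bar> \<in> ball 0 (max 1 (\<bar>N\<bar> + 1))" by auto
      with B have "0 \<in> cbox c d" "\<bar>N\<bar> \<in> cbox c d" by blast+
      then have "c \<le> 0" "N \<le> d" by auto
      then have "max a c = a" using \<open>a > 0\<close> by auto
      then show "norm (integral (cbox c d) (\<lambda>x. if x \<in> {a..} then f x else 0) - L) < e"
        using N[of d] \<open>N \<le> d\<close> sub[of c d] by (simp add: dist_norm \<Phi>_def)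
    qed auto
  qed
  then show "f integrable_on {a..}" "((\<lambda>R. integral {a..R} f) \<longlongrightarrow> integral {a..} f) at_top"
    using limL by (auto simp: integral_unique \<Phi>_def[abs_def])
qed

lemma integral_half_line_split:
  fixes f :: "real \<Rightarrow> 'b::banach"
  assumes "a > 0" "f integrable_on {0..a}" "f integrable_on {a..}"
  shows "integral {0<..} f = integral {0..a} f + integral {a..} f"
proof -
  have "negligible ({0..a} \<inter> {a..})"
    by (rule negligible_subset[of "{a}"]) auto
  then have "(f has_integral integral {0..a} f + integral {a..} f) ({0..a} \<union> {a..})"
    using assms by (intro has_integral_Un) auto
  moreover have "{0..a} \<union> {a..} = {0..}" using assms by auto
  ultimately have "(f has_integral integral {0..a} f + integral {a..} f) {0..}" by simp
  moreover have "negligible (({0..} - {0<..}) \<union> ({0<..} - {0..}) :: real set)"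
    by (rule negligible_subset[of "{0}"]) auto
  ultimately have "(f has_integral integral {0..a} f + integral {a..} f) {0<..}"
    by (subst (asm) has_integral_spike_set_eq[of "{0..}" "{0<..}"]) (auto elim: negligible_subset)
  then show ?thesis by (rule integral_unique)
qed

section \<open>Cauchy's theorem for vector-valued functions\<close>

text \<open>Complex differentiability on \<open>U\<close> with a continuous derivative. Continuity of the derivative is part of the
definition because it makes Cauchy's theorem an exchange of two integrals over a rectangle.\<close>

definition vec_holomorphic_on :: "(complex \<Rightarrow> 'b::complex_banach) \<Rightarrow> complex set \<Rightarrow> bool"
    (infixl "vec'_holomorphic'_on" 50) where
  "F vec_holomorphic_on U \<longleftrightarrow>
     (\<exists>F'. (\<forall>z\<in>U. (F has_derivative (\<lambda>h. h *\<^sub>C F' z)) (at z)) \<and> continuous_on U F')"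

lemma vec_holomorphic_on_subset:
  "F vec_holomorphic_on U \<Longrightarrow> V \<subseteq> U \<Longrightarrow> F vec_holomorphic_on V"
  unfolding vec_holomorphic_on_def by (meson continuous_on_subset subsetD)

lemma vec_holomorphic_on_imp_continuous_on:
  "F vec_holomorphic_on U \<Longrightarrow> continuous_on U F"
  unfolding vec_holomorphic_on_def
  by (meson continuous_at_imp_continuous_on has_derivative_continuous)

text \<open>Cauchy's theorem for the image of a rectangle under a smooth map \<open>G\<close>. The functions \<open>F(G) G\<^sub>t\<close> and \<open>F(G) G\<^sub>s\<close>
satisfy \<open>\<partial>\<^sub>s (F(G) G\<^sub>t) = \<partial>\<^sub>t (F(G) G\<^sub>s)\<close>, so integrating this common value over the rectangle in the
two possible orders gives the two sides.\<close>

lemma cauchy_quadrilateral: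
  fixes F :: "complex \<Rightarrow> 'b::complex_banach" and G Gs Gt Gst :: "real \<Rightarrow> real \<Rightarrow> complex"
  assumes F: "F vec_holomorphic_on U" and le: "s0 \<le> s1" "t0 \<le> t1"
    and GU: "\<And>s t. s0 \<le> s \<Longrightarrow> s \<le> s1 \<Longrightarrow> t0 \<le> t \<Longrightarrow> t \<le> t1 \<Longrightarrow> G s t \<in> U"
    and Gs: "\<And>s t. ((\<lambda>s. G s t) has_vector_derivative Gs s t) (at s)"
    and Gt: "\<And>s t. ((\<lambda>t. G s t) has_vector_derivative Gt s t) (at t)"
    and Gts: "\<And>s t. ((\<lambda>s. Gt s t) has_vector_derivative Gst s t) (at s)"
    and Gst: "\<And>s t. ((\<lambda>t. Gs s t) has_vector_derivative Gst s t) (at t)"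
    and cont: "continuous_on UNIV (\<lambda>x. G (fst x) (snd x))" "continuous_on UNIV (\<lambda>x. Gs (fst x) (snd x))"
       "continuous_on UNIV (\<lambda>x. Gt (fst x) (snd x))" "continuous_on UNIV (\<lambda>x. Gst (fst x) (snd x))"
  shows "integral {t0..t1} (\<lambda>t. Gt s1 t *\<^sub>C F (G s1 t)) - integral {t0..t1} (\<lambda>t. Gt s0 t *\<^sub>C F (G s0 t)) =
     integral {s0..s1} (\<lambda>s. Gs s t1 *\<^sub>C F (G s t1)) - integral {s0..s1} (\<lambda>s. Gs s t0 *\<^sub>C F (G s t0))"
proof -
  obtain F' where F': "\<And>z. z \<in> U \<Longrightarrow> (F has_derivative (\<lambda>h. h *\<^sub>C F' z)) (at z)" "continuous_on U F'"
    using F unfolding vec_holomorphic_on_def by blast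
  note Fc = vec_holomorphic_on_imp_continuous_on[OF F]
  \<comment> \<open>The common value of \<open>\<partial>\<^sub>s (F(G) G\<^sub>t)\<close> and \<open>\<partial>\<^sub>t (F(G) G\<^sub>s)\<close>.\<close>
  define D where "D s t = (Gs s t * Gt s t) *\<^sub>C F' (G s t) + Gst s t *\<^sub>C F (G s t)" for s t
  have FG: "((\<lambda>x. F (g x)) has_vector_derivative g' *\<^sub>C F' (g x)) (at x within S)"
    if "(g has_vector_derivative g') (at x)" "g x \<in> U" for g :: "real \<Rightarrow> complex" and g' x S
  proof -
    have "(g has_derivative (\<lambda>h. h *\<^sub>R g')) (at x within S)"
      using that(1) by (simp add: has_vector_derivative_def has_derivative_at_withinI)
    from has_derivative_compose[OF this F'(1)[OF that(2)]]
    show ?thesis by (simp add: has_vector_derivative_def scaleC.scaleR_left)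
  qed
  have P: "((\<lambda>s. Gt s t *\<^sub>C F (G s t)) has_vector_derivative D s t) (at s within S)"
    if "s0 \<le> s" "s \<le> s1" "t0 \<le> t" "t \<le> t1" for s t S
  proof -
    have "((\<lambda>s. Gt s t *\<^sub>C F (G s t)) has_vector_derivative
        Gt s t *\<^sub>C (Gs s t *\<^sub>C F' (G s t)) + Gst s t *\<^sub>C F (G s t)) (at s within S)"
      by (rule scaleC.has_vector_derivative)
         (use that in \<open>auto intro!: FG Gs GU has_vector_derivative_at_within[OF Gts]\<close>)
    then show ?thesis by (simp add: D_def scaleC_scaleC mult.commute)
  qed
  have Q: "((\<lambda>t. Gs s t *\<^sub>C F (G s t)) has_vector_derivative D s t) (at t within S)"
    if "s0 \<le> s" "s \<le> s1" "t0 \<le> t" "t \<le> t1" for s t S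
  proof -
    have "((\<lambda>t. Gs s t *\<^sub>C F (G s t)) has_vector_derivative
        Gs s t *\<^sub>C (Gt s t *\<^sub>C F' (G s t)) + Gst s t *\<^sub>C F (G s t)) (at t within S)"
      by (rule scaleC.has_vector_derivative)
         (use that in \<open>auto intro!: FG Gt GU has_vector_derivative_at_within[OF Gst]\<close>)
    then show ?thesis by (simp add: D_def scaleC_scaleC mult.commute)
  qed
  define B where "B = cbox (s0, t0) (s1, t1)"
  have BD: "fst x \<in> {s0..s1}" "snd x \<in> {t0..t1}" if "x \<in> B" for x
    using that by (cases x; auto simp: B_def cbox_Pair_eq)+
  have cB: "continuous_on B (\<lambda>x. G (fst x) (snd x))" "continuous_on B (\<lambda>x. Gs (fst x) (snd x))"
     "continuous_on B (\<lambda>x. Gt (fst x) (snd x))" "continuous_on B (\<lambda>x. Gst (fst x) (snd x))"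
    using cont by (auto elim: continuous_on_subset)
  have sub: "(\<lambda>x. G (fst x) (snd x)) ` B \<subseteq> U"
    using BD GU by fastforce
  have "continuous_on B (\<lambda>x. D (fst x) (snd x))"
    unfolding D_def
    by (intro continuous_intros scaleC.continuous_on cB
        continuous_on_compose2[OF F'(2) cB(1) sub] continuous_on_compose2[OF Fc cB(1) sub])
  then have "continuous_on (cbox (s0, t0) (s1, t1)) (\<lambda>(s, t). D s t)"
    by (simp add: B_def case_prod_unfold)
  from integral_swap_continuous[OF this]
  have swap: "integral {s0..s1} (\<lambda>s. integral {t0..t1} (D s)) = integral {t0..t1} (\<lambda>t. integral {s0..s1} (\<lambda>s. D s t))"
    by simp
  have i1: "integral {s0..s1} (\<lambda>s. D s t) = Gt s1 t *\<^sub>C F (G s1 t) - Gt s0 t *\<^sub>C F (G s0 t)"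
    if "t \<in> {t0..t1}" for t
    by (rule integral_unique, rule fundamental_theorem_of_calculus) (use le P that in auto)
  have i2: "integral {t0..t1} (D s) = Gs s t1 *\<^sub>C F (G s t1) - Gs s t0 *\<^sub>C F (G s t0)"
    if "s \<in> {s0..s1}" for s
    by (rule integral_unique, rule fundamental_theorem_of_calculus) (use le Q that in auto)
  have ct: "(\<lambda>t. Gt s t *\<^sub>C F (G s t)) integrable_on {t0..t1}" if "s0 \<le> s" "s \<le> s1" for s
  proof (rule integrable_continuous_real)
    have pc: "continuous_on {t0..t1} (Pair s)"
      by (rule continuous_on_Pair[OF continuous_on_const continuous_on_id])
    have *: "continuous_on {t0..t1} (\<lambda>t. G s t)" "continuous_on {t0..t1} (\<lambda>t. Gt s t)"
      using continuous_on_compose2[OF cont(1), of "{t0..t1}" "\<lambda>t. (s, t)"]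
        continuous_on_compose2[OF cont(3), of "{t0..t1}" "\<lambda>t. (s, t)"] pc
      by auto
    show "continuous_on {t0..t1} (\<lambda>t. Gt s t *\<^sub>C F (G s t))"
      by (intro scaleC.continuous_on * continuous_on_compose2[OF Fc *(1)]) (use that GU in auto)
  qed
  have cs: "(\<lambda>s. Gs s t *\<^sub>C F (G s t)) integrable_on {s0..s1}" if "t0 \<le> t" "t \<le> t1" for t
  proof (rule integrable_continuous_real)
    have pc: "continuous_on {s0..s1} (\<lambda>s. (s, t))"
      by (rule continuous_on_Pair[OF continuous_on_id continuous_on_const])
    have *: "continuous_on {s0..s1} (\<lambda>s. G s t)" "continuous_on {s0..s1} (\<lambda>s. Gs s t)"
      using continuous_on_compose2[OF cont(1), of "{s0..s1}" "\<lambda>s. (s, t)"]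
        continuous_on_compose2[OF cont(2), of "{s0..s1}" "\<lambda>s. (s, t)"] pc
      by auto
    show "continuous_on {s0..s1} (\<lambda>s. Gs s t *\<^sub>C F (G s t))"
      by (intro scaleC.continuous_on * continuous_on_compose2[OF Fc *(1)]) (use that GU in auto)
  qed
  have "integral {t0..t1} (\<lambda>t. Gt s1 t *\<^sub>C F (G s1 t)) - integral {t0..t1} (\<lambda>t. Gt s0 t *\<^sub>C F (G s0 t)) =
      integral {t0..t1} (\<lambda>t. integral {s0..s1} (\<lambda>s. D s t))"
    by (subst integral_diff[symmetric]) (use le ct i1 in \<open>auto intro!: integral_cong\<close>)
  also have "\<dots> = integral {s0..s1} (\<lambda>s. integral {t0..t1} (D s))"
    by (rule swap[symmetric])
  also have "\<dots> = integral {s0..s1} (\<lambda>s. Gs s t1 *\<^sub>C F (G s t1)) -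
      integral {s0..s1} (\<lambda>s. Gs s t0 *\<^sub>C F (G s t0))"
    by (subst integral_diff[symmetric]) (use le cs i2 in \<open>auto intro!: integral_cong\<close>)
  finally show ?thesis .
qed

text \<open>The special case \<open>G s t = t * c s\<close>: the region swept out by the multiples of a curve \<open>c\<close>, whose straight edges
lie on rays from \<open>0\<close>.\<close>

lemma cauchy_cone:
  fixes F :: "complex \<Rightarrow> 'b::complex_banach" and c c' :: "real \<Rightarrow> complex"
  assumes F: "F vec_holomorphic_on U" and le: "s0 \<le> s1" "t0 \<le> t1"
    and U: "\<And>s t. s0 \<le> s \<Longrightarrow> s \<le> s1 \<Longrightarrow> t0 \<le> t \<Longrightarrow> t \<le> t1 \<Longrightarrow> of_real t * c s \<in> U"
    and c: "\<And>s. (c has_vector_derivative c' s) (at s)" "continuous_on UNIV c'"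
  shows "integral {t0..t1} (\<lambda>t. c s1 *\<^sub>C F (of_real t * c s1)) - integral {t0..t1} (\<lambda>t. c s0 *\<^sub>C F (of_real t * c s0)) =
     integral {s0..s1} (\<lambda>s. (of_real t1 * c' s) *\<^sub>C F (of_real t1 * c s))
     - integral {s0..s1} (\<lambda>s. (of_real t0 * c' s) *\<^sub>C F (of_real t0 * c s))"
proof -
  have cc: "continuous_on UNIV c"
    by (intro continuous_at_imp_continuous_on ballI has_vector_derivative_continuous[OF c(1)])
  have *: "continuous_on UNIV (\<lambda>x. c (fst x))" "continuous_on UNIV (\<lambda>x. c' (fst x))"
    for x :: "real \<times> real"
    by (rule continuous_on_compose2[OF cc], auto intro: continuous_intros)
       (rule continuous_on_compose2[OF c(2)], auto intro: continuous_intros)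
  show ?thesis
    by (rule cauchy_quadrilateral[OF F le, where G = "\<lambda>s t. of_real t * c s" and Gs = "\<lambda>s t. of_real t * c' s"
          and Gt = "\<lambda>s t. c s" and Gst = "\<lambda>s t. c' s"])
       (auto intro!: U c continuous_intros * derivative_eq_intros)
qed

section \<open>Integrals along segments and half-lines\<close>

text \<open>The integral of \<open>F z dz\<close> along the segment from \<open>0\<close> to \<open>w\<close>.\<close>

definition seg :: "complex \<Rightarrow> (complex \<Rightarrow> 'b::complex_banach) \<Rightarrow> 'b" where
  "seg w F = integral {0..1} (\<lambda>t. w *\<^sub>C F (of_real t * w))"

text \<open>The integral of \<open>F z dz\<close> along the half-line from \<open>w\<close> to infinity in the direction of \<open>w\<close>.\<close>

definition tail :: "complex \<Rightarrow> (complex \<Rightarrow> 'b::complex_banach) \<Rightarrow> 'b" where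
  "tail w F = integral {1..} (\<lambda>t. w *\<^sub>C F (of_real t * w))"

lemma continuous_on_ray:
  assumes "continuous_on U F" "\<And>t. t \<in> T \<Longrightarrow> of_real t * w \<in> U"
  shows "continuous_on T (\<lambda>t. w *\<^sub>C F (of_real t * w))"
  by (intro scaleC.continuous_on continuous_on_compose2[OF assms(1)] continuous_intros) (use assms in auto)

lemma norm_ray_le:
  assumes "norm (F (of_real t * w)) \<le> M * cmod (of_real t * w) powr r" "t > 0"
  shows "norm (w *\<^sub>C F (of_real t * w)) \<le> (M * cmod w powr (r + 1)) * t powr r"
proof (cases "w = 0")
  case False
  have "norm (w *\<^sub>C F (of_real t * w)) \<le> cmod w * (M * cmod (of_real t * w) powr r)"
    unfolding norm_scaleC by (intro mult_left_mono assms(1)) auto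
  also have "\<dots> = (M * cmod w powr (r + 1)) * t powr r"
    using assms(2) False by (simp add: norm_mult powr_mult powr_add)
  finally show ?thesis .
qed (use assms in auto)

lemma seg_improper:
  assumes "\<sigma> > 0" and cont: "continuous_on U F"
    and U: "\<And>t. 0 < t \<Longrightarrow> t \<le> 1 \<Longrightarrow> of_real t * w \<in> U"
    and bd: "\<And>z. z \<in> U \<Longrightarrow> norm (F z) \<le> M * cmod z powr (\<sigma> - 1)"
  shows "(\<lambda>t. w *\<^sub>C F (of_real t * w)) integrable_on {0..1}"
    and "((\<lambda>\<epsilon>. integral {\<epsilon>..1} (\<lambda>t. w *\<^sub>C F (of_real t * w))) \<longlongrightarrow> seg w F) (at_right 0)"
    and "norm (seg w F) \<le> M * cmod w powr \<sigma> / \<sigma>"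
proof -
  have c: "continuous_on {0<..1} (\<lambda>t. w *\<^sub>C F (of_real t * w))"
    by (rule continuous_on_ray[OF cont]) (use U in auto)
  have b: "norm (w *\<^sub>C F (of_real t * w)) \<le> (M * cmod w powr \<sigma>) * t powr (\<sigma> - 1)" if "0 < t" "t \<le> 1" for t
    using norm_ray_le[where F = F and w = w, OF bd[OF U[OF that]] that(1)] by simp
  note * = improper_integral_at_0[OF assms(1) zero_less_one c b]
  show "(\<lambda>t. w *\<^sub>C F (of_real t * w)) integrable_on {0..1}"
    by (rule *(1))
  show "((\<lambda>\<epsilon>. integral {\<epsilon>..1} (\<lambda>t. w *\<^sub>C F (of_real t * w))) \<longlongrightarrow> seg w F) (at_right 0)"
    unfolding seg_def by (rule *(2))
  show "norm (seg w F) \<le> M * cmod w powr \<sigma> / \<sigma>"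
    unfolding seg_def using *(3) by simp
qed

lemma tail_improper:
  assumes "\<sigma> > 0" and cont: "continuous_on U F"
    and U: "\<And>t. 1 \<le> t \<Longrightarrow> of_real t * w \<in> U"
    and bd: "\<And>z. z \<in> U \<Longrightarrow> norm (F z) \<le> M * cmod z powr (- \<sigma> - 1)"
  shows "(\<lambda>t. w *\<^sub>C F (of_real t * w)) integrable_on {1..}"
    and "((\<lambda>R. integral {1..R} (\<lambda>t. w *\<^sub>C F (of_real t * w))) \<longlongrightarrow> tail w F) at_top"
proof -
  have c: "continuous_on {1..} (\<lambda>t. w *\<^sub>C F (of_real t * w))"
    by (rule continuous_on_ray[OF cont]) (use U in auto)
  have b: "norm (w *\<^sub>C F (of_real t * w)) \<le> (M * cmod w powr (-\<sigma>)) * t powr (-\<sigma> - 1)" if "1 \<le> t" for t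
    using norm_ray_le[where F = F and w = w, OF bd[OF U[OF that]]] that by simp
  note * = improper_integral_at_top[OF assms(1) zero_less_one c b]
  show "(\<lambda>t. w *\<^sub>C F (of_real t * w)) integrable_on {1..}"
    by (rule *(1))
  show "((\<lambda>R. integral {1..R} (\<lambda>t. w *\<^sub>C F (of_real t * w))) \<longlongrightarrow> tail w F) at_top"
    unfolding tail_def by (rule *(2))
qed

text \<open>The estimate that makes the scaled copies of an arc disappear in the limit: with \<open>r > -1\<close> as \<open>t\<close> tends to
\<open>0\<close>, and with \<open>r < -1\<close> as \<open>t\<close> tends to infinity.\<close>

lemma scaled_arc_integral_le:
  fixes F :: "complex \<Rightarrow> 'b::complex_banach" and c c' :: "real \<Rightarrow> complex"
  assumes F: "continuous_on U F" and t: "t > 0"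
    and U: "\<And>s. s0 \<le> s \<Longrightarrow> s \<le> s1 \<Longrightarrow> of_real t * c s \<in> U"
    and c: "continuous_on {s0..s1} c" "continuous_on {s0..s1} c'" "\<And>s. s0 \<le> s \<Longrightarrow> s \<le> s1 \<Longrightarrow> c s \<noteq> 0"
    and bd: "\<And>z. z \<in> U \<Longrightarrow> norm (F z) \<le> M * cmod z powr r"
  shows "norm (integral {s0..s1} (\<lambda>s. (of_real t * c' s) *\<^sub>C F (of_real t * c s)))
    \<le> t powr (r + 1) * integral {s0..s1} (\<lambda>s. cmod (c' s) * (M * cmod (c s) powr r))"
proof -
  have "norm (integral {s0..s1} (\<lambda>s. (of_real t * c' s) *\<^sub>C F (of_real t * c s)))
     \<le> integral {s0..s1} (\<lambda>s. t powr (r + 1) * (cmod (c' s) * (M * cmod (c s) powr r)))"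
  proof (rule integral_norm_bound_integral)
    show "(\<lambda>s. (of_real t * c' s) *\<^sub>C F (of_real t * c s)) integrable_on {s0..s1}"
    proof (intro integrable_continuous_real scaleC.continuous_on)
      show "continuous_on {s0..s1} (\<lambda>s. of_real t * c' s)"
        by (intro continuous_intros c)
      have "continuous_on {s0..s1} (\<lambda>s. of_real t * c s)"
        by (intro continuous_intros c)
      then show "continuous_on {s0..s1} (\<lambda>s. F (of_real t * c s))"
        by (rule continuous_on_compose2[OF F]) (use U in auto)
    qed
    show "(\<lambda>s. t powr (r + 1) * (cmod (c' s) * (M * cmod (c s) powr r))) integrable_on {s0..s1}"
      by (intro integrable_continuous_real continuous_intros c) (use c in auto)
    fix s assume s: "s \<in> {s0..s1}"
    have "norm ((of_real t * c' s) *\<^sub>C F (of_real t * c s)) \<le>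
        (t * cmod (c' s)) * (M * cmod (of_real t * c s) powr r)"
      unfolding norm_scaleC using bd[OF U] s t by (intro mult_mono) (auto simp: norm_mult)
    also have "\<dots> = t powr (r + 1) * (cmod (c' s) * (M * cmod (c s) powr r))"
      using t by (simp add: norm_mult powr_mult powr_add)
    finally show "norm ((of_real t * c' s) *\<^sub>C F (of_real t * c s)) \<le>
        t powr (r + 1) * (cmod (c' s) * (M * cmod (c s) powr r))" .
  qed
  then show ?thesis by simp
qed

text \<open>Cauchy's theorem for the closed path formed by two segments from \<open>0\<close> and an arc joining their end points. The
singularity at \<open>0\<close> is integrable; the cone truncated at distance \<open>\<epsilon>\<close> from the vertex is treated first.\<close>

lemma seg_diff:
  fixes F :: "complex \<Rightarrow> 'b::complex_banach"
  assumes \<sigma>: "\<sigma> > 0" and F: "F vec_holomorphic_on U" and le: "s0 \<le> s1"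
    and U: "\<And>s t. s0 \<le> s \<Longrightarrow> s \<le> s1 \<Longrightarrow> 0 < t \<Longrightarrow> t \<le> 1 \<Longrightarrow> of_real t * c s \<in> U"
    and bd: "\<And>z. z \<in> U \<Longrightarrow> norm (F z) \<le> M * cmod z powr (\<sigma> - 1)"
    and c: "\<And>s. (c has_vector_derivative c' s) (at s)" "continuous_on UNIV c'"
    and c0: "\<And>s. s0 \<le> s \<Longrightarrow> s \<le> s1 \<Longrightarrow> c s \<noteq> 0"
  shows "seg (c s1) F - seg (c s0) F = integral {s0..s1} (\<lambda>s. c' s *\<^sub>C F (c s))"
proof -
  note Fc = vec_holomorphic_on_imp_continuous_on[OF F]
  have cc: "continuous_on S c" for S
    by (intro continuous_at_imp_continuous_on ballI has_vector_derivative_continuous[OF c(1)])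
  define E where "E \<epsilon> = integral {s0..s1} (\<lambda>s. (of_real \<epsilon> * c' s) *\<^sub>C F (of_real \<epsilon> * c s))" for \<epsilon> :: real
  define B where "B = integral {s0..s1} (\<lambda>s. cmod (c' s) * (M * cmod (c s) powr (\<sigma> - 1)))"
  have ev: "\<forall>\<^sub>F \<epsilon> in at_right 0. 0 < \<epsilon> \<and> \<epsilon> < (1::real)"
    unfolding eventually_at_right_field by (intro exI[of _ 1]) auto
  have lim: "((\<lambda>\<epsilon>. integral {\<epsilon>..1} (\<lambda>t. c s *\<^sub>C F (of_real t * c s))) \<longlongrightarrow> seg (c s) F) (at_right 0)"
    if "s0 \<le> s" "s \<le> s1" for s
    by (rule seg_improper(2)[OF \<sigma> Fc _ bd]) (use U that in auto)
  have 1: "((\<lambda>\<epsilon>. integral {\<epsilon>..1} (\<lambda>t. c s1 *\<^sub>C F (of_real t * c s1)) -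
      integral {\<epsilon>..1} (\<lambda>t. c s0 *\<^sub>C F (of_real t * c s0))) \<longlongrightarrow> seg (c s1) F - seg (c s0) F) (at_right 0)"
    by (intro tendsto_diff lim) (use le in auto)
  have "(E \<longlongrightarrow> 0) (at_right 0)"
  proof (rule Lim_null_comparison)
    show "\<forall>\<^sub>F \<epsilon> in at_right 0. norm (E \<epsilon>) \<le> \<epsilon> powr \<sigma> * B"
      using ev
    proof eventually_elim
      case (elim \<epsilon>)
      have "norm (E \<epsilon>) \<le> \<epsilon> powr (\<sigma> - 1 + 1) * B"
        unfolding E_def B_def
        by (rule scaled_arc_integral_le[OF Fc _ _ cc continuous_on_subset[OF c(2)] c0 bd]) (use elim U in auto)
      then show ?case by simp
    qed
    show "((\<lambda>\<epsilon>. \<epsilon> powr \<sigma> * B) \<longlongrightarrow> 0) (at_right 0)"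
      using \<sigma> by real_asymp
  qed
  then have 2: "((\<lambda>\<epsilon>. integral {s0..s1} (\<lambda>s. c' s *\<^sub>C F (c s)) - E \<epsilon>) \<longlongrightarrow>
      integral {s0..s1} (\<lambda>s. c' s *\<^sub>C F (c s)) - 0) (at_right 0)"
    by (intro tendsto_intros)
  have "\<forall>\<^sub>F \<epsilon> in at_right 0. integral {\<epsilon>..1} (\<lambda>t. c s1 *\<^sub>C F (of_real t * c s1)) -
      integral {\<epsilon>..1} (\<lambda>t. c s0 *\<^sub>C F (of_real t * c s0)) =
      integral {s0..s1} (\<lambda>s. c' s *\<^sub>C F (c s)) - E \<epsilon>"
    using ev
  proof eventually_elim
    case (elim \<epsilon>)
    have "integral {\<epsilon>..1} (\<lambda>t. c s1 *\<^sub>C F (of_real t * c s1)) - integral {\<epsilon>..1} (\<lambda>t. c s0 *\<^sub>C F (of_real t * c s0)) =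
       integral {s0..s1} (\<lambda>s. (of_real 1 * c' s) *\<^sub>C F (of_real 1 * c s)) - E \<epsilon>"
      unfolding E_def by (rule cauchy_cone[OF F le _ _ c]) (use elim U in auto)
    then show ?case by simp
  qed
  from tendsto_unique[OF trivial_limit_at_right_real Lim_transform_eventually[OF 1 this] 2]
  show ?thesis by simp
qed

text \<open>The counterpart of \<open>seg_diff\<close> for the unbounded region beyond the arc, obtained by truncating the cone at a
large factor \<open>R\<close>.\<close>

lemma tail_diff:
  fixes F :: "complex \<Rightarrow> 'b::complex_banach"
  assumes \<sigma>: "\<sigma> > 0" and F: "F vec_holomorphic_on U" and le: "s0 \<le> s1"
    and U: "\<And>s t. s0 \<le> s \<Longrightarrow> s \<le> s1 \<Longrightarrow> 1 \<le> t \<Longrightarrow> of_real t * c s \<in> U"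
    and bd: "\<And>z. z \<in> U \<Longrightarrow> norm (F z) \<le> M * cmod z powr (- \<sigma> - 1)"
    and c: "\<And>s. (c has_vector_derivative c' s) (at s)" "continuous_on UNIV c'"
    and c0: "\<And>s. s0 \<le> s \<Longrightarrow> s \<le> s1 \<Longrightarrow> c s \<noteq> 0"
  shows "tail (c s1) F - tail (c s0) F = - integral {s0..s1} (\<lambda>s. c' s *\<^sub>C F (c s))"
proof -
  note Fc = vec_holomorphic_on_imp_continuous_on[OF F]
  have cc: "continuous_on S c" for S
    by (intro continuous_at_imp_continuous_on ballI has_vector_derivative_continuous[OF c(1)])
  define E where "E R = integral {s0..s1} (\<lambda>s. (of_real R * c' s) *\<^sub>C F (of_real R * c s))" for R :: real
  define B where "B = integral {s0..s1} (\<lambda>s. cmod (c' s) * (M * cmod (c s) powr (- \<sigma> - 1)))"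
  have ev: "\<forall>\<^sub>F R in at_top. 1 < (R::real)" by (rule eventually_gt_at_top)
  have lim: "((\<lambda>R. integral {1..R} (\<lambda>t. c s *\<^sub>C F (of_real t * c s))) \<longlongrightarrow> tail (c s) F) at_top"
    if "s0 \<le> s" "s \<le> s1" for s
    by (rule tail_improper(2)[OF \<sigma> Fc _ bd]) (use U that in auto)
  have 1: "((\<lambda>R. integral {1..R} (\<lambda>t. c s1 *\<^sub>C F (of_real t * c s1)) -
      integral {1..R} (\<lambda>t. c s0 *\<^sub>C F (of_real t * c s0))) \<longlongrightarrow> tail (c s1) F - tail (c s0) F) at_top"
    by (intro tendsto_diff lim) (use le in auto)
  have "(E \<longlongrightarrow> 0) at_top"
  proof (rule Lim_null_comparison)
    show "\<forall>\<^sub>F R in at_top. norm (E R) \<le> R powr (- \<sigma>) * B"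
      using ev
    proof eventually_elim
      case (elim R)
      have "norm (E R) \<le> R powr (- \<sigma> - 1 + 1) * B"
        unfolding E_def B_def
        by (rule scaled_arc_integral_le[OF Fc _ _ cc continuous_on_subset[OF c(2)] c0 bd]) (use elim U in auto)
      then show ?case by simp
    qed
    show "((\<lambda>R. R powr (- \<sigma>) * B) \<longlongrightarrow> 0) at_top"
      using \<sigma> by real_asymp
  qed
  then have 2: "((\<lambda>R. E R - integral {s0..s1} (\<lambda>s. c' s *\<^sub>C F (c s))) \<longlongrightarrow>
      0 - integral {s0..s1} (\<lambda>s. c' s *\<^sub>C F (c s))) at_top"
    by (intro tendsto_intros)
  have "\<forall>\<^sub>F R in at_top. integral {1..R} (\<lambda>t. c s1 *\<^sub>C F (of_real t * c s1)) -
      integral {1..R} (\<lambda>t. c s0 *\<^sub>C F (of_real t * c s0)) =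
      E R - integral {s0..s1} (\<lambda>s. c' s *\<^sub>C F (c s))"
    using ev
  proof eventually_elim
    case (elim R)
    have "integral {1..R} (\<lambda>t. c s1 *\<^sub>C F (of_real t * c s1)) - integral {1..R} (\<lambda>t. c s0 *\<^sub>C F (of_real t * c s0)) =
       E R - integral {s0..s1} (\<lambda>s. (of_real 1 * c' s) *\<^sub>C F (of_real 1 * c s))"
      unfolding E_def by (rule cauchy_cone[OF F le _ _ c]) (use elim U in auto)
    then show ?case by simp
  qed
  from tendsto_unique[OF trivial_limit_at_top_linorder Lim_transform_eventually[OF 1 this] 2]
  show ?thesis by simp
qed

lemma integral_rescale:
  fixes f :: "real \<Rightarrow> 'b::banach"
  assumes "a > 0" "f integrable_on {a * x..a * y}"
  shows "integral {x..y} (\<lambda>t. a *\<^sub>R f (a * t)) = integral {a * x..a * y} f"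
proof -
  have "(f has_integral integral {a * x..a * y} f) {a * x..a * y}" using assms by blast
  from has_integral_stretch_real[OF this, of a]
  have "((\<lambda>t. f (a * t)) has_integral (1 / a) *\<^sub>R integral {a * x..a * y} f) {x..y}"
    using assms(1) by simp
  from has_integral_cmul[OF this, of a]
  have "((\<lambda>t. a *\<^sub>R f (a * t)) has_integral integral {a * x..a * y} f) {x..y}"
    using assms(1) by simp
  then show ?thesis by (rule integral_unique)
qed

text \<open>The intermediate point may be any positive multiple of \<open>w\<close>; a linear substitution absorbs the factor \<open>a\<close>.\<close>

lemma ray_integral_split:
  fixes F :: "complex \<Rightarrow> 'b::complex_banach"
  assumes \<sigma>: "\<sigma> > 0" and a: "a > 0" and F: "continuous_on U F"
    and U: "\<And>t. 0 < t \<Longrightarrow> of_real t * w \<in> U"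
    and bd: "\<And>z. z \<in> U \<Longrightarrow> norm (F z) \<le> M * cmod z powr (\<sigma> - 1)"
      "\<And>z. z \<in> U \<Longrightarrow> norm (F z) \<le> M * cmod z powr (- \<sigma> - 1)"
  shows "ray_integral w F = seg (of_real a * w) F + tail (of_real a * w) F"
proof -
  define f where "f t = w *\<^sub>C F (of_real t * w)" for t :: real
  have c: "continuous_on {0<..} f"
    unfolding f_def by (rule continuous_on_ray[OF F]) (use U in auto)
  have b1: "norm (f t) \<le> (M * cmod w powr (\<sigma> - 1 + 1)) * t powr (\<sigma> - 1)" if "0 < t" for t
    unfolding f_def by (rule norm_ray_le[where F = F and w = w, OF bd(1)[OF U[OF that]] that])
  have b2: "norm (f t) \<le> (M * cmod w powr (- \<sigma> - 1 + 1)) * t powr (- \<sigma> - 1)" if "0 < t" for t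
    unfolding f_def by (rule norm_ray_le[where F = F and w = w, OF bd(2)[OF U[OF that]] that])
  have i0: "f integrable_on {0..a}"
    by (rule improper_integral_at_0(1)[OF \<sigma> a continuous_on_subset[OF c] b1]) auto
  have ai: "f integrable_on {a..}" "((\<lambda>R. integral {a..R} f) \<longlongrightarrow> integral {a..} f) at_top"
    by (rule improper_integral_at_top[OF \<sigma> a continuous_on_subset[OF c] b2]; use a in auto)+
  have sc: "(of_real a * w) *\<^sub>C F (of_real t * (of_real a * w)) = a *\<^sub>R f (a * t)" for t
  proof -
    have "of_real t * (of_real a * w) = of_real (a * t) * w" by (simp add: mult_ac)
    then show ?thesis unfolding f_def by (metis scaleC_of_real scaleC_scaleC)
  qed
  have seg: "seg (of_real a * w) F = integral {0..a} f"
    unfolding seg_def sc using integral_rescale[OF a, of f 0 1] i0 by simp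
  have tl: "((\<lambda>R. integral {1..R} (\<lambda>t. a *\<^sub>R f (a * t))) \<longlongrightarrow> tail (of_real a * w) F) at_top"
    using tail_improper(2)[OF \<sigma> F _ bd(2), of "of_real a * w"] U[of "_ * a"] a
    unfolding sc by (auto simp: mult.assoc)
  have lim: "((\<lambda>R. integral {a..a * R} f) \<longlongrightarrow> integral {a..} f) at_top"
    by (rule filterlim_compose[OF ai(2)]) (use a in real_asymp)
  have eq: "integral {a..a * R} f = integral {1..R} (\<lambda>t. a *\<^sub>R f (a * t))" for R
  proof -
    have "f integrable_on {a..a * R}"
      by (rule integrable_continuous_real, rule continuous_on_subset[OF c]) (use a in auto)
    then show ?thesis using integral_rescale[OF a, of f 1 R] by simp
  qed
  have "integral {a..} f = tail (of_real a * w) F"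
    by (rule tendsto_unique[OF trivial_limit_at_top_linorder lim[unfolded eq] tl])
  then show ?thesis
    using integral_half_line_split[OF a i0 ai(1)] seg
    unfolding ray_integral_def f_def[symmetric] by simp
qed

section \<open>Integrals along the boundary of a Stolz domain\<close>

text \<open>The argument of \<open>\<lambda> = 1 - z\<close> on the arc of the boundary of the Stolz domain of angle \<open>s\<close>; it runs over
\<open>t \<in> [0, 1]\<close> from one point of tangency, at \<open>\<pi>/2 - s\<close>, to the other.\<close>

definition stolz_angle :: "real \<Rightarrow> real \<Rightarrow> real" where
  "stolz_angle s t = (pi / 2 - s) + t * (pi + 2 * s)"

definition stolz_arc :: "complex \<Rightarrow> real \<Rightarrow> real \<Rightarrow> complex" where
  "stolz_arc u s t = u * (1 - of_real (sin s) * cis (stolz_angle s t))"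

definition stolz_arc_dt :: "complex \<Rightarrow> real \<Rightarrow> real \<Rightarrow> complex" where
  "stolz_arc_dt u s t = - (u * of_real (sin s) * of_real (pi + 2 * s) * \<i> * cis (stolz_angle s t))"

definition stolz_arc_ds :: "complex \<Rightarrow> real \<Rightarrow> real \<Rightarrow> complex" where
  "stolz_arc_ds u s t = - (u * (of_real (cos s) + of_real (sin s * (2 * t - 1)) * \<i>) * cis (stolz_angle s t))"

definition stolz_arc_dst :: "complex \<Rightarrow> real \<Rightarrow> real \<Rightarrow> complex" where
  "stolz_arc_dst u s t = - (u * (of_real (cos s * (pi + 2 * s) + 2 * sin s) * \<i>
      - of_real (sin s * (2 * t - 1) * (pi + 2 * s))) * cis (stolz_angle s t))"

lemma stolz_arc_derivs:
  "((\<lambda>s. stolz_arc u s t) has_vector_derivative stolz_arc_ds u s t) (at s)"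
  "((\<lambda>t. stolz_arc u s t) has_vector_derivative stolz_arc_dt u s t) (at t)"
  "((\<lambda>s. stolz_arc_dt u s t) has_vector_derivative stolz_arc_dst u s t) (at s)"
  "((\<lambda>t. stolz_arc_ds u s t) has_vector_derivative stolz_arc_dst u s t) (at t)"
  unfolding has_vector_derivative_def stolz_arc_def stolz_arc_ds_def stolz_arc_dt_def stolz_arc_dst_def
    stolz_angle_def
  by (auto intro!: derivative_eq_intros simp: fun_eq_iff scaleR_conv_of_real algebra_simps)

lemma stolz_arc_continuous:
  "continuous_on UNIV (\<lambda>x. stolz_arc u (fst x) (snd x))"
  "continuous_on UNIV (\<lambda>x. stolz_arc_ds u (fst x) (snd x))"
  "continuous_on UNIV (\<lambda>x. stolz_arc_dt u (fst x) (snd x))"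
  "continuous_on UNIV (\<lambda>x. stolz_arc_dst u (fst x) (snd x))"
  "continuous_on UNIV (\<lambda>s. stolz_arc_ds u s t)"
  "continuous_on S (\<lambda>t. stolz_arc_dt u s t)"
  "continuous_on S (\<lambda>t. stolz_arc u s t)"
  unfolding stolz_arc_def stolz_arc_ds_def stolz_arc_dt_def stolz_arc_dst_def stolz_angle_def
  by (intro continuous_intros)+

text \<open>The points of tangency lie on the two rays bounding the sector of angle \<open>s\<close>, at distance \<open>cos s\<close> from the vertex.\<close>

lemma stolz_arc_ends:
  "stolz_arc u s 0 = of_real (cos s) * (u * cis (- s))"
  "stolz_arc u s 1 = of_real (cos s) * (u * cis s)"
proof -
  have ss: "sin s * sin s = 1 - cos s * cos s"
    by (metis cos_squared_eq power2_eq_square sin_squared_eq)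
  show "stolz_arc u s 0 = of_real (cos s) * (u * cis (- s))"
    by (simp add: stolz_arc_def stolz_angle_def complex_eq_iff cos_diff sin_diff algebra_simps ss)
  have "stolz_angle s 1 = pi / 2 + s + pi" by (simp add: stolz_angle_def algebra_simps)
  then have "cis (stolz_angle s 1) = cis (pi / 2) * cis s * cis pi" by (simp only: cis_mult)
  then have a: "cis (stolz_angle s 1) = - (\<i> * cis s)" by simp
  show "stolz_arc u s 1 = of_real (cos s) * (u * cis s)"
    unfolding stolz_arc_def a by (simp add: complex_eq_iff algebra_simps ss)
qed

text \<open>The counterclockwise boundary integral over the Stolz domain rotated by \<open>u\<close>, in the variable \<open>z = 1 - \<lambda>\<close>: out from
the vertex along the lower edge, along the arc, and back to the vertex along the upper edge.\<close>

definition stolz_integral :: "complex \<Rightarrow> real \<Rightarrow> (complex \<Rightarrow> 'b::complex_banach) \<Rightarrow> 'b" where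
  "stolz_integral u s F = seg (stolz_arc u s 0) F
     + integral {0..1} (\<lambda>t. stolz_arc_dt u s t *\<^sub>C F (stolz_arc u s t))
     - seg (stolz_arc u s 1) F"

lemma stolz_arc_nonzero:
  assumes "u \<noteq> 0" "0 \<le> s" "s < pi / 2"
  shows "stolz_arc u s t \<noteq> 0"
proof
  assume "stolz_arc u s t = 0"
  then have "of_real (sin s) * cis (stolz_angle s t) = 1" using assms by (simp add: stolz_arc_def)
  then have "cmod (of_real (sin s) * cis (stolz_angle s t)) = 1" by simp
  then have "\<bar>sin s\<bar> = 1" by (simp add: norm_mult)
  moreover have "\<bar>sin s\<bar> < 1"
    using sin_monotone_2pi[of s "pi/2"] sin_ge_zero[of s] assms by auto
  ultimately show False by simp
qed

lemma arc_integrable: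
  fixes F :: "complex \<Rightarrow> 'b::complex_banach"
  assumes "continuous_on U F" "\<And>t. 0 \<le> t \<Longrightarrow> t \<le> 1 \<Longrightarrow> stolz_arc u s t \<in> U"
  shows "(\<lambda>t. stolz_arc_dt u s t *\<^sub>C F (stolz_arc u s t)) integrable_on {0..1}"
  by (intro integrable_continuous_real scaleC.continuous_on stolz_arc_continuous
        continuous_on_compose2[OF assms(1) stolz_arc_continuous(7)]) (use assms in auto)

text \<open>As \<open>s\<close> varies, the end points of the arc slide along the end points of the two edges. So the boundary terms
that Cauchy's theorem produces for the arc cancel those for the edges.\<close>

lemma stolz_integral_angle_independent:
  fixes F :: "complex \<Rightarrow> 'b::complex_banach"
  assumes \<sigma>: "\<sigma> > 0" and F: "F vec_holomorphic_on U" and u: "u \<noteq> 0"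
    and s: "0 \<le> s0" "s0 \<le> s1" "s1 < pi / 2"
    and edge: "\<And>s t. s0 \<le> s \<Longrightarrow> s \<le> s1 \<Longrightarrow> 0 < t \<Longrightarrow> t \<le> 1 \<Longrightarrow>
        of_real t * stolz_arc u s 0 \<in> U \<and> of_real t * stolz_arc u s 1 \<in> U"
    and arc: "\<And>s t. s0 \<le> s \<Longrightarrow> s \<le> s1 \<Longrightarrow> 0 \<le> t \<Longrightarrow> t \<le> 1 \<Longrightarrow> stolz_arc u s t \<in> U"
    and bd: "\<And>z. z \<in> U \<Longrightarrow> norm (F z) \<le> M * cmod z powr (\<sigma> - 1)"
  shows "stolz_integral u s0 F = stolz_integral u s1 F"
proof -
  have e: "seg (stolz_arc u s1 i) F - seg (stolz_arc u s0 i) F =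
      integral {s0..s1} (\<lambda>s. stolz_arc_ds u s i *\<^sub>C F (stolz_arc u s i))" if "i = 0 \<or> i = 1" for i
    by (rule seg_diff[OF \<sigma> F s(2) _ bd stolz_arc_derivs(1) stolz_arc_continuous(5)])
       (use edge that stolz_arc_nonzero[OF u] s in auto)
  have a: "integral {0..1} (\<lambda>t. stolz_arc_dt u s1 t *\<^sub>C F (stolz_arc u s1 t))
      - integral {0..1} (\<lambda>t. stolz_arc_dt u s0 t *\<^sub>C F (stolz_arc u s0 t)) =
      integral {s0..s1} (\<lambda>s. stolz_arc_ds u s 1 *\<^sub>C F (stolz_arc u s 1))
      - integral {s0..s1} (\<lambda>s. stolz_arc_ds u s 0 *\<^sub>C F (stolz_arc u s 0))"
    by (rule cauchy_quadrilateral[OF F s(2) zero_le_one arc stolz_arc_derivs stolz_arc_continuous(1-4)])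
  show ?thesis using e[of 0] e[of 1] a unfolding stolz_integral_def by (simp add: algebra_simps)
qed

text \<open>Both contours contain the two edges; the remaining parts, the half-lines beyond the points of tangency and the arc,
bound a region that is swept out by the multiples \<open>r \<ge> 1\<close> of the arc.\<close>

lemma sector_integral_eq_stolz_integral:
  fixes F :: "complex \<Rightarrow> 'b::complex_banach"
  assumes \<sigma>: "\<sigma> > 0" and F: "F vec_holomorphic_on U" and u: "u \<noteq> 0" and \<nu>: "0 < \<nu>" "\<nu> < pi / 2"
    and edge: "\<And>t. 0 < t \<Longrightarrow> of_real t * (u * cis \<nu>) \<in> U \<and> of_real t * (u * cis (- \<nu>)) \<in> U"
    and arc: "\<And>t r. 0 \<le> t \<Longrightarrow> t \<le> 1 \<Longrightarrow> 1 \<le> r \<Longrightarrow> of_real r * stolz_arc u \<nu> t \<in> U"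
    and bd: "\<And>z. z \<in> U \<Longrightarrow> norm (F z) \<le> M * cmod z powr (\<sigma> - 1)"
       "\<And>z. z \<in> U \<Longrightarrow> norm (F z) \<le> M * cmod z powr (- \<sigma> - 1)"
  shows "- ray_integral (u * cis \<nu>) F + ray_integral (u * cis (- \<nu>)) F = stolz_integral u \<nu> F"
proof -
  note Fc = vec_holomorphic_on_imp_continuous_on[OF F]
  have cos: "cos \<nu> > 0" using \<nu> by (intro cos_gt_zero) auto
  have r1: "ray_integral (u * cis \<nu>) F = seg (stolz_arc u \<nu> 1) F + tail (stolz_arc u \<nu> 1) F"
    unfolding stolz_arc_ends by (rule ray_integral_split[OF \<sigma> cos Fc _ bd]) (use edge in auto)
  have r0: "ray_integral (u * cis (-\<nu>)) F = seg (stolz_arc u \<nu> 0) F + tail (stolz_arc u \<nu> 0) F"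
    unfolding stolz_arc_ends by (rule ray_integral_split[OF \<sigma> cos Fc _ bd]) (use edge in auto)
  have "tail (stolz_arc u \<nu> 1) F - tail (stolz_arc u \<nu> 0) F =
     - integral {0..1} (\<lambda>t. stolz_arc_dt u \<nu> t *\<^sub>C F (stolz_arc u \<nu> t))"
    by (rule tail_diff[OF \<sigma> F zero_le_one _ bd(2) stolz_arc_derivs(2) stolz_arc_continuous(6)])
       (use arc stolz_arc_nonzero[OF u] \<nu> in auto)
  then show ?thesis unfolding r0 r1 stolz_integral_def by (simp add: algebra_simps)
qed

text \<open>The parts of the ray inside and outside the circle through \<open>u\<close> change by opposite multiples of the integral along the same
circular arc.\<close>

lemma ray_integral_rotate:
  fixes F :: "complex \<Rightarrow> 'b::complex_banach"
  assumes \<sigma>: "\<sigma> > 0" and F: "F vec_holomorphic_on U" and u: "u \<noteq> 0" and le: "s0 \<le> s1"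
    and U: "\<And>s t. s0 \<le> s \<Longrightarrow> s \<le> s1 \<Longrightarrow> 0 < t \<Longrightarrow> of_real t * (u * cis s) \<in> U"
    and bd: "\<And>z. z \<in> U \<Longrightarrow> norm (F z) \<le> M * cmod z powr (\<sigma> - 1)"
       "\<And>z. z \<in> U \<Longrightarrow> norm (F z) \<le> M * cmod z powr (- \<sigma> - 1)"
  shows "ray_integral (u * cis s0) F = ray_integral (u * cis s1) F"
proof -
  note Fc = vec_holomorphic_on_imp_continuous_on[OF F]
  have r: "ray_integral (u * cis s) F = seg (u * cis s) F + tail (u * cis s) F" if "s0 \<le> s" "s \<le> s1" for s
    using ray_integral_split[OF \<sigma> zero_less_one Fc _ bd, of "u * cis s"] U that by simp
  have d: "((\<lambda>s. u * cis s) has_vector_derivative u * (\<i> * cis s)) (at s)" for s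
    unfolding has_vector_derivative_def
    by (auto intro!: derivative_eq_intros simp: fun_eq_iff scaleR_conv_of_real algebra_simps)
  have c: "continuous_on UNIV (\<lambda>s. u * (\<i> * cis s))" by (intro continuous_intros)
  have "seg (u * cis s1) F - seg (u * cis s0) F =
      integral {s0..s1} (\<lambda>s. (u * (\<i> * cis s)) *\<^sub>C F (u * cis s))"
    by (rule seg_diff[OF \<sigma> F le _ bd(1) d c]) (use U u in auto)
  moreover have "tail (u * cis s1) F - tail (u * cis s0) F =
      - integral {s0..s1} (\<lambda>s. (u * (\<i> * cis s)) *\<^sub>C F (u * cis s))"
    by (rule tail_diff[OF \<sigma> F le _ bd(2) d c]) (use U u in auto)
  ultimately show ?thesis using r[of s0] r[of s1] le by (simp add: algebra_simps)
qed

lemma stolz_integral_add: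
  fixes F G :: "complex \<Rightarrow> 'b::complex_banach"
  assumes "\<sigma> > 0" "\<tau> > 0" and cont: "continuous_on U F" "continuous_on U G"
    and edge: "\<And>t. 0 < t \<Longrightarrow> t \<le> 1 \<Longrightarrow> of_real t * stolz_arc u s 0 \<in> U \<and> of_real t * stolz_arc u s 1 \<in> U"
    and arc: "\<And>t. 0 \<le> t \<Longrightarrow> t \<le> 1 \<Longrightarrow> stolz_arc u s t \<in> U"
    and bd: "\<And>z. z \<in> U \<Longrightarrow> norm (F z) \<le> M * cmod z powr (\<sigma> - 1)"
      "\<And>z. z \<in> U \<Longrightarrow> norm (G z) \<le> N * cmod z powr (\<tau> - 1)"
  shows "stolz_integral u s (\<lambda>z. F z + G z) = stolz_integral u s F + stolz_integral u s G"
proof -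
  have "seg (stolz_arc u s i) (\<lambda>z. F z + G z) = seg (stolz_arc u s i) F + seg (stolz_arc u s i) G"
    if "i = 0 \<or> i = 1" for i
    unfolding seg_def scaleC.add_right
    by (rule integral_add; rule seg_improper(1)[OF assms(1) cont(1) _ bd(1)] seg_improper(1)[OF assms(2) cont(2) _ bd(2)])
       (use edge that in auto)
  moreover have "integral {0..1} (\<lambda>t. stolz_arc_dt u s t *\<^sub>C (F (stolz_arc u s t) + G (stolz_arc u s t))) =
     integral {0..1} (\<lambda>t. stolz_arc_dt u s t *\<^sub>C F (stolz_arc u s t)) +
     integral {0..1} (\<lambda>t. stolz_arc_dt u s t *\<^sub>C G (stolz_arc u s t))"
    unfolding scaleC.add_right
    by (intro integral_add arc_integrable[OF cont(1)] arc_integrable[OF cont(2)] arc)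
  ultimately show ?thesis unfolding stolz_integral_def by (simp add: algebra_simps)
qed

text \<open>The edges have length at most \<open>1\<close> and the arc has length at most \<open>2\<pi>\<close>.\<close>

lemma norm_stolz_integral_le:
  fixes F :: "complex \<Rightarrow> 'b::complex_banach"
  assumes cont: "continuous_on U F" and u: "cmod u = 1" and s: "0 \<le> s" "s \<le> pi / 2"
    and edge: "\<And>t. 0 < t \<Longrightarrow> t \<le> 1 \<Longrightarrow> of_real t * stolz_arc u s 0 \<in> U \<and> of_real t * stolz_arc u s 1 \<in> U"
    and arc: "\<And>t. 0 \<le> t \<Longrightarrow> t \<le> 1 \<Longrightarrow> stolz_arc u s t \<in> U"
    and bd: "\<And>z. z \<in> U \<Longrightarrow> norm (F z) \<le> B" and B: "B \<ge> 0" and zU: "0 \<notin> U"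
  shows "norm (stolz_integral u s F) \<le> (2 + 2 * pi) * B"
proof -
  have b: "norm (F z) \<le> B * cmod z powr (1 - 1)" if "z \<in> U" for z
    using bd[OF that] that zU by (cases "z = 0") auto
  have sg: "norm (seg (stolz_arc u s i) F) \<le> B" if "i = 0 \<or> i = 1" for i
  proof -
    have "norm (seg (stolz_arc u s i) F) \<le> B * cmod (stolz_arc u s i) powr 1 / 1"
      by (rule seg_improper(3)[OF _ cont _ b]) (use edge that in auto)
    also have "\<dots> \<le> B"
      using that B u abs_cos_le_one[of s] by (auto simp: stolz_arc_ends norm_mult mult_left_le)
    finally show ?thesis .
  qed
  have "norm (integral {0..1} (\<lambda>t. stolz_arc_dt u s t *\<^sub>C F (stolz_arc u s t))) \<le> (2 * pi * B) * (1 - 0)"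
  proof (rule integral_bound)
    show "continuous_on {0..1} (\<lambda>t. stolz_arc_dt u s t *\<^sub>C F (stolz_arc u s t))"
      by (intro scaleC.continuous_on stolz_arc_continuous
          continuous_on_compose2[OF cont stolz_arc_continuous(7)]) (use arc in auto)
    fix t :: real assume t: "t \<in> {0..1}"
    have "cmod (stolz_arc_dt u s t) = \<bar>sin s\<bar> * \<bar>pi + 2 * s\<bar>"
      using u by (simp add: stolz_arc_dt_def norm_mult del: of_real_add)
    also have "\<dots> \<le> 1 * (2 * pi)"
      using s by (intro mult_mono) auto
    finally show "norm (stolz_arc_dt u s t *\<^sub>C F (stolz_arc u s t)) \<le> 2 * pi * B"
      unfolding norm_scaleC using bd[OF arc] t by (intro mult_mono) auto
  qed auto
  then have "norm (stolz_integral u s F) \<le> B + 2 * pi * B + B"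
    unfolding stolz_integral_def
    by (intro order_trans[OF norm_triangle_ineq4] order_trans[OF norm_triangle_ineq] add_mono sg) auto
  then show ?thesis by (simp add: algebra_simps)
qed

section \<open>Geometry of sectors and Stolz domains\<close>

lemma Re_eq_cmod_cos_Arg: "Re z = cmod z * cos (Arg z)"
  using rcis_cmod_Arg[of z] by (metis Re_rcis)

text \<open>Without \<open>Arg\<close>, a sector is given by an inequality between continuous functions, from which openness and the
shape of its closure can be read off.\<close>

lemma sector_eq:
  assumes "0 < \<omega>" "\<omega> \<le> pi"
  shows "sector \<omega> = {z. cos \<omega> * cmod z < Re z}"
proof -
  have "\<bar>Arg z\<bar> < \<omega> \<longleftrightarrow> cos \<omega> * cmod z < Re z" if "z \<noteq> 0" for z
  proof -
    have "\<bar>Arg z\<bar> \<le> pi" using mpi_less_Arg[of z] Arg_le_pi[of z] by auto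
    then have "\<bar>Arg z\<bar> < \<omega> \<longleftrightarrow> cos \<omega> < cos \<bar>Arg z\<bar>"
      using assms by (subst cos_mono_less_eq) auto
    also have "\<dots> \<longleftrightarrow> cos \<omega> < cos (Arg z)" by (simp add: abs_if)
    finally show ?thesis using that by (simp add: Re_eq_cmod_cos_Arg[of z] mult.commute)
  qed
  moreover have "z \<noteq> 0" if "cos \<omega> * cmod z < Re z" for z using that by auto
  ultimately show ?thesis by (auto simp: sector_def)
qed

lemma cis_in_sector: "r > 0 \<Longrightarrow> \<bar>x\<bar> < \<omega> \<Longrightarrow> \<omega> \<le> pi \<Longrightarrow> of_real r * cis x \<in> sector \<omega>"
  by (auto simp: sector_eq norm_mult cos_mono_less_eq[of \<omega> "\<bar>x\<bar>", simplified])

lemma open_sector: "0 < \<omega> \<Longrightarrow> \<omega> \<le> pi \<Longrightarrow> open (sector \<omega>)"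
  by (auto simp: sector_eq intro!: open_Collect_less continuous_intros)

lemma sector_mono: "\<omega> \<le> \<omega>' \<Longrightarrow> sector \<omega> \<subseteq> sector \<omega>'"
  by (auto simp: sector_def)

lemma n_sector_mono: "\<omega> \<le> \<omega>' \<Longrightarrow> n_sector n \<omega> \<subseteq> n_sector n \<omega>'"
  unfolding n_sector_def using sector_mono by fast

lemma norm_rot [simp]: "cmod (rot n j) = 1"
  by (simp add: rot_def)

lemma rot_nonzero [simp]: "rot n j \<noteq> 0"
  using norm_rot by (metis norm_zero zero_neq_one)

lemma cnj_rot_mult [simp]: "cnj (rot n j) * (rot n j * z) = z" "rot n j * (cnj (rot n j) * z) = z"
  by (simp_all add: complex_norm_square[symmetric] mult.assoc[symmetric] mult.commute[of "cnj _"])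

lemma in_rot_image_iff: "z \<in> (\<lambda>z. rot n j * z) ` S \<longleftrightarrow> cnj (rot n j) * z \<in> S"
  by (metis (no_types, lifting) cnj_rot_mult image_iff)

lemma cmod_diff_of_real_squared: "(cmod (z - of_real t))\<^sup>2 = (cmod z)\<^sup>2 - 2 * t * Re z + t\<^sup>2"
  by (simp only: cmod_power2) (simp add: power2_eq_square algebra_simps)

text \<open>The disc with centre \<open>t\<close> and radius \<open>t sin s\<close> is tangent to the boundary of the sector of angle \<open>s\<close>.\<close>

lemma cone_of_disc:
  assumes "cmod (z - of_real t) \<le> t * sin s" "0 \<le> t" "0 \<le> s" "s < pi / 2"
  shows "cos s * cmod z \<le> Re z"
proof (cases "t = 0")
  case False
  then have t: "t > 0" using assms by simp
  have "(cmod (z - of_real t))\<^sup>2 \<le> (t * sin s)\<^sup>2" by (intro power_mono assms(1)) auto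
  then have "(cmod z)\<^sup>2 - 2 * t * Re z + t\<^sup>2 \<le> t\<^sup>2 * (sin s)\<^sup>2"
    by (simp add: cmod_diff_of_real_squared power_mult_distrib)
  then have "(cmod z)\<^sup>2 + t\<^sup>2 * (cos s)\<^sup>2 \<le> 2 * t * Re z"
    by (simp add: sin_squared_eq algebra_simps)
  moreover have "0 \<le> (cmod z - t * cos s)\<^sup>2" by simp
  ultimately have "t * (cos s * cmod z) \<le> t * Re z" by (simp add: power2_eq_square algebra_simps)
  then show ?thesis using t by simp
qed (use assms in auto)

lemma cone_of_disc_strict:
  assumes "cmod (z - of_real t) < t * sin s" "0 < t" "0 \<le> s" "s < pi / 2"
  shows "cos s * cmod z < Re z"
proof -
  have "(cmod (z - of_real t))\<^sup>2 < (t * sin s)\<^sup>2" by (intro power_strict_mono assms(1)) auto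
  then have "(cmod z)\<^sup>2 - 2 * t * Re z + t\<^sup>2 < t\<^sup>2 * (sin s)\<^sup>2"
    by (simp add: cmod_diff_of_real_squared power_mult_distrib)
  then have "(cmod z)\<^sup>2 + t\<^sup>2 * (cos s)\<^sup>2 < 2 * t * Re z"
    by (simp add: sin_squared_eq algebra_simps)
  moreover have "0 \<le> (cmod z - t * cos s)\<^sup>2" by simp
  ultimately have "t * (cos s * cmod z) < t * Re z" by (simp add: power2_eq_square algebra_simps)
  then show ?thesis using assms(2) by simp
qed

text \<open>The convex hull of \<open>1\<close> and a disc about \<open>0\<close> consists of the discs obtained by contracting it towards \<open>1\<close>. In the
variable \<open>1 - \<lambda>\<close> these are the discs with centre \<open>t\<close> and radius \<open>t sin \<gamma>\<close>, and passing to the interior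
removes only the vertex \<open>t = 0\<close>.\<close>

lemma stolz_shift_eq:
  assumes "0 < \<gamma>" "\<gamma> < pi"
  shows "stolz_shift \<gamma> = {z. \<exists>t. 0 < t \<and> t \<le> 1 \<and> cmod (z - of_real t) < t * sin \<gamma>}"
proof -
  define r where "r = sin \<gamma>"
  have r: "0 < r" "r \<le> 1" using assms by (auto simp: r_def sin_gt_zero)
  define H where "H = convex hull (insert 1 (ball 0 r) :: complex set)"
  define B where "B = (\<Union>t\<in>{0<..1}. ball (1 - complex_of_real t) (t * r))"
  have HB: "H = insert 1 B"
  proof (intro equalityI subsetI)
    fix w assume "w \<in> H"
    then obtain a b z where w: "a \<ge> 0" "b \<ge> 0" "a + b = 1" "z \<in> ball 0 r" "w = a *\<^sub>R 1 + b *\<^sub>R z"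
      unfolding H_def using r convex_hull_insert[of "ball 0 r" "1::complex"]
      by (auto simp: convex_hull_eq[THEN iffD2, OF convex_ball])
    show "w \<in> insert 1 B"
    proof (cases "b = 0")
      case False
      have "w - (1 - of_real b) = of_real b * z"
        using w by (simp add: scaleR_conv_of_real algebra_simps flip: of_real_add)
      then have "cmod (w - (1 - of_real b)) < b * r"
        using w(1-4) False by (simp add: norm_mult)
      then have "w \<in> ball (1 - of_real b) (b * r)"
        by (simp add: dist_norm norm_minus_commute)
      then show ?thesis using w False unfolding B_def by fastforce
    qed (use w in auto)
  next
    fix w assume "w \<in> insert 1 B"
    then consider "w = 1" | t where "0 < t" "t \<le> 1" "w \<in> ball (1 - of_real t) (t * r)"
      unfolding B_def by auto
    then show "w \<in> H"
    proof cases
      case 1 then show ?thesis unfolding H_def by (simp add: hull_inc)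
    next
      case 2
      define z where "z = (w - (1 - of_real t)) / of_real t"
      have "cmod (w - (1 - of_real t)) < t * r" using 2 by (simp add: dist_norm norm_minus_commute)
      then have "z \<in> ball 0 r" using 2 by (simp add: z_def norm_divide field_simps)
      moreover have "w = (1 - t) *\<^sub>R 1 + t *\<^sub>R z"
        using 2 by (simp add: z_def scaleR_conv_of_real)
      moreover have "1 \<in> H" "z \<in> H" unfolding H_def using \<open>z \<in> ball 0 r\<close> by (auto intro: hull_inc)
      moreover have "convex H" unfolding H_def by (rule convex_convex_hull)
      ultimately show ?thesis using 2 by (auto intro: convexD_alt)
    qed
  qed
  have "interior H = B"
  proof
    have "open B" unfolding B_def by auto
    then show "B \<subseteq> interior H" using HB by (auto intro: interiorI)
    have "1 \<notin> interior H"
    proof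
      assume "1 \<in> interior H"
      then obtain e where e: "e > 0" "ball 1 e \<subseteq> H" using mem_interior by blast
      have "1 + of_real (e / 2) \<in> ball (1::complex) e" using e by (simp add: dist_norm)
      then have "1 + complex_of_real (e / 2) \<in> insert 1 B" using e HB by blast
      then have "1 + complex_of_real (e / 2) \<in> B" using e(1) by auto
      then obtain t where t: "0 < t" "t \<le> 1" and "1 + complex_of_real (e / 2) \<in> ball (1 - of_real t) (t * r)"
        unfolding B_def by (auto simp del: mem_ball)
      then have tr: "cmod (1 + of_real (e / 2) - (1 - of_real t)) < t * r"
        by (simp only: mem_ball dist_norm norm_minus_commute)
      have "1 + complex_of_real (e / 2) - (1 - of_real t) = of_real (e / 2 + t)" by simp
      then have "e / 2 + t < t * r" using tr t e by (metis abs_of_pos norm_of_real add_pos_pos half_gt_zero)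
      moreover have "t * r \<le> t" using t r by (simp add: mult_left_le)
      ultimately show False using e by simp
    qed
    then show "interior H \<subseteq> B" using interior_subset[of H] HB by auto
  qed
  then have "stolz_shift \<gamma> = (\<lambda>z. 1 - z) ` B"
    unfolding stolz_shift_def stolz_def H_def r_def by simp
  also have "\<dots> = {z. \<exists>t. 0 < t \<and> t \<le> 1 \<and> cmod (z - of_real t) < t * r}"
  proof (intro equalityI subsetI)
    fix z assume "z \<in> (\<lambda>z. 1 - z) ` B"
    then show "z \<in> {z. \<exists>t. 0 < t \<and> t \<le> 1 \<and> cmod (z - of_real t) < t * r}"
      unfolding B_def by (fastforce simp: dist_norm algebra_simps)
  next
    fix z assume "z \<in> {z. \<exists>t. 0 < t \<and> t \<le> 1 \<and> cmod (z - of_real t) < t * r}"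
    then have "1 - z \<in> B"
      unfolding B_def by (fastforce simp: dist_norm algebra_simps)
    then show "z \<in> (\<lambda>z. 1 - z) ` B" by (metis diff_diff_eq2 add_diff_cancel_left' image_eqI)
  qed
  finally show ?thesis by (simp add: r_def)
qed

lemma open_stolz_shift: "0 < \<gamma> \<Longrightarrow> \<gamma> < pi \<Longrightarrow> open (stolz_shift \<gamma>)"
proof -
  assume \<gamma>: "0 < \<gamma>" "\<gamma> < pi"
  have "stolz_shift \<gamma> = (\<Union>t\<in>{0<..1}. ball (complex_of_real t) (t * sin \<gamma>))"
    unfolding stolz_shift_eq[OF \<gamma>] by (auto simp: dist_norm norm_minus_commute)
  then show ?thesis by auto
qed

lemma stolz_shift_subset_sector: "0 < \<gamma> \<Longrightarrow> \<gamma> < pi / 2 \<Longrightarrow> stolz_shift \<gamma> \<subseteq> sector \<gamma>"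
  by (auto simp: stolz_shift_eq sector_eq cone_of_disc_strict)

lemma stolz_shift_mono:
  assumes "0 < s" "s \<le> \<gamma>" "\<gamma> \<le> pi / 2"
  shows "stolz_shift s \<subseteq> stolz_shift \<gamma>"
proof -
  have "sin s \<le> sin \<gamma>" using assms by (intro sin_monotone_2pi_le) auto
  then show ?thesis
    using assms by (auto simp: stolz_shift_eq) (meson less_le_trans mult_left_mono less_imp_le)
qed

lemma convex_stolz_shift: "convex (stolz_shift \<gamma>)"
proof -
  have "stolz_shift \<gamma> = (\<lambda>z. 1 + (-1) *\<^sub>R z) ` stolz \<gamma>" by (simp add: stolz_shift_def)
  then show ?thesis
    by (simp only:) (intro convex_affinity, simp add: stolz_def convex_interior)
qed

lemma norm_stolz_shift_less:
  assumes "0 < \<gamma>" "\<gamma> < pi" "z \<in> stolz_shift \<gamma>"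
  shows "cmod z < 2"
proof -
  obtain t where t: "0 < t" "t \<le> 1" "cmod (z - of_real t) < t * sin \<gamma>"
    using assms by (auto simp: stolz_shift_eq)
  have "cmod z \<le> cmod (z - of_real t) + t" using norm_triangle_sub[of z "of_real t"] t by simp
  also have "\<dots> < t * sin \<gamma> + t" using t by simp
  also have "\<dots> \<le> 2" using t sin_le_one[of \<gamma>] mult_mono[of t 1 "sin \<gamma>" 1] sin_gt_zero[of \<gamma>] assms by auto
  finally show ?thesis .
qed

text \<open>The tangent from the vertex in direction \<open>s\<close> touches the disc of radius \<open>sin \<bar>s\<bar>\<close> about \<open>1\<close> at distance
\<open>cos \<bar>s\<bar>\<close>, so up to this distance the ray stays in the larger Stolz domain.\<close>

lemma ray_in_stolz_shift:
  assumes "0 < r" "r \<le> cos \<bar>s\<bar>" "\<bar>s\<bar> < \<gamma>" "\<gamma> < pi / 2"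
  shows "of_real r * cis s \<in> stolz_shift \<gamma>"
proof -
  have c: "cos s > 0" using assms by (intro cos_gt_zero_pi) auto
  define t where "t = r / cos s"
  have t: "0 < t" "t \<le> 1" using assms c by (auto simp: t_def abs_if split: if_splits)
  have ss: "sin s * sin s = 1 - cos s * cos s"
    by (metis cos_squared_eq power2_eq_square sin_squared_eq)
  have "of_real r * cis s - of_real t = of_real t * (of_real (cos s) * cis s - 1)"
    using c by (simp add: t_def field_simps)
  also have "of_real (cos s) * cis s - 1 = \<i> * of_real (sin s) * cis s"
    by (simp add: complex_eq_iff ss algebra_simps)
  finally have "cmod (of_real r * cis s - of_real t) = t * \<bar>sin s\<bar>"
    using t by (simp add: norm_mult)
  also have "\<bar>sin s\<bar> = sin \<bar>s\<bar>" using assms sin_ge_zero[of "\<bar>s\<bar>"] by (auto simp: abs_if split: if_splits)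
  also have "t * sin \<bar>s\<bar> < t * sin \<gamma>"
    using t assms by (intro mult_strict_left_mono sin_monotone_2pi) auto
  finally show ?thesis using t assms by (auto simp: stolz_shift_eq)
qed

lemma cos_less_cos_of_separated:
  assumes "0 < a" "a \<le> pi" "a < y" "y < 2 * pi - a"
  shows "cos y < cos a"
proof (cases "y \<le> pi")
  case True
  then show ?thesis using assms by (intro cos_monotone_0_pi) auto
next
  case False
  have "cos (2 * pi - y) < cos a" using assms False by (intro cos_monotone_0_pi) auto
  then show ?thesis by (simp add: cos_diff)
qed

text \<open>Distinct sectors with axes along the \<open>n\<close>-th roots of unity and half-angles below \<open>\<pi>/n\<close> meet at the vertex only,
even after taking closures: a point within angle \<open>s\<close> of the axis \<open>j\<close> has an angle strictly between \<open>\<pi>/n\<close> and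
\<open>2\<pi> - \<pi>/n\<close> to the axis \<open>k\<close>.\<close>

lemma cone_unique:
  assumes "j < n" "k < n" "z \<noteq> 0" and s: "0 \<le> s" "s < pi / real n" "0 \<le> \<alpha>" "\<alpha> < pi / real n"
    and zj: "cos s * cmod z \<le> Re (cnj (rot n j) * z)" and zk: "cos \<alpha> * cmod z \<le> Re (cnj (rot n k) * z)"
  shows "j = k"
proof (rule ccontr)
  assume "j \<noteq> k"
  have n: "n > 0" using assms by auto
  have pn: "0 < pi / real n" "pi / real n \<le> pi" using n by (auto simp: field_simps)
  define w where "w = cnj (rot n j) * z"
  have w: "w \<noteq> 0" "cmod w = cmod z" using assms by (auto simp: w_def norm_mult)
  define x where "x = Arg w"
  have x: "\<bar>x\<bar> \<le> pi" using mpi_less_Arg[of w] Arg_le_pi[of w] by (auto simp: x_def)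
  have "cos s \<le> cos \<bar>x\<bar>" using zj w Re_eq_cmod_cos_Arg[of w] by (simp add: w_def x_def mult.commute abs_if)
  then have xs: "\<bar>x\<bar> \<le> s" using x s pn by (subst (asm) cos_mono_le_eq) auto
  have z: "z = rot n j * w" by (simp add: w_def)
  have weq: "w = of_real (cmod z) * cis x" using w rcis_cmod_Arg[of w] by (simp add: x_def rcis_def)
  have r: "cnj (rot n k) * rot n j = cis (2 * (real j - real k) * pi / real n)"
    by (simp add: rot_def cis_cnj cis_mult algebra_simps diff_divide_distrib)
  have "cnj (rot n k) * z = (cnj (rot n k) * rot n j) * w" unfolding z by (simp only: mult.assoc)
  also have "\<dots> = cis (2 * (real j - real k) * pi / real n) * (of_real (cmod z) * cis x)"
    by (simp only: r weq[symmetric])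
  also have "\<dots> = of_real (cmod z) * cis (2 * (real j - real k) * pi / real n + x)"
    by (simp only: cis_mult[symmetric] mult_ac)
  finally have "cos \<alpha> \<le> cos (2 * (real j - real k) * pi / real n + x)"
    using zk \<open>z \<noteq> 0\<close> by (simp add: mult.commute)
  moreover have "cos (2 * (real j - real k) * pi / real n + x) < cos (pi / real n)"
  proof -
    define P where "P = pi / real n"
    have P: "0 < P" "P \<le> pi" "s < P" using pn s by (auto simp: P_def)
    have nP: "(real n - 1) * (2 * P) = 2 * pi - 2 * P" using n by (simp add: P_def field_simps)
    have sep: "cos (d * (2 * P) + y) < cos P" if "1 \<le> d" "d \<le> real n - 1" "\<bar>y\<bar> \<le> s" for d y
    proof -
      have "1 * (2 * P) \<le> d * (2 * P)" "d * (2 * P) \<le> (real n - 1) * (2 * P)"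
        using that P by (auto intro!: mult_right_mono)
      then show ?thesis using that(3) P nP by (intro cos_less_cos_of_separated) linarith+
    qed
    have arg: "2 * (real j - real k) * pi / real n + x = (real j - real k) * (2 * P) + x"
      by (simp add: P_def)
    show ?thesis
    proof (cases "j > k")
      case True
      then show ?thesis unfolding arg P_def[symmetric] using assms xs by (intro sep) auto
    next
      case False
      have "cos ((real k - real j) * (2 * P) + (- x)) < cos P"
        using assms xs False \<open>j \<noteq> k\<close> by (intro sep) auto
      moreover have "(real j - real k) * (2 * P) + x = - ((real k - real j) * (2 * P) + (- x))"
        by (simp add: algebra_simps)
      ultimately show ?thesis unfolding arg P_def[symmetric] by (simp only: cos_minus)
    qed
  qed
  moreover have "cos (pi / real n) \<le> cos \<alpha>" using s pn by (intro cos_monotone_0_pi_le) auto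
  ultimately show False by simp
qed

text \<open>Explicit closed sets containing the closures of \<open>n_sector\<close> and of \<open>1 - n_stolz\<close>. Their complements are the open sets
on which the resolvent of \<open>A\<close> is used; since \<open>0\<close> belongs to both sets when \<open>n > 0\<close>, it does not lie in such a complement.\<close>

definition closed_n_sector :: "nat \<Rightarrow> real \<Rightarrow> complex set" where
  "closed_n_sector n \<omega> = (\<Union>j<n. {z. cos \<omega> * cmod z \<le> Re (cnj (rot n j) * z)})"

definition closed_n_stolz_shift :: "nat \<Rightarrow> real \<Rightarrow> complex set" where
  "closed_n_stolz_shift n \<alpha> = (\<Union>j<n. (\<lambda>z. rot n j * z) ` {z. \<exists>t. 0 \<le> t \<and> t \<le> 1 \<and> cmod (z - of_real t) \<le> t * sin \<alpha>})"

lemma closure_n_sector_subset: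
  assumes "0 < \<omega>" "\<omega> \<le> pi"
  shows "closure (n_sector n \<omega>) \<subseteq> closed_n_sector n \<omega>"
proof (rule closure_minimal)
  show "n_sector n \<omega> \<subseteq> closed_n_sector n \<omega>"
    using assms by (force simp: n_sector_def closed_n_sector_def in_rot_image_iff sector_eq norm_mult)
  show "closed (closed_n_sector n \<omega>)"
    unfolding closed_n_sector_def by (intro closed_UN ballI closed_Collect_le continuous_intros) auto
qed

lemma compact_closed_stolz:
  assumes "0 < \<alpha>" "\<alpha> < pi"
  shows "compact {z. \<exists>t. 0 \<le> t \<and> t \<le> 1 \<and> cmod (z - of_real t) \<le> t * sin \<alpha>}" (is "compact ?K")
proof -
  have sa: "sin \<alpha> > 0" using assms by (simp add: sin_gt_zero)
  have "?K = (\<lambda>(t, w). of_real t + of_real (t * sin \<alpha>) * (w::complex)) ` ({0..1} \<times> cball 0 1)"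
  proof (intro equalityI subsetI)
    fix z assume "z \<in> ?K"
    then obtain t where t: "0 \<le> t" "t \<le> 1" "cmod (z - of_real t) \<le> t * sin \<alpha>" by auto
    define w where "w = (z - of_real t) / of_real (t * sin \<alpha>)"
    have "cmod w \<le> 1"
    proof (cases "t = 0")
      case False
      then have "0 < t * sin \<alpha>" using t sa by simp
      then show ?thesis using t(3) by (simp add: w_def norm_divide abs_of_pos del: of_real_mult)
    qed (simp add: w_def)
    moreover have "z = of_real t + of_real (t * sin \<alpha>) * w"
      using t sa by (cases "t = 0") (auto simp: w_def)
    ultimately show "z \<in> (\<lambda>(t, w). of_real t + of_real (t * sin \<alpha>) * (w::complex)) ` ({0..1} \<times> cball 0 1)"
      using t by (auto intro!: image_eqI[of _ _ "(t, w)"])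
  next
    fix z assume "z \<in> (\<lambda>(t, w). of_real t + of_real (t * sin \<alpha>) * (w::complex)) ` ({0..1} \<times> cball 0 1)"
    then obtain t w where t: "0 \<le> t" "t \<le> 1" "cmod w \<le> 1" "z = of_real t + of_real (t * sin \<alpha>) * w" by auto
    then have "cmod (z - of_real t) \<le> t * sin \<alpha>"
      using sa by (simp add: norm_mult mult_left_le)
    then show "z \<in> ?K" using t by auto
  qed
  also have "compact \<dots>"
    unfolding case_prod_unfold
    by (intro compact_continuous_image compact_Times continuous_intros) auto
  finally show ?thesis .
qed

lemma closure_n_stolz_subset:
  assumes "0 < \<alpha>" "\<alpha> < pi" "w \<in> closure (n_stolz n \<alpha>)"
  shows "1 - w \<in> closed_n_stolz_shift n \<alpha>"
proof -
  have "compact (closed_n_stolz_shift n \<alpha>)"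
    unfolding closed_n_stolz_shift_def
    by (intro compact_UN compact_continuous_image compact_closed_stolz assms continuous_intros) auto
  then have "compact ((\<lambda>z. 1 - z) ` closed_n_stolz_shift n \<alpha>)"
    by (intro compact_continuous_image continuous_intros)
  then have "closure (n_stolz n \<alpha>) \<subseteq> (\<lambda>z. 1 - z) ` closed_n_stolz_shift n \<alpha>"
  proof (intro closure_minimal compact_imp_closed)
    show "n_stolz n \<alpha> \<subseteq> (\<lambda>z. 1 - z) ` closed_n_stolz_shift n \<alpha>"
      unfolding n_stolz_def closed_n_stolz_shift_def stolz_shift_eq[OF assms(1,2)]
      by (intro image_mono UN_mono subset_refl) (use less_imp_le in blast)
  qed
  then show ?thesis using assms(3) by auto
qed

lemma closed_n_stolz_shift_subset:
  assumes "0 < \<alpha>" "\<alpha> < pi / 2"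
  shows "closed_n_stolz_shift n \<alpha> \<subseteq> closed_n_sector n \<alpha>"
  using assms cone_of_disc
  by (fastforce simp: closed_n_stolz_shift_def closed_n_sector_def in_rot_image_iff norm_mult)

lemma ray_notin_closed_n_sector:
  assumes "j < n" "0 < r" "0 < \<omega>" "\<omega> < \<bar>x\<bar>" "\<bar>x\<bar> < pi / real n"
  shows "of_real r * (rot n j * cis x) \<notin> closed_n_sector n \<omega>"
proof
  assume "of_real r * (rot n j * cis x) \<in> closed_n_sector n \<omega>" (is "?z \<in> _")
  then obtain k where k: "k < n" "cos \<omega> * cmod ?z \<le> Re (cnj (rot n k) * ?z)"
    unfolding closed_n_sector_def by auto
  have n: "pi / real n \<le> pi" using assms by (auto simp: field_simps)
  have e: "cnj (rot n j) * ?z = of_real r * cis x"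
    by (metis cnj_rot_mult(1) mult.left_commute)
  have "cos \<bar>x\<bar> * cmod ?z \<le> Re (cnj (rot n j) * ?z)"
    unfolding e using assms by (simp add: norm_mult)
  then have "j = k"
    using cone_unique[of j n k ?z "\<bar>x\<bar>" \<omega>] k assms by (auto simp: norm_mult)
  then have "cos \<omega> * cmod ?z \<le> Re (of_real r * cis x)" using k(2) e by metis
  then have "cos \<omega> \<le> cos \<bar>x\<bar>" using assms(2) by (simp add: norm_mult mult.commute)
  then show False using assms n by (subst (asm) cos_mono_le_eq) auto
qed

lemma stolz_arc_mem:
  assumes "0 < s" "s < \<gamma>" "\<gamma> < pi / 2"
  shows "stolz_arc u s t \<in> (\<lambda>z. u * z) ` stolz_shift \<gamma>"
proof -
  define w where "w = 1 - of_real (sin s) * cis (stolz_angle s t)"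
  have "sin s > 0" using assms by (intro sin_gt_zero) auto
  then have "cmod (w - of_real 1) = sin s" by (simp add: w_def norm_mult)
  moreover have "sin s < sin \<gamma>" using assms by (intro sin_monotone_2pi) auto
  ultimately have "w \<in> stolz_shift \<gamma>"
    using assms by (auto simp: stolz_shift_eq intro!: exI[of _ 1])
  then show ?thesis by (auto simp: stolz_arc_def w_def)
qed

lemma stolz_edge_mem:
  assumes "0 < s" "s < \<gamma>" "\<gamma> < pi / 2" "0 < t" "t \<le> 1"
  shows "of_real t * stolz_arc u s 0 \<in> (\<lambda>z. u * z) ` stolz_shift \<gamma>"
    and "of_real t * stolz_arc u s 1 \<in> (\<lambda>z. u * z) ` stolz_shift \<gamma>"
proof -
  have c: "cos s > 0" using assms by (intro cos_gt_zero) auto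
  have "of_real (t * cos s) * cis x \<in> stolz_shift \<gamma>" if "\<bar>x\<bar> = s" for x
    using assms c that by (intro ray_in_stolz_shift) (auto simp: mult_le_cancel_right1)
  from this[of "-s"] this[of s]
  have "u * (of_real (t * cos s) * cis (-s)) \<in> (\<lambda>z. u * z) ` stolz_shift \<gamma>"
    "u * (of_real (t * cos s) * cis s) \<in> (\<lambda>z. u * z) ` stolz_shift \<gamma>"
    using assms by auto
  then show "of_real t * stolz_arc u s 0 \<in> (\<lambda>z. u * z) ` stolz_shift \<gamma>"
    and "of_real t * stolz_arc u s 1 \<in> (\<lambda>z. u * z) ` stolz_shift \<gamma>"
    unfolding stolz_arc_ends of_real_mult by (simp_all only: mult_ac)
qed

lemma cos_stolz_angle_le:
  assumes "0 \<le> s" "s \<le> pi / 2" "0 \<le> t" "t \<le> 1"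
  shows "cos (stolz_angle s t) \<le> sin s"
proof -
  define y where "y = stolz_angle s t - pi"
  have "0 \<le> t * (pi + 2 * s)" "t * (pi + 2 * s) \<le> 1 * (pi + 2 * s)"
    using assms by (simp, intro mult_right_mono) auto
  then have "\<bar>y\<bar> \<le> pi / 2 + s" by (auto simp: y_def stolz_angle_def)
  then have "cos (pi / 2 + s) \<le> cos \<bar>y\<bar>" using assms by (intro cos_monotone_0_pi_le) auto
  then have "- sin s \<le> cos y" by (simp add: cos_add abs_if split: if_splits)
  moreover have "cos (stolz_angle s t) = - cos y" by (simp add: y_def cos_diff)
  ultimately show ?thesis by simp
qed

text \<open>The arc of a Stolz domain, and everything beyond it in its cone, avoids every Stolz domain of smaller angle. In the
other directions this is \<open>cone_unique\<close>. In the same direction, scaling back by \<open>1/r\<close> reduces to \<open>r = 1\<close>, where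
the explicit description by discs leads to a contradictory quadratic inequality in the disc parameter.\<close>

lemma stolz_arc_notin_closed:
  assumes n: "n > 1" "j < n" and s: "0 < \<alpha>" "\<alpha> < s" "s < pi / real n" and t: "0 \<le> t" "t \<le> 1" and r: "1 \<le> r"
  shows "of_real r * stolz_arc (rot n j) s t \<notin> closed_n_stolz_shift n \<alpha>"
proof
  define a where "a = 1 - of_real (sin s) * cis (stolz_angle s t)"
  have "pi / real n \<le> pi / 2" using n by (simp add: field_simps)
  then have n2: "s < pi / 2" using s(3) by linarith
  have ss: "0 < sin s" "sin s < 1" "sin \<alpha> < sin s" "0 < sin \<alpha>"
    using s(1,2) n2 sin_monotone_2pi[of s "pi/2"] sin_monotone_2pi[of \<alpha> s] by (auto intro!: sin_gt_zero)
  have a0: "a \<noteq> 0"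
    using stolz_arc_nonzero[of 1 s t] s n2 by (simp add: stolz_arc_def a_def)
  define z where "z = of_real r * stolz_arc (rot n j) s t"
  assume "of_real r * stolz_arc (rot n j) s t \<in> closed_n_stolz_shift n \<alpha>"
  then obtain k t' where k: "k < n" "0 \<le> t'" "t' \<le> 1" "cmod (cnj (rot n k) * z - of_real t') \<le> t' * sin \<alpha>"
    unfolding closed_n_stolz_shift_def z_def by (auto simp: in_rot_image_iff)
  have zj: "cnj (rot n j) * z = of_real r * a"
    unfolding z_def stolz_arc_def a_def by (metis cnj_rot_mult(1) mult.left_commute)
  have "cmod (a - of_real 1) \<le> 1 * sin s" using ss by (simp add: a_def norm_mult)
  then have "cos s * cmod a \<le> Re a" by (rule cone_of_disc) (use s n2 in auto)
  then have "cos s * cmod z \<le> Re (cnj (rot n j) * z)"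
    unfolding zj using r by (simp add: z_def stolz_arc_def norm_mult flip: a_def)
  moreover have "cos \<alpha> * cmod z \<le> Re (cnj (rot n k) * z)"
    using cone_of_disc[OF k(4) k(2)] s n2 by (simp add: norm_mult)
  moreover have "z \<noteq> 0" using a0 r by (auto simp: z_def stolz_arc_def simp flip: a_def)
  ultimately have "j = k" using cone_unique[of j n k z s \<alpha>] k n s by auto
  \<comment> \<open>\<open>v\<close> is the parameter of the disc containing the unscaled point \<open>a\<close>; \<open>v \<le> 1\<close> because \<open>r \<ge> 1\<close>.\<close>
  define v where "v = t' / r"
  have v: "0 \<le> v" "v \<le> 1" using k r by (auto simp: v_def divide_le_eq)
  have "cmod (of_real r * a - of_real t') \<le> t' * sin \<alpha>" using k(4) \<open>j = k\<close> zj by simp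
  moreover have "of_real r * a - of_real t' = of_real r * (a - of_real v)"
    using r by (simp add: v_def algebra_simps)
  ultimately have "r * cmod (a - of_real v) \<le> r * (v * sin \<alpha>)" using r by (simp add: norm_mult v_def)
  then have av: "cmod (a - of_real v) \<le> v * sin \<alpha>" using r by simp
  have "v \<noteq> 0" using av a0 by auto
  then have "v * sin \<alpha> < v * sin s" using v ss by simp
  with av have "cmod (a - of_real v) < v * sin s" by simp
  then have "(cmod (a - of_real v))\<^sup>2 < (v * sin s)\<^sup>2" by (intro power_strict_mono) auto
  then have 1: "(cmod a)\<^sup>2 - 2 * v * Re a + v\<^sup>2 < v\<^sup>2 * (sin s)\<^sup>2"
    by (simp add: cmod_diff_of_real_squared power_mult_distrib)
  define C where "C = cos (stolz_angle s t)"
  have C: "C \<le> sin s" unfolding C_def by (rule cos_stolz_angle_le) (use s n2 t in auto)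
  have Rea: "Re a = 1 - sin s * C" by (simp add: a_def C_def)
  have "(cmod (a - of_real 1))\<^sup>2 = (sin s)\<^sup>2" using ss by (simp add: a_def norm_mult)
  then have ca: "(cmod a)\<^sup>2 = (sin s)\<^sup>2 + 2 * Re a - 1"
    using cmod_diff_of_real_squared[of a 1] by simp
  have "(1 - v) * (sin s * C) \<le> (1 - v) * (sin s * sin s)"
    using v ss C by (intro mult_left_mono) auto
  moreover have "(sin s)\<^sup>2 * (1 - v)\<^sup>2 \<le> 1 * (1 - v)\<^sup>2"
    using ss by (intro mult_right_mono) (auto simp: power_le_one)
  ultimately show False
    using 1 unfolding ca Rea by (simp add: power2_eq_square algebra_simps)
qed

text \<open>The edges lie on rays of angle \<open>s > \<alpha>\<close>, outside the closed sectors of angle \<open>\<alpha>\<close>.\<close>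

lemma stolz_edge_notin_closed:
  assumes n: "n > 1" "j < n" and s: "0 < \<alpha>" "\<alpha> < s" "s < pi / real n" and t: "0 < t"
  shows "of_real t * stolz_arc (rot n j) s 0 \<notin> closed_n_stolz_shift n \<alpha>"
    and "of_real t * stolz_arc (rot n j) s 1 \<notin> closed_n_stolz_shift n \<alpha>"
proof -
  have "pi / real n \<le> pi / 2" using n by (simp add: field_simps)
  then have n2: "s < pi / 2" using s(3) by linarith
  have c: "cos s > 0" using s(1,2) n2 by (intro cos_gt_zero) auto
  have "of_real (t * cos s) * (rot n j * cis x) \<notin> closed_n_stolz_shift n \<alpha>" if "\<bar>x\<bar> = s" for x
    using ray_notin_closed_n_sector[of j n "t * cos s" \<alpha> x] closed_n_stolz_shift_subset[of \<alpha> n] that s t c n n2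
    by (auto simp del: of_real_mult)
  from this[of "-s"] this[of s]
  show "of_real t * stolz_arc (rot n j) s 0 \<notin> closed_n_stolz_shift n \<alpha>"
    and "of_real t * stolz_arc (rot n j) s 1 \<notin> closed_n_stolz_shift n \<alpha>"
    using s unfolding stolz_arc_ends by (simp_all add: mult.assoc)
qed

lemma scaled_in_sector:
  assumes "z \<in> sector \<omega>" "r > 0"
  shows "of_real r * z \<in> sector \<omega>"
proof -
  have "Arg (of_real r * z) = Arg z" using assms(2) by simp
  then show ?thesis using assms by (auto simp: sector_def)
qed

section \<open>Resolvents\<close>

lemma vec_holomorphic_on_scaleC:
  assumes f: "f holomorphic_on U" "open U" and G: "G vec_holomorphic_on U"
  shows "(\<lambda>z. f z *\<^sub>C G z) vec_holomorphic_on U"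
proof -
  obtain G' where G': "\<And>z. z \<in> U \<Longrightarrow> (G has_derivative (\<lambda>h. h *\<^sub>C G' z)) (at z)" "continuous_on U G'"
    using G unfolding vec_holomorphic_on_def by blast
  show ?thesis unfolding vec_holomorphic_on_def
  proof (intro exI conjI ballI)
    fix z assume z: "z \<in> U"
    have "(f has_derivative (\<lambda>h. deriv f z * h)) (at z)"
      using holomorphic_derivI[OF f z] by (simp add: has_field_derivative_def)
    from scaleC.FDERIV[OF this G'(1)[OF z]]
    show "((\<lambda>z. f z *\<^sub>C G z) has_derivative (\<lambda>h. h *\<^sub>C (f z *\<^sub>C G' z + deriv f z *\<^sub>C G z))) (at z)"
      by (simp add: scaleC_scaleC scaleC.add_right mult.commute)
  next
    show "continuous_on U (\<lambda>z. f z *\<^sub>C G' z + deriv f z *\<^sub>C G z)"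
      by (intro continuous_intros scaleC.continuous_on G' holomorphic_on_imp_continuous_on f
          holomorphic_deriv vec_holomorphic_on_imp_continuous_on[OF G])
  qed
qed

lemma is_resolvent_unique:
  assumes "is_resolvent D A z S" "is_resolvent D A z S'"
  shows "S = S'"
proof (rule blinfun_eqI)
  fix x
  have "blinfun_apply S' (z *\<^sub>C blinfun_apply S x - A (blinfun_apply S x)) = blinfun_apply S x"
    using assms unfolding is_resolvent_def by blast
  moreover have "z *\<^sub>C blinfun_apply S x - A (blinfun_apply S x) = x"
    using assms unfolding is_resolvent_def by blast
  ultimately show "blinfun_apply S x = blinfun_apply S' x" by simp
qed

lemma resolvent_eqI: "is_resolvent D A z S \<Longrightarrow> resolvent D A z = S"
  unfolding resolvent_def using is_resolvent_unique by blast

lemma is_resolvent_resolvent: "z \<notin> spectrum D A \<Longrightarrow> is_resolvent D A z (resolvent D A z)"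
  unfolding spectrum_def using resolvent_eqI by auto

lemma resolvent_identity:
  assumes "z \<notin> spectrum UNIV A" "w \<notin> spectrum UNIV A"
  shows "resolvent UNIV A w - resolvent UNIV A z = (z - w) *\<^sub>C (resolvent UNIV A w o\<^sub>L resolvent UNIV A z)"
proof (rule blinfun_eqI)
  fix x
  define Rw Rz where "Rw = resolvent UNIV A w" and "Rz = resolvent UNIV A z"
  have Rz: "z *\<^sub>C blinfun_apply Rz x - A (blinfun_apply Rz x) = x"
    using is_resolvent_resolvent[OF assms(1)] unfolding is_resolvent_def Rz_def by blast
  have Rw: "Rw \<in> bounded_ops" "\<And>y. blinfun_apply Rw (w *\<^sub>C y - A y) = y"
    using is_resolvent_resolvent[OF assms(2)] unfolding is_resolvent_def Rw_def by blast+
  define y where "y = blinfun_apply Rz x"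
  have "x = (w *\<^sub>C y - A y) + (z - w) *\<^sub>C y"
    using Rz by (simp add: y_def scaleC.diff_left)
  then have "blinfun_apply Rw x = y + (z - w) *\<^sub>C blinfun_apply Rw y"
    using Rw by (simp add: blinfun.add_right bounded_ops_def)
  then show "blinfun_apply (resolvent UNIV A w - resolvent UNIV A z) x =
      blinfun_apply ((z - w) *\<^sub>C (resolvent UNIV A w o\<^sub>L resolvent UNIV A z)) x"
    unfolding Rw_def[symmetric] Rz_def[symmetric]
    by (simp add: blinfun.diff_left blinfun_apply_scaleC y_def)
qed

text \<open>The form in which both sectoriality and the Ritt condition are used: \<open>z R(z, A)\<close> is bounded on an open subset of
the resolvent set.\<close>

definition resolvent_dominated :: "('a::complex_banach \<Rightarrow> 'a) \<Rightarrow> complex set \<Rightarrow> real \<Rightarrow> bool" where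
  "resolvent_dominated A \<Omega> C \<longleftrightarrow> open \<Omega> \<and> 0 \<notin> \<Omega> \<and> C \<ge> 0 \<and>
     (\<forall>z\<in>\<Omega>. z \<notin> spectrum UNIV A \<and> cmod z * norm (resolvent UNIV A z) \<le> C)"

lemma resolvent_dominated_norm_le:
  assumes "resolvent_dominated A \<Omega> C" "z \<in> \<Omega>"
  shows "norm (resolvent UNIV A z) \<le> C / cmod z"
proof -
  have "z \<noteq> 0" "cmod z * norm (resolvent UNIV A z) \<le> C"
    using assms unfolding resolvent_dominated_def by auto
  then show ?thesis by (simp add: field_simps)
qed

text \<open>The bound makes the resolvent locally bounded, and the resolvent identity then yields first continuity and then the
derivative \<open>- R(z)\<^sup>2\<close>.\<close>

lemma resolvent_vec_holomorphic:
  assumes "resolvent_dominated A \<Omega> C"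
  shows "resolvent UNIV A vec_holomorphic_on \<Omega>"
proof -
  define R where "R = resolvent UNIV A"
  have op: "open \<Omega>" "0 \<notin> \<Omega>" "C \<ge> 0" and sp: "\<And>z. z \<in> \<Omega> \<Longrightarrow> z \<notin> spectrum UNIV A"
    using assms unfolding resolvent_dominated_def by auto
  have id: "R w - R z = (z - w) *\<^sub>C (R w o\<^sub>L R z)" if "z \<in> \<Omega>" "w \<in> \<Omega>" for z w
    unfolding R_def using that sp by (intro resolvent_identity) auto
  have der: "(R has_derivative (\<lambda>h. h *\<^sub>C - (R z o\<^sub>L R z))) (at z)" if z: "z \<in> \<Omega>" for z
  proof -
    have z0: "z \<noteq> 0" using z op by auto
    define K where "K = 2 * C / cmod z"
    obtain d where d: "d > 0" "ball z d \<subseteq> \<Omega>" using op z open_contains_ball by blast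
    define e where "e = min d (cmod z / 2)"
    have e: "e > 0" using d z0 by (simp add: e_def)
    have K: "norm (R w) \<le> K" if "w \<in> ball z e" for w
    proof -
      have w: "w \<in> \<Omega>" using that d by (auto simp: e_def)
      have w0: "w \<noteq> 0" using w op by auto
      have "cmod z - cmod w \<le> cmod (z - w)" by (rule norm_triangle_ineq2)
      then have wz: "cmod w \<ge> cmod z / 2" using that by (simp add: e_def dist_norm)
      have "norm (R w) \<le> C / cmod w" unfolding R_def by (rule resolvent_dominated_norm_le[OF assms w])
      also have "\<dots> \<le> C / (cmod z / 2)" using wz z0 op w0 by (intro divide_left_mono) auto
      finally show ?thesis by (simp add: K_def mult.commute)
    qed
    have est: "norm (R w - R z - (w - z) *\<^sub>C - (R z o\<^sub>L R z)) / norm (w - z) \<le> norm (w - z) * (K * K * K)"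
      if w: "w \<in> ball z e" "w \<noteq> z" for w
    proof -
      have w\<Omega>: "w \<in> \<Omega>" using w d by (auto simp: e_def)
      have "R w - R z - (w - z) *\<^sub>C - (R z o\<^sub>L R z) = (z - w) *\<^sub>C (R w o\<^sub>L R z) - (z - w) *\<^sub>C (R z o\<^sub>L R z)"
        using id[OF z w\<Omega>] by (simp add: scaleC.minus_right scaleC.diff_left)
      also have "\<dots> = (z - w) *\<^sub>C ((R w - R z) o\<^sub>L R z)"
        by (simp add: scaleC.diff_right bounded_bilinear.diff_left[OF bounded_bilinear_blinfun_compose])
      also have "\<dots> = (z - w) *\<^sub>C (((z - w) *\<^sub>C (R w o\<^sub>L R z)) o\<^sub>L R z)"
        by (simp only: id[OF z w\<Omega>])
      finally have "norm (R w - R z - (w - z) *\<^sub>C - (R z o\<^sub>L R z)) =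
          cmod (z - w) * norm (((z - w) *\<^sub>C (R w o\<^sub>L R z)) o\<^sub>L R z)"
        by (simp add: norm_scaleC)
      also have "\<dots> \<le> cmod (z - w) * (cmod (z - w) * (K * K) * K)"
      proof (intro mult_left_mono order_trans[OF norm_blinfun_compose] mult_mono)
        have "norm (R w o\<^sub>L R z) \<le> K * K"
          using K[of w] K[of z] w e by (intro order_trans[OF norm_blinfun_compose] mult_mono) (auto intro: order_trans[OF norm_ge_zero])
        then show "norm ((z - w) *\<^sub>C (R w o\<^sub>L R z)) \<le> cmod (z - w) * (K * K)"
          unfolding norm_scaleC by (intro mult_left_mono) auto
        show "norm (R z) \<le> K" using K[of z] e by simp
      qed (auto simp: K_def op)
      finally show ?thesis using w(2) by (simp add: divide_le_eq norm_minus_commute mult_ac)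
    qed
    have "((\<lambda>w. norm (R w - R z - (w - z) *\<^sub>C - (R z o\<^sub>L R z)) / norm (w - z)) \<longlongrightarrow> 0) (at z)"
    proof (rule Lim_null_comparison)
      show "\<forall>\<^sub>F w in at z. norm (norm (R w - R z - (w - z) *\<^sub>C - (R z o\<^sub>L R z)) / norm (w - z)) \<le> norm (w - z) * (K * K * K)"
        unfolding eventually_at using e est
        by (intro exI[of _ e]) (auto simp: dist_commute)
      have "((\<lambda>w. norm (w - z) * (K * K * K)) \<longlongrightarrow> norm (z - z) * (K * K * K)) (at z)"
        by (intro tendsto_intros)
      then show "((\<lambda>w. norm (w - z) * (K * K * K)) \<longlongrightarrow> 0) (at z)" by simp
    qed
    then show ?thesis
      unfolding has_derivative_iff_norm using scaleC.bounded_linear_left by auto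
  qed
  have cR: "continuous_on \<Omega> R"
    by (intro continuous_at_imp_continuous_on ballI has_derivative_continuous[OF der])
  show ?thesis
    unfolding R_def[symmetric] vec_holomorphic_on_def
    using der cR by (intro exI[of _ "\<lambda>z. - (R z o\<^sub>L R z)"]) (auto intro!: continuous_intros)
qed

lemma is_resolvent_one_minus_iff:
  fixes T A :: "'a::complex_banach \<Rightarrow>\<^sub>L 'a"
  assumes "A = id_blinfun - T"
  shows "is_resolvent UNIV (blinfun_apply A) z S \<longleftrightarrow> is_resolvent UNIV (blinfun_apply T) (1 - z) (- S)"
proof -
  have "S \<in> bounded_ops \<longleftrightarrow> - S \<in> bounded_ops"
    unfolding bounded_ops_def by (auto simp: blinfun.minus_left scaleC.minus_right)
  moreover have key: "(1 - z) *\<^sub>C x - blinfun_apply T x = - (z *\<^sub>C x - blinfun_apply A x)" for x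
    by (simp add: assms blinfun.diff_left scaleC.diff_left)
  moreover have "(1 - z) *\<^sub>C blinfun_apply (- S) x - blinfun_apply T (blinfun_apply (- S) x) =
      z *\<^sub>C blinfun_apply S x - blinfun_apply A (blinfun_apply S x)" for x
    unfolding key by (simp add: blinfun.minus_left blinfun.minus_right scaleC.minus_right)
  moreover have "blinfun_apply (- S) ((1 - z) *\<^sub>C x - blinfun_apply T x) =
      blinfun_apply S (z *\<^sub>C x - blinfun_apply A x)" for x
    unfolding key by (simp only: blinfun.minus_left blinfun.minus_right minus_minus)
  ultimately show ?thesis
    unfolding is_resolvent_def by (simp only: UNIV_I)
qed

lemma spectrum_one_minus:
  fixes T A :: "'a::complex_banach \<Rightarrow>\<^sub>L 'a"
  assumes "A = id_blinfun - T"
  shows "z \<in> spectrum UNIV (blinfun_apply A) \<longleftrightarrow> 1 - z \<in> spectrum UNIV (blinfun_apply T)"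
  unfolding spectrum_def mem_Collect_eq is_resolvent_one_minus_iff[OF assms]
  by (metis minus_minus)

lemma resolvent_one_minus:
  fixes T A :: "'a::complex_banach \<Rightarrow>\<^sub>L 'a"
  assumes "A = id_blinfun - T" "z \<notin> spectrum UNIV (blinfun_apply A)"
  shows "resolvent UNIV (blinfun_apply T) (1 - z) = - resolvent UNIV (blinfun_apply A) z"
  using is_resolvent_resolvent[OF assms(2)] is_resolvent_one_minus_iff[OF assms(1)]
  by (intro resolvent_eqI) blast

section \<open>Splitting a function near the vertex of a Stolz domain\<close>

lemma stolz_shift_scale:
  assumes "z \<in> stolz_shift \<gamma>" "0 < \<gamma>" "\<gamma> < pi" "0 < r" "r \<le> 1"
  shows "of_real r * z \<in> stolz_shift \<gamma>"
proof -
  obtain t where t: "0 < t" "t \<le> 1" "cmod (z - of_real t) < t * sin \<gamma>"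
    using assms by (auto simp: stolz_shift_eq)
  have "of_real r * z - of_real (r * t) = of_real r * (z - of_real t)" by (simp add: algebra_simps)
  then have "cmod (of_real r * z - of_real (r * t)) < r * t * sin \<gamma>"
    using t assms by (simp add: norm_mult mult.assoc)
  moreover have "r * t \<le> 1" using t assms by (simp add: mult_le_one)
  ultimately show ?thesis using assms t by (auto simp: stolz_shift_eq intro!: exI[of _ "r * t"])
qed

lemma triangle_subset_stolz_shift:
  assumes "p \<in> stolz_shift \<gamma>" "q \<in> stolz_shift \<gamma>" "0 < \<gamma>" "\<gamma> < pi"
    and "z \<in> convex hull {0, q, p}" "z \<noteq> 0"
  shows "z \<in> stolz_shift \<gamma>"
proof -
  obtain x y w where xyw: "0 \<le> x" "0 \<le> y" "0 \<le> w" "x + y + w = 1" "z = x *\<^sub>R 0 + y *\<^sub>R q + w *\<^sub>R p"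
    using assms(5) unfolding convex_hull_3 by blast
  define r where "r = y + w"
  have "r > 0"
  proof (rule ccontr)
    assume "\<not> r > 0"
    then have "y = 0" "w = 0" using xyw by (auto simp: r_def)
    then show False using xyw assms by simp
  qed
  define v where "v = (y / r) *\<^sub>R q + (w / r) *\<^sub>R p"
  have "v \<in> stolz_shift \<gamma>"
    unfolding v_def
    by (rule convexD[OF convex_stolz_shift]) (use assms xyw \<open>r > 0\<close> in \<open>auto simp: r_def simp flip: add_divide_distrib\<close>)
  moreover have "z = r *\<^sub>R v"
    using xyw \<open>r > 0\<close> by (simp add: v_def scaleR_add_right)
  then have "z = of_real r * v" by (simp add: scaleR_conv_of_real)
  ultimately show ?thesis
    using stolz_shift_scale[of v \<gamma> r] assms xyw \<open>r > 0\<close> by (auto simp: r_def)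
qed

lemma sector_polar:
  assumes "z \<in> sector \<theta>"
  obtains r x where "r > 0" "\<bar>x\<bar> < \<theta>" "z = of_real r * cis x" "cmod z = r"
  using assms rcis_cmod_Arg[of z] by (intro that[of "cmod z" "Arg z"]) (auto simp: sector_def rcis_def)

text \<open>The barycentric coordinates of \<open>z = r cis x\<close> at the two vertices other than \<open>0\<close> are proportional to \<open>r sin (b - x)\<close>
and \<open>r sin (b + x)\<close>.\<close>

lemma sector_in_triangle:
  assumes b: "0 < b" "b < pi / 2" and \<rho>: "\<rho> > 0" and z: "z \<in> sector b" "Re z \<le> \<rho> * cos b"
  shows "z \<in> convex hull {0, of_real \<rho> * cis (-b), of_real \<rho> * cis b}"
proof -
  obtain r x where x: "r > 0" "\<bar>x\<bar> < b" "z = of_real r * cis x" "cmod z = r"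
    using z(1) by (rule sector_polar)
  have pos: "cos b > 0" "sin b > 0" using b by (auto intro!: cos_gt_zero sin_gt_zero)
  define y w where "y = r * sin (b - x) / (2 * \<rho> * (sin b * cos b))"
    and "w = r * sin (b + x) / (2 * \<rho> * (sin b * cos b))"
  have "sin (b - x) > 0" "sin (b + x) > 0" using x b by (auto intro!: sin_gt_zero)
  then have yw: "y \<ge> 0" "w \<ge> 0" using x pos \<rho> by (auto simp: y_def w_def)
  have sum: "y + w = r * cos x / (\<rho> * cos b)"
    using pos \<rho> by (simp add: y_def w_def sin_add sin_diff field_simps)
  have dif: "w - y = r * sin x / (\<rho> * sin b)"
    using pos \<rho> by (simp add: y_def w_def sin_add sin_diff field_simps)
  have "y + w \<le> 1" using z(2) x pos \<rho> unfolding sum by (simp add: divide_le_eq)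
  moreover have "z = (1 - (y + w)) *\<^sub>R 0 + y *\<^sub>R (of_real \<rho> * cis (-b)) + w *\<^sub>R (of_real \<rho> * cis b)"
  proof (rule complex_eqI)
    have "\<rho> * cos b * (y + w) = r * cos x" unfolding sum using pos \<rho> by simp
    then show "Re z = Re ((1 - (y + w)) *\<^sub>R 0 + y *\<^sub>R (of_real \<rho> * cis (-b)) + w *\<^sub>R (of_real \<rho> * cis b))"
      by (simp add: x algebra_simps)
    have "\<rho> * sin b * (w - y) = r * sin x" unfolding dif using pos \<rho> by simp
    then show "Im z = Im ((1 - (y + w)) *\<^sub>R 0 + y *\<^sub>R (of_real \<rho> * cis (-b)) + w *\<^sub>R (of_real \<rho> * cis b))"
      by (simp add: x algebra_simps)
  qed
  ultimately show ?thesis unfolding convex_hull_3 using yw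
    by (intro CollectI exI[of _ "1 - (y + w)"] exI[of _ y] exI[of _ w]) auto
qed

text \<open>Rotating the ray onto the real axis turns the distance from \<open>z\<close> to its line into \<open>\<bar>Im\<bar>\<close>.\<close>

lemma dist_to_ray_ge:
  assumes "0 < \<theta>" "\<theta> < b" "b < pi / 2" and z: "z \<in> sector \<theta>" and y: "\<bar>y\<bar> = b"
  shows "sin (b - \<theta>) * cmod z \<le> cmod (of_real t * cis y - z)"
proof -
  obtain r x where x: "r > 0" "\<bar>x\<bar> < \<theta>" "z = of_real r * cis x" "cmod z = r"
    using z by (rule sector_polar)
  have "sin (b - \<theta>) \<le> sin \<bar>x - y\<bar>"
  proof (cases "\<bar>x - y\<bar> \<le> pi / 2")
    case True
    then show ?thesis using x assms by (intro sin_monotone_2pi_le) auto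
  next
    case False
    have "sin (b - \<theta>) \<le> sin (pi - \<bar>x - y\<bar>)" using x assms False by (intro sin_monotone_2pi_le) auto
    then show ?thesis by simp
  qed
  also have "\<dots> \<le> \<bar>sin (x - y)\<bar>" using sin_minus[of "x - y"] by (auto simp: abs_if)
  finally have "sin (b - \<theta>) * cmod z \<le> \<bar>r * sin (x - y)\<bar>"
    using x by (simp add: abs_mult mult.commute)
  also have "r * sin (x - y) = Im ((z - of_real t * cis y) * cis (- y))"
    by (simp add: x left_diff_distrib mult.assoc cis_mult)
  also have "\<bar>\<dots>\<bar> \<le> cmod ((z - of_real t * cis y) * cis (- y))" by (rule abs_Im_le_cmod)
  also have "\<dots> = cmod (of_real t * cis y - z)" by (simp add: norm_mult norm_minus_commute)
  finally show ?thesis .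
qed

lemma linepath_cauchy_integral_holomorphic:
  assumes f: "continuous_on (closed_segment a b) f" and "open S" "S \<inter> closed_segment a b = {}"
  shows "(\<lambda>z. contour_integral (linepath a b) (\<lambda>w. f w / (w - z))) holomorphic_on S"
proof -
  define g where "g z = contour_integral (linepath a b) (\<lambda>w. f w / (w - z))" for z
  have S: "S - path_image (linepath a b) = S" using assms(3) by auto
  have "g field_differentiable (at z)" if z: "z \<in> S" for z
  proof -
    have "((\<lambda>w. f w / (w - u) ^ 1) has_contour_integral g u) (linepath a b)" if "u \<in> S - path_image (linepath a b)" for u
      unfolding g_def power_one_right
      by (intro has_contour_integral_integral contour_integrable_continuous_linepath continuous_intros f)
         (use that assms(3) in auto)
    from Cauchy_next_derivative(2)[of "linepath a b" f "cmod (b - a)" S 1 g z, OF _ _ this]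
    have "(g has_field_derivative of_nat 1 * contour_integral (linepath a b) (\<lambda>u. f u / (u - z) ^ Suc 1)) (at z)"
      using f z assms S by auto
    then show ?thesis unfolding field_differentiable_def by blast
  qed
  then show ?thesis unfolding g_def[symmetric] holomorphic_on_def
    using field_differentiable_at_within by blast
qed

text \<open>Away from \<open>0\<close>, a decay like \<open>1/r\<close> at infinity is at least as good as the one that \<open>H0_sector\<close> asks for, when
\<open>s \<le> 1\<close>.\<close>

lemma inverse_le_decay:
  fixes r s \<kappa> :: real
  assumes "0 < s" "s \<le> 1" "0 < \<kappa>" "\<kappa> \<le> 1" "\<kappa> / 2 \<le> r"
  shows "1 / r \<le> 8 / \<kappa>\<^sup>2 * (r powr s / (1 + r powr (2 * s)))"
proof -
  have r: "r > 0" using assms by simp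
  have p: "r powr (2 * s) = r powr s * r powr s" by (simp flip: powr_add)
  have rs: "r powr s > 0" using r by simp
  have k: "8 / \<kappa>\<^sup>2 \<ge> 8" using assms power_le_one[of \<kappa> 2] by (simp add: field_simps)
  show ?thesis
  proof (cases "r \<ge> 1")
    case True
    have "r powr s \<ge> 1" using True assms by (simp add: ge_one_powr_ge_zero)
    have "r powr s \<le> r powr 1" using True assms by (intro powr_mono) auto
    then have "1 / r \<le> 1 / r powr s" using r by (simp add: frac_le)
    also have "\<dots> = 2 * (r powr s / (r powr (2 * s) + r powr (2 * s)))" using rs by (simp add: p)
    also have "\<dots> \<le> 2 * (r powr s / (1 + r powr (2 * s)))"
      using \<open>r powr s \<ge> 1\<close> rs unfolding p
      by (intro mult_left_mono divide_left_mono) (auto simp: add_pos_pos mult_ge1_I)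
    also have "\<dots> \<le> 8 / \<kappa>\<^sup>2 * (r powr s / (1 + r powr (2 * s)))"
      using k by (intro mult_right_mono) auto
    finally show ?thesis .
  next
    case False
    have "r powr 1 \<le> r powr s" using False r assms by (intro powr_mono') auto
    then have rr: "r \<le> r powr s" using r by simp
    have "r powr s \<le> 1" using False r assms by (simp add: powr_le1)
    then have "r powr s * r powr s \<le> 1" using rs by (intro mult_le_one) auto
    then have q: "0 < 1 + r powr (2 * s)" "1 + r powr (2 * s) \<le> 2" using mult_pos_pos[OF rs rs] unfolding p by auto
    have "r / 2 \<le> r powr s / (1 + r powr (2 * s))" by (rule frac_le) (use rr r q rs in auto)
    then have "\<kappa> / 4 \<le> r powr s / (1 + r powr (2 * s))" using assms by linarith
    then have "8 / \<kappa>\<^sup>2 * (\<kappa> / 4) \<le> 8 / \<kappa>\<^sup>2 * (r powr s / (1 + r powr (2 * s)))"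
      by (intro mult_left_mono) auto
    moreover have "8 / \<kappa>\<^sup>2 * (\<kappa> / 4) = 2 / \<kappa>" using assms by (simp add: power2_eq_square)
    moreover have "1 / r \<le> 2 / \<kappa>" using assms r by (simp add: field_simps)
    ultimately show ?thesis by simp
  qed
qed

lemma convex_Re_eq: "convex {w. Re w = c}"
  by (simp add: convex_def flip: distrib_right)

text \<open>Cauchy's formula on the triangle with vertices \<open>0\<close>, \<open>q\<close>, \<open>p\<close>. The decay of \<open>f\<close> at the vertex \<open>0\<close>, which lies on
the boundary of the domain of \<open>f\<close>, makes the extension by \<open>0\<close> continuous on the closed triangle.\<close>

lemma triangle_cauchy_formula:
  assumes b: "0 < b" "b < \<gamma>" "\<gamma> < pi / 2" and \<rho>: "0 < \<rho>" "\<rho> \<le> cos b"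
    and f: "f holomorphic_on stolz_shift \<gamma>" and s: "0 < s"
    and fs: "\<And>z. z \<in> stolz_shift \<gamma> \<Longrightarrow> cmod (f z) \<le> c * cmod z powr s"
    and p: "p = of_real \<rho> * cis b" and q: "q = of_real \<rho> * cis (- b)"
    and z: "z \<in> sector b" "Re z < \<rho> * cos b"
  defines "f0 \<equiv> \<lambda>w. if w = 0 then 0 else f w"
  shows "z \<in> stolz_shift \<gamma>"
    and "continuous_on (convex hull {0, q, p}) f0"
    and "2 * of_real pi * \<i> * f z =
        contour_integral (linepath 0 q) (\<lambda>w. f0 w / (w - z))
      + contour_integral (linepath q p) (\<lambda>w. f0 w / (w - z))
      + contour_integral (linepath p 0) (\<lambda>w. f0 w / (w - z))"
proof -
  define S where "S = convex hull {0, q, p}"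
  have pq: "p \<in> stolz_shift \<gamma>" "q \<in> stolz_shift \<gamma>"
    unfolding p q using b \<rho> by (auto intro!: ray_in_stolz_shift)
  have SD: "w \<in> stolz_shift \<gamma>" if "w \<in> S" "w \<noteq> 0" for w
    using triangle_subset_stolz_shift[OF pq] that b unfolding S_def by auto
  have zS: "w \<in> S" if "w \<in> sector b" "Re w < \<rho> * cos b" for w
    unfolding S_def p q using sector_in_triangle[of b \<rho> w] that b \<rho> by auto
  have z0: "z \<noteq> 0" using z(1) by (simp add: sector_def)
  show zD: "z \<in> stolz_shift \<gamma>" using SD zS z z0 by blast
  have "open (sector b \<inter> {w. Re w < \<rho> * cos b})"
    by (intro open_Int open_sector open_Collect_less continuous_intros) (use b in auto)
  then have zint: "z \<in> interior S" using z zS by (auto intro!: interiorI[of "sector b \<inter> {w. Re w < \<rho> * cos b}"])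
  have oD: "open (stolz_shift \<gamma>)" using b by (intro open_stolz_shift) auto
  have f0D: "f0 field_differentiable (at w)" if "w \<in> stolz_shift \<gamma>" for w
  proof -
    have "w \<noteq> 0" using that stolz_shift_subset_sector[of \<gamma>] b by (auto simp: sector_def)
    have "0 \<notin> stolz_shift \<gamma>" using stolz_shift_subset_sector[of \<gamma>] b by (auto simp: sector_def)
    have "(f has_field_derivative deriv f w) (at w)" by (rule holomorphic_derivI[OF f oD that])
    then have "(f0 has_field_derivative deriv f w) (at w)"
      by (rule has_field_derivative_transform_within_open[OF _ oD that])
         (use \<open>0 \<notin> stolz_shift \<gamma>\<close> in \<open>auto simp: f0_def\<close>)
    then show ?thesis unfolding field_differentiable_def by blast
  qed
  show cont: "continuous_on (convex hull {0, q, p}) f0"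
    unfolding S_def[symmetric] continuous_on_eq_continuous_within
  proof
    fix w assume w: "w \<in> S"
    show "continuous (at w within S) f0"
    proof (cases "w = 0")
      case False
      then show ?thesis
        using f0D[OF SD[OF w]] field_differentiable_imp_continuous_at continuous_at_imp_continuous_at_within by blast
    next
      case True
      have "((\<lambda>w. \<bar>c\<bar> * cmod w powr s) \<longlongrightarrow> \<bar>c\<bar> * cmod 0 powr s) (at 0 within S)"
        using s by (intro tendsto_intros tendsto_powr') auto
      then have lim: "((\<lambda>w. \<bar>c\<bar> * cmod w powr s) \<longlongrightarrow> 0) (at 0 within S)" using s by simp
      have "\<forall>\<^sub>F w in at 0 within S. norm (f0 w) \<le> \<bar>c\<bar> * cmod w powr s"
      proof (unfold eventually_at_filter, rule always_eventually, intro allI impI)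
        fix w :: complex assume "w \<noteq> 0" "w \<in> S"
        then have "cmod (f w) \<le> c * cmod w powr s" using SD fs by blast
        also have "\<dots> \<le> \<bar>c\<bar> * cmod w powr s" by (intro mult_right_mono) auto
        finally show "norm (f0 w) \<le> \<bar>c\<bar> * cmod w powr s" using \<open>w \<noteq> 0\<close> by (simp add: f0_def)
      qed
      from Lim_null_comparison[OF this lim] show ?thesis
        using True by (simp add: continuous_within f0_def)
    qed
  qed
  define \<Gamma> where "\<Gamma> = linepath 0 q +++ linepath q p +++ linepath p 0"
  have seg: "closed_segment x y \<subseteq> S" if "x \<in> {0, q, p}" "y \<in> {0, q, p}" for x y
    unfolding S_def using that by (intro closed_segment_subset) (auto intro: hull_inc)
  have ray: False if "z = of_real t * cis y" "\<bar>y\<bar> = b" for t y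
  proof -
    have "cos b * cmod z < Re z" using z(1) b by (simp add: sector_eq)
    moreover have "cos y = cos b" using that(2) by (auto simp: abs_if split: if_splits)
    ultimately have "cos b * \<bar>t\<bar> < cos b * t" using that(1) by (simp add: norm_mult mult.commute)
    moreover have "cos b > 0" using b by (intro cos_gt_zero) auto
    ultimately show False by simp
  qed
  have notseg: "z \<notin> closed_segment x y" if xy: "x \<in> {0, q, p}" "y \<in> {0, q, p}" for x y
  proof
    assume zxy: "z \<in> closed_segment x y"
    consider "{x, y} \<subseteq> {0, q}" | "{x, y} \<subseteq> {0, p}" | "{x, y} \<subseteq> {q, p}"
      using xy by auto
    then show False
    proof cases
      case 1
      then have "closed_segment x y \<subseteq> closed_segment 0 q" by (intro closed_segment_subset) auto
      then have "z \<in> closed_segment 0 q" using zxy by blast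
      then obtain u where "z = u *\<^sub>R q" by (auto simp: in_segment)
      then show False using b by (intro ray[of "u * \<rho>" "- b"]) (auto simp: q scaleR_conv_of_real)
    next
      case 2
      then have "closed_segment x y \<subseteq> closed_segment 0 p" by (intro closed_segment_subset) auto
      then have "z \<in> closed_segment 0 p" using zxy by blast
      then obtain u where "z = u *\<^sub>R p" by (auto simp: in_segment)
      then show False using b by (intro ray[of "u * \<rho>" b]) (auto simp: p scaleR_conv_of_real)
    next
      case 3
      then have "closed_segment x y \<subseteq> {w. Re w = \<rho> * cos b}"
        by (intro closed_segment_subset convex_Re_eq) (auto simp: p q)
      then show False using z zxy by auto
    qed
  qed
  have wn: "winding_number \<Gamma> z = 1"
  proof -
    obtain r x where x: "r > 0" "\<bar>x\<bar> < b" "z = of_real r * cis x"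
      using z(1) by (rule sector_polar)
    have "Im ((q - 0) * cnj (q - z)) = \<rho> * r * sin (b + x)"
      by (simp add: q x sin_add algebra_simps)
    moreover have "sin (b + x) > 0" using x b by (auto intro!: sin_gt_zero)
    ultimately have "0 < Im ((q - 0) * cnj (q - z))" using x \<rho> by simp
    then show ?thesis
      using winding_number_triangle[of z 0 q p] zint unfolding \<Gamma>_def S_def by simp
  qed
  have ci: "(\<lambda>w. f0 w / (w - z)) contour_integrable_on linepath x y" if "x \<in> {0, q, p}" "y \<in> {0, q, p}" for x y
    by (intro contour_integrable_continuous_linepath continuous_intros
        continuous_on_subset[OF cont, folded S_def, OF seg[OF that]]) (use notseg[OF that] in auto)
  have "((\<lambda>w. f0 w / (w - z)) has_contour_integral (2 * pi * \<i> * winding_number \<Gamma> z * f0 z)) \<Gamma>"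
  proof (rule Cauchy_integral_formula_weak[where S = S and k = "{}"])
    show "convex S" unfolding S_def by (rule convex_convex_hull)
    show "continuous_on S f0" using cont by (simp add: S_def)
    show "f0 field_differentiable (at x)" if xi: "x \<in> interior S - {}" for x
    proof (rule f0D)
      have "x \<in> S" using xi interior_subset by auto
      moreover have "x \<noteq> 0"
      proof
        assume "x = 0"
        then obtain e where e: "e > 0" "ball 0 e \<subseteq> S" using xi mem_interior[of 0 S] by (metis Diff_empty)
        then have "complex_of_real (- (e / 2)) \<in> S" by (auto simp: subset_iff)
        then have "complex_of_real (- (e / 2)) \<in> stolz_shift \<gamma>" using e SD by auto
        then have "complex_of_real (- (e / 2)) \<in> sector \<gamma>" using stolz_shift_subset_sector[of \<gamma>] b by auto
        then have "cos \<gamma> * \<bar>e / 2\<bar> < - (e / 2)" using b by (simp add: sector_eq)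
        moreover have "cos \<gamma> \<ge> 0" using b by (intro cos_ge_zero) auto
        ultimately show False using e by (smt (verit) mult_nonneg_nonneg abs_ge_zero half_gt_zero)
      qed
      ultimately show "x \<in> stolz_shift \<gamma>" by (rule SD)
    qed
    show "path_image \<Gamma> \<subseteq> S - {z}"
      unfolding \<Gamma>_def using seg notseg by (auto simp: path_image_join)
  qed (use zint in \<open>auto simp: \<Gamma>_def\<close>)
  then have "((\<lambda>w. f0 w / (w - z)) has_contour_integral (2 * of_real pi * \<i> * f z)) \<Gamma>"
    using wn z0 by (simp add: f0_def)
  moreover have "((\<lambda>w. f0 w / (w - z)) has_contour_integral
        (contour_integral (linepath 0 q) (\<lambda>w. f0 w / (w - z))
      + (contour_integral (linepath q p) (\<lambda>w. f0 w / (w - z))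
      + contour_integral (linepath p 0) (\<lambda>w. f0 w / (w - z))))) \<Gamma>"
    unfolding \<Gamma>_def
    by (intro has_contour_integral_join has_contour_integral_integral ci valid_path_join) auto
  ultimately show "2 * of_real pi * \<i> * f z =
        contour_integral (linepath 0 q) (\<lambda>w. f0 w / (w - z))
      + contour_integral (linepath q p) (\<lambda>w. f0 w / (w - z))
      + contour_integral (linepath p 0) (\<lambda>w. f0 w / (w - z))"
    using contour_integral_unique by (metis add.assoc)
qed

lemma linepath_cauchy_integral_le:
  assumes f: "continuous_on (closed_segment a b) f" and d: "0 < d"
    and M: "\<And>w. w \<in> closed_segment a b \<Longrightarrow> cmod (f w) \<le> M"
    and dist: "\<And>w. w \<in> closed_segment a b \<Longrightarrow> d \<le> cmod (w - z)"
  shows "cmod (contour_integral (linepath a b) (\<lambda>w. f w / (w - z))) \<le> M / d * cmod (b - a)"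
proof (rule contour_integral_bound_linepath)
  have M0: "0 \<le> M" using M[of a] by (auto intro: order_trans[OF norm_ge_zero])
  then show "0 \<le> M / d" using d by simp
  show "(\<lambda>w. f w / (w - z)) contour_integrable_on linepath a b"
    using dist d by (intro contour_integrable_continuous_linepath continuous_intros f) force
  show "cmod (f w / (w - z)) \<le> M / d" if "w \<in> closed_segment a b" for w
    unfolding norm_divide using M[OF that] dist[OF that] M0 d by (intro frac_le) auto
qed

text \<open>\<open>h\<close> is a function on the whole sector with the decay required in \<open>H0_sector\<close>, which agrees with \<open>f\<close> on the Stolz
domain up to an error of first order at the vertex; \<open>B\<close> bounds both \<open>h\<close> and the error.\<close>

definition sector_extension ::
    "real \<Rightarrow> real \<Rightarrow> real \<Rightarrow> (complex \<Rightarrow> complex) \<Rightarrow> (complex \<Rightarrow> complex) \<Rightarrow> bool" where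
  "sector_extension \<theta> B s f h \<longleftrightarrow> h holomorphic_on sector \<theta> \<and>
     (\<forall>z\<in>sector \<theta>. cmod (h z) \<le> B) \<and>
     (\<exists>c. \<forall>z\<in>sector \<theta>. cmod (h z) \<le> c * (cmod z powr s / (1 + cmod z powr (2 * s)))) \<and>
     (\<forall>z\<in>stolz_shift \<theta>. cmod (f z - h z) \<le> B * cmod z)"

text \<open>In Cauchy's formula on a triangle with vertex \<open>0\<close>, the sides meeting at \<open>0\<close> lie on the rays of angle \<open>\<plusminus>b\<close> with
\<open>\<theta> < b < \<gamma>\<close>, so their contribution is holomorphic on the whole sector of angle \<open>\<theta>\<close> and decays like \<open>1/z\<close>. The
contribution of the third side is smooth near \<open>0\<close>; its value there, times \<open>1/(1 + z)\<close>, is moved to the first part.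
The essential point is that \<open>C\<close> does not depend on \<open>f\<close>. Far from \<open>0\<close> the bound for \<open>h\<close> is a direct estimate of the
integrals. Near \<open>0\<close> such an estimate would diverge logarithmically, and \<open>h\<close> is bounded as the difference of
\<open>f\<close> and the smooth part.\<close>

lemma sector_decomposition:
  assumes \<theta>: "0 < \<theta>" "\<theta> < \<gamma>" "\<gamma> < pi / 2"
  obtains C where "C > 0"
    "\<And>f M c s. f holomorphic_on stolz_shift \<gamma> \<Longrightarrow> 0 < s \<Longrightarrow> s \<le> 1 \<Longrightarrow>
       (\<And>z. z \<in> stolz_shift \<gamma> \<Longrightarrow> cmod (f z) \<le> M) \<Longrightarrow>
       (\<And>z. z \<in> stolz_shift \<gamma> \<Longrightarrow> cmod (f z) \<le> c * cmod z powr s) \<Longrightarrow>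
       \<exists>h. sector_extension \<theta> (C * M) s f h"
proof -
  \<comment> \<open>\<open>\<rho> = cos \<gamma> < cos b\<close> keeps the vertices \<open>p\<close> and \<open>q\<close> of the triangle inside the Stolz domain of angle \<open>\<gamma>\<close>.\<close>
  define b \<rho> where "b = (\<theta> + \<gamma>) / 2" and "\<rho> = cos \<gamma>"
  have b: "0 < b" "b < \<gamma>" "\<theta> < b" "b < pi / 2" using \<theta> by (auto simp: b_def)
  define p q where "p = of_real \<rho> * cis b" and "q = of_real \<rho> * cis (- b)"
  have cb: "cos b > 0" using b by (intro cos_gt_zero) auto
  have \<rho>: "0 < \<rho>" "\<rho> \<le> cos b" "\<rho> \<le> 1"
    using \<theta> b unfolding \<rho>_def by (auto intro!: cos_gt_zero cos_monotone_0_pi_le)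
  define \<kappa> where "\<kappa> = \<rho> * cos b"
  have \<kappa>: "0 < \<kappa>" "\<kappa> \<le> 1" using \<rho> cb by (auto simp: \<kappa>_def intro: mult_le_one)
  define \<delta> where "\<delta> = sin (b - \<theta>)"
  have \<delta>: "0 < \<delta>" using b \<theta> unfolding \<delta>_def by (intro sin_gt_zero) linarith+
  define C1 where "C1 = 1 / \<kappa>\<^sup>2 + 1 / \<kappa>"
  define C2 where "C2 = 1 / \<delta> + 1 / \<kappa>"
  define C3 where "C3 = C2 * (2 / \<kappa>)"
  have C123: "C1 > 0" "C2 > 0" "C3 > 0" using \<kappa> \<delta> by (auto simp: C1_def C2_def C3_def add_pos_pos)
  define C where "C = 1 + C1 + C3 + (1 + C3) * (2 / \<kappa>)"
  have C: "C > 0" "1 + C1 \<le> C" "C1 \<le> C" "C3 \<le> C" "(1 + C3) * (2 / \<kappa>) \<le> C"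
    using C123 \<kappa> by (auto simp: C_def add_pos_pos)
  have sec: "cmod z > 0" "Re z > 0" "cmod (1 + z) \<ge> 1" "cmod (1 + z) \<ge> cmod z" if "z \<in> sector \<theta>" for z
  proof -
    have "cos \<theta> * cmod z < Re z" "z \<noteq> 0" using that \<theta> by (auto simp: sector_eq)
    moreover have "cos \<theta> * cmod z \<ge> 0" using \<theta> cos_ge_zero[of \<theta>] by auto
    ultimately show *: "cmod z > 0" "Re z > 0" by auto
    show "cmod (1 + z) \<ge> 1" using * complex_Re_le_cmod[of "1 + z"] by simp
    have "(cmod z)\<^sup>2 \<le> (cmod (1 + z))\<^sup>2" using *
      unfolding cmod_power2 by (simp add: power2_eq_square algebra_simps)
    then show "cmod (1 + z) \<ge> cmod z" by (rule power2_le_imp_le) auto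
  qed
  have main: "\<exists>h. sector_extension \<theta> (C * M) s f h"
    if f: "f holomorphic_on stolz_shift \<gamma>" and s: "0 < s" "s \<le> 1"
      and fM: "\<And>z. z \<in> stolz_shift \<gamma> \<Longrightarrow> cmod (f z) \<le> M"
      and fs: "\<And>z. z \<in> stolz_shift \<gamma> \<Longrightarrow> cmod (f z) \<le> c * cmod z powr s" for f M c s
  proof -
    have pS: "p \<in> stolz_shift \<gamma>" "q \<in> stolz_shift \<gamma>"
      unfolding p_def q_def using b \<rho> \<theta> by (auto intro!: ray_in_stolz_shift)
    have M: "M \<ge> 0" using fM[OF pS(1)] norm_ge_zero order_trans by blast
    have c: "c \<ge> 0"
    proof -
      have "p \<noteq> 0" using \<rho> by (simp add: p_def)
      then show ?thesis
        using fs[OF pS(1)] norm_ge_zero[of "f p"] by (smt (verit) powr_gt_zero zero_less_norm_iff mult_neg_pos)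
    qed
    define f0 where "f0 w = (if w = 0 then 0 else f w)" for w
    note tri = triangle_cauchy_formula[OF b(1,2) \<theta>(3) \<rho>(1,2) f s(1) fs p_def q_def, folded f0_def \<kappa>_def]
    have small: "z \<in> sector b" "Re z < \<kappa>" if "z \<in> sector \<theta>" "cmod z < \<kappa> / 2" for z
      using that sector_mono[of \<theta> b] b \<kappa> complex_Re_le_cmod[of z] by auto
    have "of_real (\<kappa> / 4) * cis 0 \<in> sector \<theta>" by (rule cis_in_sector) (use \<kappa> \<theta> in auto)
    then have "of_real (\<kappa> / 4) \<in> sector \<theta>" by simp
    from small[OF this] have cont: "continuous_on (convex hull {0, q, p}) f0"
      using tri(2)[of "of_real (\<kappa> / 4)"] \<kappa> by (auto simp: f0_def[abs_def])
    have sub: "closed_segment x y \<subseteq> convex hull {0, q, p}" if "x \<in> {0, q, p}" "y \<in> {0, q, p}" for x y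
      using that by (intro closed_segment_subset) (auto intro: hull_inc)
    have cs: "continuous_on (closed_segment x y) f0" if "x \<in> {0, q, p}" "y \<in> {0, q, p}" for x y
      by (rule continuous_on_subset[OF cont sub[OF that]])
    have f0M: "cmod (f0 w) \<le> M" if "w \<in> convex hull {0, q, p}" for w
      using triangle_subset_stolz_shift[OF pS _ _ that] fM M \<theta> by (cases "w = 0") (auto simp: f0_def)
    have edge: "\<delta> * cmod z \<le> cmod (w - z)"
      if "z \<in> sector \<theta>" "w \<in> closed_segment 0 q \<or> w \<in> closed_segment p 0" for z w
    proof -
      have "\<exists>t y. \<bar>y\<bar> = b \<and> w = of_real t * cis y"
        using that(2)
      proof
        assume "w \<in> closed_segment 0 q"
        then obtain u where "w = u *\<^sub>R q" by (auto simp: in_segment)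
        then show ?thesis using b by (intro exI[of _ "u * \<rho>"] exI[of _ "-b"]) (auto simp: q_def scaleR_conv_of_real)
      next
        assume "w \<in> closed_segment p 0"
        then obtain u where "w = (1 - u) *\<^sub>R p" by (auto simp: in_segment)
        then show ?thesis using b by (intro exI[of _ "(1 - u) * \<rho>"] exI[of _ "b"]) (auto simp: p_def scaleR_conv_of_real)
      qed
      then show ?thesis
        unfolding \<delta>_def using dist_to_ray_ge[of \<theta> b z] that \<theta> b by auto
    qed
    have far: "Re w = \<kappa>" if "w \<in> closed_segment q p" for w
    proof -
      have "closed_segment q p \<subseteq> {w. Re w = \<kappa>}"
        by (intro closed_segment_subset convex_Re_eq) (auto simp: p_def q_def \<kappa>_def)
      then show ?thesis using that by auto
    qed
    have lens: "cmod (q - 0) \<le> 1" "cmod (0 - p) \<le> 1" "cmod (p - q) \<le> 2"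
      using \<rho> norm_triangle_ineq4[of p q] by (auto simp: p_def q_def norm_mult)
    define k where "k = 1 / (2 * of_real pi * \<i>)"
    have k: "cmod k = 1 / (2 * pi)" "k \<noteq> 0" by (auto simp: k_def norm_divide norm_mult)
    \<comment> \<open>\<open>J1\<close> and \<open>J3\<close> come from the sides at the vertex, \<open>J2\<close> from the far side; \<open>k * J2 0\<close> is the value at \<open>0\<close> of the smooth part.\<close>
    define J1 where "J1 z = contour_integral (linepath 0 q) (\<lambda>w. f0 w / (w - z))" for z
    define J2 where "J2 z = contour_integral (linepath q p) (\<lambda>w. f0 w / (w - z))" for z
    define J3 where "J3 z = contour_integral (linepath p 0) (\<lambda>w. f0 w / (w - z))" for z
    define h where "h z = k * (J1 z + J3 z) + k * J2 0 / (1 + z)" for z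
    have hol: "h holomorphic_on sector \<theta>"
    proof -
      have "w \<notin> sector \<theta>" if "w \<in> closed_segment 0 q \<or> w \<in> closed_segment p 0" for w
        using edge[OF _ that, of w] sec[of w] \<delta> by (auto simp: mult_le_0_iff)
      then have "J1 holomorphic_on sector \<theta>" "J3 holomorphic_on sector \<theta>"
        unfolding J1_def J3_def using \<theta>
        by (intro linepath_cauchy_integral_holomorphic cs open_sector; auto)+
      moreover have "1 + z \<noteq> 0" if "z \<in> sector \<theta>" for z using sec(3)[OF that] by auto
      ultimately show ?thesis unfolding h_def by (intro holomorphic_intros) auto
    qed
    have J13: "cmod (J1 z) \<le> M / (\<delta> * cmod z)" "cmod (J3 z) \<le> M / (\<delta> * cmod z)" if z: "z \<in> sector \<theta>" for z
    proof -
      have dz: "\<delta> * cmod z > 0" using sec(1)[OF z] \<delta> by simp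
      have "cmod (contour_integral (linepath x y) (\<lambda>w. f0 w / (w - z))) \<le> M / (\<delta> * cmod z)"
        if xy: "(x, y) = (0, q) \<or> (x, y) = (p, 0)" for x y
      proof -
        have "cmod (contour_integral (linepath x y) (\<lambda>w. f0 w / (w - z))) \<le> M / (\<delta> * cmod z) * cmod (y - x)"
          using xy f0M sub edge[OF z] by (intro linepath_cauchy_integral_le cs dz) auto
        also have "\<dots> \<le> M / (\<delta> * cmod z)" using lens xy M dz by (intro mult_left_le) auto
        finally show ?thesis .
      qed
      then show "cmod (J1 z) \<le> M / (\<delta> * cmod z)" "cmod (J3 z) \<le> M / (\<delta> * cmod z)"
        unfolding J1_def J3_def by auto
    qed
    have farw: "\<kappa> \<le> cmod w" if "w \<in> closed_segment q p" for w
      using far[OF that] complex_Re_le_cmod[of w] by simp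
    have "cmod (J2 0) \<le> M / \<kappa> * cmod (p - q)"
      unfolding J2_def using farw f0M sub[of q p] \<kappa> by (intro linepath_cauchy_integral_le cs) auto
    also have "\<dots> \<le> M / \<kappa> * 2" using lens(3) M \<kappa> by (intro mult_left_mono) auto
    finally have J20: "cmod (k * J2 0) \<le> M / \<kappa>"
    proof -
      assume "cmod (J2 0) \<le> M / \<kappa> * 2"
      then have "cmod (k * J2 0) \<le> 1 / (2 * pi) * (M / \<kappa> * 2)"
        unfolding norm_mult k by (intro mult_left_mono) auto
      also have "\<dots> = (M / \<kappa>) * (1 / pi)" by simp
      also have "\<dots> \<le> M / \<kappa>" using M \<kappa> pi_ge_two by (intro mult_left_le) (auto simp: divide_le_eq)
      finally show ?thesis .
    qed
    \<comment> \<open>The direct estimate, used away from the vertex and for the decay at infinity.\<close>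
    have hbig: "cmod (h z) \<le> C2 * M / cmod z" if z: "z \<in> sector \<theta>" for z
    proof -
      have "cmod (k * (J1 z + J3 z)) \<le> 1 / (2 * pi) * (M / (\<delta> * cmod z) + M / (\<delta> * cmod z))"
        unfolding norm_mult k by (intro mult_left_mono norm_triangle_le add_mono J13 z) auto
      also have "\<dots> = M / (\<delta> * cmod z) * (1 / pi)" by simp
      also have "\<dots> \<le> M / (\<delta> * cmod z)"
        using M \<delta> pi_ge_two by (intro mult_left_le) (auto simp: divide_le_eq)
      finally have 1: "cmod (k * (J1 z + J3 z)) \<le> M / (\<delta> * cmod z)" .
      have 2: "cmod (k * J2 0 / (1 + z)) \<le> (M / \<kappa>) / cmod z"
        unfolding norm_divide[of "k * J2 0"] using J20 sec[OF z] M \<kappa> by (intro frac_le) auto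
      have "cmod (h z) \<le> M / (\<delta> * cmod z) + (M / \<kappa>) / cmod z"
        unfolding h_def by (intro norm_triangle_le add_mono 1 2)
      also have "\<dots> = C2 * M / cmod z" using \<delta> \<kappa> sec[OF z] by (simp add: C2_def field_simps)
      finally show ?thesis .
    qed
    \<comment> \<open>Near the vertex Cauchy's formula applies and \<open>f - h\<close> is the smooth part minus a function with the same value at \<open>0\<close>.\<close>
    have near: "cmod (f z - h z) \<le> C1 * M * cmod z" "z \<in> stolz_shift \<gamma>"
      if z: "z \<in> sector \<theta>" "cmod z < \<kappa> / 2" for z
    proof -
      note zz = small[OF z]
      show "z \<in> stolz_shift \<gamma>" using tri(1)[OF _ zz] by simp
      have "2 * of_real pi * \<i> * f z = J1 z + J2 z + J3 z"
        using tri(3)[OF _ zz] unfolding J1_def J2_def J3_def f0_def[abs_def] by simp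
      then have fz: "f z = k * (J1 z + J2 z + J3 z)" by (simp add: k_def field_simps)
      have z1: "1 + z \<noteq> 0" using sec(3)[OF z(1)] by auto
      have wz: "\<kappa> / 2 \<le> cmod (w - z)" if "w \<in> closed_segment q p" for w
        using farw[OF that] norm_triangle_ineq2[of w z] z(2) by linarith
      have i1: "(\<lambda>w. f0 w / (w - z)) contour_integrable_on linepath q p"
        using wz \<kappa> cs by (intro contour_integrable_continuous_linepath continuous_intros) force+
      have i2: "(\<lambda>w. f0 w / (w - 0)) contour_integrable_on linepath q p"
        using farw \<kappa> cs by (intro contour_integrable_continuous_linepath continuous_intros) force+
      have "J2 z - J2 0 = contour_integral (linepath q p) (\<lambda>w. f0 w / (w - z) - f0 w / (w - 0))"
        unfolding J2_def by (rule contour_integral_diff[OF i1 i2, symmetric])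
      also have "cmod \<dots> \<le> (M * cmod z * (2 / \<kappa>\<^sup>2)) * cmod (p - q)"
      proof (rule contour_integral_bound_linepath)
        show "(\<lambda>w. f0 w / (w - z) - f0 w / (w - 0)) contour_integrable_on linepath q p"
          by (intro contour_integrable_diff i1 i2)
        fix w assume w: "w \<in> closed_segment q p"
        have nz: "w \<noteq> 0" "w - z \<noteq> 0" using wz[OF w] farw[OF w] \<kappa> by auto
        have "f0 w / (w - z) - f0 w / (w - 0) = f0 w * z / (w * (w - z))"
          using nz by (simp add: field_simps)
        also have "cmod \<dots> \<le> (M * cmod z) / (\<kappa> * (\<kappa> / 2))"
          unfolding norm_divide norm_mult
          using f0M[of w] w sub[of q p] wz[OF w] farw[OF w] \<kappa> M
          by (intro frac_le mult_mono) auto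
        also have "\<dots> = M * cmod z * (2 / \<kappa>\<^sup>2)" by (simp add: power2_eq_square)
        finally show "cmod (f0 w / (w - z) - f0 w / (w - 0)) \<le> M * cmod z * (2 / \<kappa>\<^sup>2)" .
      qed (use M in auto)
      also have "\<dots> \<le> (M * cmod z * (2 / \<kappa>\<^sup>2)) * 2" using lens(3) M by (intro mult_left_mono) auto
      finally have "cmod (k * (J2 z - J2 0)) \<le> 1 / (2 * pi) * ((M * cmod z * (2 / \<kappa>\<^sup>2)) * 2)"
        unfolding norm_mult k by (intro mult_left_mono) auto
      also have "\<dots> = M * cmod z / \<kappa>\<^sup>2 * (2 / pi)" by (simp add: mult_ac)
      also have "\<dots> \<le> M * cmod z / \<kappa>\<^sup>2" using M pi_ge_two by (intro mult_left_le) (auto simp: divide_le_eq)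
      finally have 1: "cmod (k * (J2 z - J2 0)) \<le> M * cmod z / \<kappa>\<^sup>2" .
      have "cmod (k * J2 0 * z / (1 + z)) \<le> (M / \<kappa> * cmod z) / 1"
        unfolding norm_divide norm_mult[of "k * J2 0"] using J20 sec[OF z(1)] M \<kappa>
        by (intro frac_le mult_mono) auto
      moreover have "f z - h z = k * (J2 z - J2 0) + k * J2 0 * z / (1 + z)"
        unfolding fz h_def using z1 by (simp add: field_simps)
      ultimately have "cmod (f z - h z) \<le> M * cmod z / \<kappa>\<^sup>2 + M / \<kappa> * cmod z"
        using 1 by (auto intro: norm_triangle_le add_mono)
      then show "cmod (f z - h z) \<le> C1 * M * cmod z" by (simp add: C1_def algebra_simps)
    qed
    have h3: "cmod (h z) \<le> C3 * M" if "z \<in> sector \<theta>" "\<not> cmod z < \<kappa> / 2" for z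
    proof -
      have "C2 * M / cmod z \<le> C2 * M / (\<kappa> / 2)"
        using that \<kappa> M C123 by (intro frac_le) auto
      then show ?thesis using hbig[OF that(1)] by (simp add: C3_def mult_ac)
    qed
    have hM: "cmod (h z) \<le> C * M" if z: "z \<in> sector \<theta>" for z
    proof (cases "cmod z < \<kappa> / 2")
      case True
      have "cmod (h z) \<le> cmod (f z) + cmod (f z - h z)"
        using norm_triangle_ineq4[of "f z" "f z - h z"] by simp
      also have "\<dots> \<le> M + C1 * M * cmod z" by (intro add_mono fM near z True)
      also have "\<dots> \<le> M + C1 * M * 1" using True \<kappa> C123 M by (intro add_mono mult_left_mono) auto
      also have "\<dots> = (1 + C1) * M" by (simp add: algebra_simps)
      also have "\<dots> \<le> C * M" using C M by (intro mult_right_mono) auto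
      finally show ?thesis .
    next
      case False
      have "cmod (h z) \<le> C3 * M" by (rule h3[OF z False])
      also have "\<dots> \<le> C * M" using C M by (intro mult_right_mono) auto
      finally show ?thesis .
    qed
    have decay: "cmod (h z) \<le> (2 * (c + C1 * M) + C2 * M * (8 / \<kappa>\<^sup>2)) * (cmod z powr s / (1 + cmod z powr (2 * s)))"
      if z: "z \<in> sector \<theta>" for z
    proof (cases "cmod z < \<kappa> / 2")
      case True
      define r where "r = cmod z"
      have r: "0 < r" "r \<le> 1" using sec[OF z] True \<kappa> by (auto simp: r_def)
      have rs: "r powr (2 * s) \<le> 1" using r s by (intro powr_le1) auto
      have "r powr 1 \<le> r powr s" using r s by (intro powr_mono') auto
      then have rr: "r \<le> r powr s" using r by simp
      have "cmod (h z) \<le> cmod (f z) + cmod (f z - h z)"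
        using norm_triangle_ineq4[of "f z" "f z - h z"] by simp
      also have "\<dots> \<le> c * r powr s + C1 * M * r" unfolding r_def by (intro add_mono fs near z True)
      also have "\<dots> \<le> c * r powr s + C1 * M * r powr s" using rr C123 M c by (intro add_mono mult_left_mono) auto
      also have "\<dots> = 2 * (c + C1 * M) * (r powr s / 2)" by (simp add: algebra_simps)
      also have "\<dots> \<le> (2 * (c + C1 * M) + C2 * M * (8 / \<kappa>\<^sup>2)) * (r powr s / (1 + r powr (2 * s)))"
        using rs c C123 M by (intro mult_mono frac_le) (auto simp: add_pos_nonneg)
      finally show ?thesis by (simp add: r_def)
    next
      case False
      have "cmod (h z) \<le> C2 * M * (1 / cmod z)" using hbig[OF z] by simp
      also have "\<dots> \<le> C2 * M * (8 / \<kappa>\<^sup>2 * (cmod z powr s / (1 + cmod z powr (2 * s))))"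
        using False s \<kappa> C123 M by (intro mult_left_mono inverse_le_decay) auto
      also have "\<dots> = (C2 * M * (8 / \<kappa>\<^sup>2)) * (cmod z powr s / (1 + cmod z powr (2 * s)))" by (simp add: mult.assoc)
      also have "\<dots> \<le> (2 * (c + C1 * M) + C2 * M * (8 / \<kappa>\<^sup>2)) * (cmod z powr s / (1 + cmod z powr (2 * s)))"
        using c C123 M by (intro mult_right_mono) (auto intro: add_nonneg_nonneg)
      finally show ?thesis .
    qed
    have diff: "cmod (f z - h z) \<le> C * M * cmod z" if z: "z \<in> stolz_shift \<theta>" for z
    proof -
      have zs: "z \<in> sector \<theta>" using stolz_shift_subset_sector[of \<theta>] z \<theta> by auto
      have zg: "z \<in> stolz_shift \<gamma>" using stolz_shift_mono[of \<theta> \<gamma>] z \<theta> by auto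
      show ?thesis
      proof (cases "cmod z < \<kappa> / 2")
        case True
        have "cmod (f z - h z) \<le> C1 * M * cmod z" by (rule near(1)[OF zs True])
        also have "\<dots> \<le> C * M * cmod z" using C M by (intro mult_right_mono) auto
        finally show ?thesis .
      next
        case False
        have "cmod (f z - h z) \<le> M + C3 * M"
          by (intro order_trans[OF norm_triangle_ineq4] add_mono fM zg h3 zs False)
        also have "\<dots> = (1 + C3) * M * 1" by (simp add: algebra_simps)
        also have "\<dots> \<le> (1 + C3) * M * (2 / \<kappa> * cmod z)"
          using False C123 M \<kappa> by (intro mult_left_mono) (auto simp: field_simps)
        also have "\<dots> = ((1 + C3) * (2 / \<kappa>)) * M * cmod z" by (simp add: mult_ac)
        also have "\<dots> \<le> C * M * cmod z" using C M by (intro mult_right_mono) auto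
        finally show ?thesis .
      qed
    qed
    show ?thesis unfolding sector_extension_def using hol hM decay diff by blast
  qed
  show thesis by (rule that[OF C(1)], rule main; assumption)
qed

section \<open>The Stolz contour in the variable \<open>1 - \<lambda>\<close>\<close>

lemma has_integral_affine_pos:
  fixes f :: "real \<Rightarrow> 'b::real_normed_vector"
  assumes "(f has_integral I) {0..1}" "m > 0"
  shows "((\<lambda>t. m *\<^sub>R f (m * t + c)) has_integral I) {- c / m..(1 - c) / m}"
proof -
  have "(\<lambda>x. (1 / m) *\<^sub>R x + - ((1 / m) *\<^sub>R c)) ` {0..1} = {- c / m..(1 - c) / m}"
  proof (intro equalityI subsetI)
    fix x assume "x \<in> {- c / m..(1 - c) / m}"
    then show "x \<in> (\<lambda>x. (1 / m) *\<^sub>R x + - ((1 / m) *\<^sub>R c)) ` {0..1}"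
      using assms(2) by (intro image_eqI[of _ _ "m * x + c"]) (auto simp: field_simps)
  qed (use assms(2) in \<open>auto simp: field_simps\<close>)
  with has_integral_affinity[of f I 0 1 m c] assms
  have "((\<lambda>t. f (m * t + c)) has_integral (1 / m) *\<^sub>R I) {- c / m..(1 - c) / m}" by simp
  from has_integral_cmul[OF this, of m] show ?thesis using assms(2) by simp
qed

lemma has_integral_reflect_01:
  fixes f :: "real \<Rightarrow> 'b::real_normed_vector"
  assumes "(f has_integral I) {0..1}"
  shows "((\<lambda>t. f (1 - t)) has_integral I) {0..1}"
proof -
  have "(\<lambda>x. (1 / -1) *\<^sub>R x + - ((1 / -1) *\<^sub>R 1)) ` {0..1} = {0..1::real}"
  proof (intro equalityI subsetI)
    fix x :: real assume "x \<in> {0..1}"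
    then show "x \<in> (\<lambda>x. (1 / -1) *\<^sub>R x + - ((1 / -1) *\<^sub>R 1)) ` {0..1}"
      by (intro image_eqI[of _ _ "1 - x"]) auto
  qed auto
  with has_integral_affinity[of f I 0 1 "-1" 1] assms show ?thesis by simp
qed

text \<open>The three pieces of the path are traversed on \<open>[0, 1/2]\<close>, \<open>[1/2, 3/4]\<close> and \<open>[3/4, 1]\<close>. The sign in
\<open>G (1 - z) = - F z\<close> compensates \<open>d\<lambda> = - dz\<close>.\<close>

lemma vector_contour_integral_n_stolz_path:
  fixes F G :: "complex \<Rightarrow> 'b::complex_banach"
  assumes GF: "\<And>z. z \<in> U \<Longrightarrow> G (1 - z) = - F z"
    and edge: "\<And>t. 0 < t \<Longrightarrow> t \<le> 1 \<Longrightarrow>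
        of_real t * stolz_arc (rot n j) \<beta> 0 \<in> U \<and> of_real t * stolz_arc (rot n j) \<beta> 1 \<in> U"
    and arc: "\<And>t. 0 \<le> t \<Longrightarrow> t \<le> 1 \<Longrightarrow> stolz_arc (rot n j) \<beta> t \<in> U"
    and int: "(\<lambda>t. stolz_arc (rot n j) \<beta> 0 *\<^sub>C F (of_real t * stolz_arc (rot n j) \<beta> 0)) integrable_on {0..1}"
      "(\<lambda>t. stolz_arc (rot n j) \<beta> 1 *\<^sub>C F (of_real t * stolz_arc (rot n j) \<beta> 1)) integrable_on {0..1}"
      "(\<lambda>t. stolz_arc_dt (rot n j) \<beta> t *\<^sub>C F (stolz_arc (rot n j) \<beta> t)) integrable_on {0..1}"
  shows "vector_contour_integral (n_stolz_path n j \<beta>) G = stolz_integral (rot n j) \<beta> F"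
proof -
  define u where "u = rot n j"
  define w0 w1 where "w0 = stolz_arc u \<beta> 0" and "w1 = stolz_arc u \<beta> 1"
  define P where "P = n_stolz_path n j \<beta>"
  define I where "I t = vector_derivative P (at t within {0..1}) *\<^sub>C G (P t)" for t
  have P0: "P t = 1 - of_real (2 * t) * w0" if "t < 1 / 2" for t
    using that by (simp add: P_def n_stolz_path_def stolz_path_def joinpaths_def linepath_def u_def w0_def
        stolz_arc_def stolz_angle_def scaleR_conv_of_real algebra_simps)
  have P1: "P t = 1 - stolz_arc u \<beta> (4 * t - 2)" if "1 / 2 < t" "t < 3 / 4" for t
  proof -
    have "linepath (pi / 2 - \<beta>) (3 * pi / 2 + \<beta>) (4 * t - 2) = stolz_angle \<beta> (4 * t - 2)"
      by (simp add: linepath_def stolz_angle_def algebra_simps add_divide_distrib diff_divide_distrib)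
    moreover have "2 * (2 * t - 1) = 4 * t - 2" by simp
    ultimately show ?thesis using that
      by (simp add: P_def n_stolz_path_def stolz_path_def joinpaths_def part_circlepath_def u_def
          stolz_arc_def cis_conv_exp)
  qed
  have P2: "P t = 1 - of_real (1 - (4 * t - 3)) * w1" if "3 / 4 < t" for t
  proof -
    have "2 * (2 * t - 1) - 1 = 4 * t - 3" by simp
    moreover have "stolz_angle \<beta> 1 = 3 * pi / 2 + \<beta>" by (simp add: stolz_angle_def)
    ultimately show ?thesis using that
      by (simp add: P_def n_stolz_path_def stolz_path_def joinpaths_def linepath_def u_def w1_def
          stolz_arc_def scaleR_conv_of_real algebra_simps)
  qed
  have vd: "vector_derivative P (at t within {0..1}) = D"
    if "(Q has_vector_derivative D) (at t)" "open T" "t \<in> T" "T \<subseteq> {0..1}" "\<And>x. x \<in> T \<Longrightarrow> P x = Q x"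
    for Q D t T
  proof (rule vector_derivative_at_within_ivl)
    show "(P has_vector_derivative D) (at t)"
      by (rule has_vector_derivative_transform_within_open[OF that(1-3)]) (use that(5) in auto)
  qed (use that in auto)
  have I0: "I t = 2 *\<^sub>R (w0 *\<^sub>C F (of_real (2 * t) * w0))" if t: "0 < t" "t < 1 / 2" for t
  proof -
    have "((\<lambda>t. 1 - of_real (2 * t) * w0) has_vector_derivative - (2 * w0)) (at t)"
      unfolding has_vector_derivative_def
      by (auto intro!: derivative_eq_intros simp: fun_eq_iff scaleR_conv_of_real)
    then have "vector_derivative P (at t within {0..1}) = - (2 * w0)"
      by (rule vd[where T = "{0<..<1/2}"]) (use t P0 in auto)
    moreover have "G (P t) = - F (of_real (2 * t) * w0)"
      using GF edge[of "2 * t"] t P0[of t] by (simp add: w0_def u_def)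
    ultimately show ?thesis
      by (simp add: I_def scaleC.minus_left scaleC.minus_right scaleC_of_real[symmetric] scaleC_scaleC)
  qed
  have I1: "I t = 4 *\<^sub>R (stolz_arc_dt u \<beta> (4 * t + (- 2)) *\<^sub>C F (stolz_arc u \<beta> (4 * t + (- 2))))"
    if t: "1 / 2 < t" "t < 3 / 4" for t
  proof -
    have "((\<lambda>t. 4 * t - 2) has_vector_derivative 4) (at t)"
      unfolding has_vector_derivative_def by (auto intro!: derivative_eq_intros)
    from vector_diff_chain_at[OF this stolz_arc_derivs(2)]
    have "((\<lambda>t. stolz_arc u \<beta> (4 * t - 2)) has_vector_derivative 4 *\<^sub>R stolz_arc_dt u \<beta> (4 * t - 2)) (at t)"
      by (simp add: o_def)
    then have "((\<lambda>t. 1 - stolz_arc u \<beta> (4 * t - 2)) has_vector_derivative 0 - 4 *\<^sub>R stolz_arc_dt u \<beta> (4 * t - 2)) (at t)"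
      by (intro has_vector_derivative_diff has_vector_derivative_const)
    then have "vector_derivative P (at t within {0..1}) = 0 - 4 *\<^sub>R stolz_arc_dt u \<beta> (4 * t - 2)"
      by (rule vd[where T = "{1/2<..<3/4}"]) (use t P1 in auto)
    moreover have "G (P t) = - F (stolz_arc u \<beta> (4 * t - 2))"
      using GF arc[of "4 * t - 2"] t P1[of t] by (simp add: u_def)
    ultimately show ?thesis
      by (simp add: I_def scaleC.minus_left scaleC.minus_right scaleC.scaleR_left)
  qed
  have I2: "I t = - (4 *\<^sub>R (w1 *\<^sub>C F (of_real (1 - (4 * t + (- 3))) * w1)))" if t: "3 / 4 < t" "t < 1" for t
  proof -
    have "((\<lambda>t. 1 - of_real (1 - (4 * t - 3)) * w1) has_vector_derivative (4 * w1)) (at t)"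
      unfolding has_vector_derivative_def
      by (auto intro!: derivative_eq_intros simp: fun_eq_iff scaleR_conv_of_real)
    then have "vector_derivative P (at t within {0..1}) = 4 * w1"
      by (rule vd[where T = "{3/4<..<1}"]) (use t P2 in auto)
    moreover have "G (P t) = - F (of_real (1 - (4 * t - 3)) * w1)"
      using GF edge[of "1 - (4 * t - 3)"] t P2[of t] by (simp add: w1_def u_def)
    ultimately show ?thesis
      by (simp add: I_def scaleC.minus_left scaleC.minus_right scaleC_of_real[symmetric] scaleC_scaleC)
  qed
  have s0: "((\<lambda>t. w0 *\<^sub>C F (of_real t * w0)) has_integral seg w0 F) {0..1}"
    using int(1) unfolding seg_def w0_def u_def by blast
  have s1: "((\<lambda>t. stolz_arc_dt u \<beta> t *\<^sub>C F (stolz_arc u \<beta> t)) has_integral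
       integral {0..1} (\<lambda>t. stolz_arc_dt u \<beta> t *\<^sub>C F (stolz_arc u \<beta> t))) {0..1}"
    using int(3) unfolding u_def by blast
  have "((\<lambda>t. w1 *\<^sub>C F (of_real t * w1)) has_integral seg w1 F) {0..1}"
    using int(2) unfolding seg_def w1_def u_def by blast
  note s2 = has_integral_reflect_01[OF this]
  have "((\<lambda>t. 2 *\<^sub>R (w0 *\<^sub>C F (of_real (2 * t) * w0))) has_integral seg w0 F) {0..1/2}"
    using has_integral_affine_pos[OF s0, of 2 0] by simp
  then have i0: "(I has_integral seg w0 F) {0..1/2}"
    using I0 by (subst (asm) interval_cbox, subst interval_cbox, elim has_integral_spike_interior) auto
  have "((\<lambda>t. 4 *\<^sub>R (stolz_arc_dt u \<beta> (4 * t + (- 2)) *\<^sub>C F (stolz_arc u \<beta> (4 * t + (- 2))))) has_integral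
      integral {0..1} (\<lambda>t. stolz_arc_dt u \<beta> t *\<^sub>C F (stolz_arc u \<beta> t))) {1/2..3/4}"
    using has_integral_affine_pos[OF s1, of 4 "-2"] by simp
  then have i1: "(I has_integral integral {0..1} (\<lambda>t. stolz_arc_dt u \<beta> t *\<^sub>C F (stolz_arc u \<beta> t))) {1/2..3/4}"
    using I1 by (subst (asm) interval_cbox, subst interval_cbox, elim has_integral_spike_interior) auto
  have "((\<lambda>t. 4 *\<^sub>R (w1 *\<^sub>C F (of_real (1 - (4 * t + (- 3))) * w1))) has_integral seg w1 F) {3/4..1}"
    using has_integral_affine_pos[OF s2, of 4 "-3"] by simp
  from has_integral_neg[OF this] have i2: "(I has_integral - seg w1 F) {3/4..1}"
    using I2 by (subst (asm) interval_cbox, subst interval_cbox, elim has_integral_spike_interior) auto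
  have "(I has_integral seg w0 F + integral {0..1} (\<lambda>t. stolz_arc_dt u \<beta> t *\<^sub>C F (stolz_arc u \<beta> t))) {0..3/4}"
    by (rule has_integral_combine[OF _ _ i0 i1]) auto
  from has_integral_combine[OF _ _ this i2]
  have "(I has_integral seg w0 F + integral {0..1} (\<lambda>t. stolz_arc_dt u \<beta> t *\<^sub>C F (stolz_arc u \<beta> t)) + - seg w1 F) {0..1}"
    by simp
  then show ?thesis
    unfolding vector_contour_integral_def P_def[symmetric] stolz_integral_def
    by (simp add: integral_unique I_def[abs_def] w0_def w1_def u_def)
qed

section \<open>The two functional calculi as integrals over Stolz boundaries\<close>

lemma open_rot_image:
  assumes "open S" shows "open ((\<lambda>z. rot n j * z) ` S)"
proof -
  have "(\<lambda>z. rot n j * z) ` S = (\<lambda>z. cnj (rot n j) * z) -` S" by (auto simp: in_rot_image_iff)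
  then show ?thesis using assms by (auto intro!: open_vimage continuous_intros)
qed

lemma open_n_sector: "0 < \<omega> \<Longrightarrow> \<omega> \<le> pi \<Longrightarrow> open (n_sector n \<omega>)"
  unfolding n_sector_def by (intro open_UN ballI open_rot_image open_sector)

lemma closed_closed_n_sector: "closed (closed_n_sector n \<omega>)"
  unfolding closed_n_sector_def by (intro closed_UN ballI closed_Collect_le continuous_intros) auto

lemma closed_closed_n_stolz_shift: "0 < \<alpha> \<Longrightarrow> \<alpha> < pi \<Longrightarrow> closed (closed_n_stolz_shift n \<alpha>)"
  unfolding closed_n_stolz_shift_def
  by (intro compact_imp_closed compact_UN compact_continuous_image compact_closed_stolz continuous_intros) auto

lemma n_stolz_mono:
  assumes "0 < s" "s \<le> \<gamma>" "\<gamma> \<le> pi / 2"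
  shows "n_stolz n s \<subseteq> n_stolz n \<gamma>"
  unfolding n_stolz_def by (intro image_mono UN_mono subset_refl stolz_shift_mono[OF assms])

lemma pi_div_le: "n > 1 \<Longrightarrow> pi / real n \<le> pi / 2"
  by (simp add: field_simps)

lemma n_Ritt_resolvent_dominated:
  fixes T A :: "'a::complex_banach \<Rightarrow>\<^sub>L 'a"
  assumes n: "n > 1" and T: "n_Ritt_of_type n \<alpha> T" and A: "A = id_blinfun - T" and \<beta>: "\<alpha> < \<beta>" "\<beta> < pi / real n"
  obtains C where "resolvent_dominated (blinfun_apply A) (- closed_n_stolz_shift n \<beta>) C"
proof -
  have \<alpha>: "0 < \<alpha>" and sp: "spectrum UNIV (blinfun_apply T) \<subseteq> closure (n_stolz n \<alpha>)"
    and bd: "bounded ((\<lambda>z. (z - 1) *\<^sub>C resolvent UNIV (blinfun_apply T) z) ` (- closure (n_stolz n \<beta>)))"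
    using T \<beta> unfolding n_Ritt_of_type_def by auto
  have \<beta>2: "\<beta> < pi / 2" using \<beta> pi_div_le[OF n] by linarith
  obtain C where C: "C > 0" "\<And>z. z \<notin> closure (n_stolz n \<beta>) \<Longrightarrow>
      norm ((z - 1) *\<^sub>C resolvent UNIV (blinfun_apply T) z) \<le> C"
    using bd unfolding bounded_pos by auto
  have "closure (n_stolz n \<alpha>) \<subseteq> closure (n_stolz n \<beta>)"
    using \<alpha> \<beta> \<beta>2 by (intro closure_mono n_stolz_mono) auto
  then have off: "1 - z \<notin> closure (n_stolz n \<beta>)" "z \<notin> spectrum UNIV (blinfun_apply A)"
    if "z \<notin> closed_n_stolz_shift n \<beta>" for z
    using closure_n_stolz_subset[of \<beta> "1 - z" n] that \<alpha> \<beta> \<beta>2 sp spectrum_one_minus[OF A, of z] by auto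
  have "0 \<in> closed_n_stolz_shift n \<beta>"
    using n unfolding closed_n_stolz_shift_def by (auto intro!: bexI[of _ 0] exI[of _ 0] simp: in_rot_image_iff)
  moreover have "cmod z * norm (resolvent UNIV (blinfun_apply A) z) \<le> C" if "z \<notin> closed_n_stolz_shift n \<beta>" for z
    using C(2)[OF off(1)[OF that]] resolvent_one_minus[OF A off(2)[OF that]] by (simp add: norm_scaleC)
  ultimately have "resolvent_dominated (blinfun_apply A) (- closed_n_stolz_shift n \<beta>) C"
    unfolding resolvent_dominated_def using off C(1) closed_closed_n_stolz_shift[of \<beta> n] \<alpha> \<beta> \<beta>2 by auto
  then show thesis by (rule that)
qed

lemma n_sectorial_resolvent_dominated:
  assumes n: "n > 1" and A: "n_sectorial n \<omega> UNIV A" and \<nu>: "\<omega> < \<nu>" "\<nu> < pi / real n"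
  obtains C where "resolvent_dominated A (- closed_n_sector n \<nu>) C"
proof -
  have \<omega>: "0 < \<omega>" and sp: "spectrum UNIV A \<subseteq> closure (n_sector n \<omega>)"
    and bd: "bounded ((\<lambda>z. z *\<^sub>C resolvent UNIV A z) ` (- closure (n_sector n \<nu>)))"
    using A \<nu> unfolding n_sectorial_def by auto
  have \<nu>2: "\<nu> < pi / 2" using \<nu> pi_div_le[OF n] by linarith
  obtain C where C: "C > 0" "\<And>z. z \<notin> closure (n_sector n \<nu>) \<Longrightarrow> norm (z *\<^sub>C resolvent UNIV A z) \<le> C"
    using bd unfolding bounded_pos by auto
  have "closure (n_sector n \<omega>) \<subseteq> closure (n_sector n \<nu>)"
    using \<nu> by (intro closure_mono n_sector_mono) auto
  then have off: "z \<notin> closure (n_sector n \<nu>)" "z \<notin> spectrum UNIV A" if "z \<notin> closed_n_sector n \<nu>" for z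
    using closure_n_sector_subset[of \<nu> n] that \<omega> \<nu> \<nu>2 sp by auto
  have "0 \<in> closed_n_sector n \<nu>" using n unfolding closed_n_sector_def by (auto intro!: bexI[of _ 0])
  then have "resolvent_dominated A (- closed_n_sector n \<nu>) C"
    unfolding resolvent_dominated_def using off C closed_closed_n_sector[of n \<nu>] by (auto simp: norm_scaleC)
  then show thesis by (rule that)
qed

text \<open>Since \<open>R(z)\<close> is of order \<open>1/z\<close>, a factor of order \<open>z powr s\<close> makes the integrand integrable at the vertex when \<open>s > 0\<close>
and at infinity when \<open>s < 0\<close>.\<close>

lemma scaled_resolvent:
  fixes A :: "'a::complex_banach \<Rightarrow> 'a"
  assumes A: "resolvent_dominated A \<Omega> C" and f: "f holomorphic_on V" "open V"
  shows "(\<lambda>z. f z *\<^sub>C resolvent UNIV A z) vec_holomorphic_on (V \<inter> \<Omega>)"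
    and "\<lbrakk>z \<in> V \<inter> \<Omega>; cmod (f z) \<le> c * cmod z powr s\<rbrakk> \<Longrightarrow>
        norm (f z *\<^sub>C resolvent UNIV A z) \<le> (c * C) * cmod z powr (s - 1)"
proof -
  show "(\<lambda>z. f z *\<^sub>C resolvent UNIV A z) vec_holomorphic_on (V \<inter> \<Omega>)"
    using A f resolvent_vec_holomorphic[OF A]
    by (intro vec_holomorphic_on_scaleC)
       (auto intro: holomorphic_on_subset vec_holomorphic_on_subset simp: resolvent_dominated_def)
  assume z: "z \<in> V \<inter> \<Omega>" and b: "cmod (f z) \<le> c * cmod z powr s"
  have z0: "z \<noteq> 0" "C \<ge> 0" using z A by (auto simp: resolvent_dominated_def)
  have "norm (f z *\<^sub>C resolvent UNIV A z) \<le> (c * cmod z powr s) * (C / cmod z)"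
    unfolding norm_scaleC
    by (rule mult_mono[OF b resolvent_dominated_norm_le[OF A]]) (use z order_trans[OF norm_ge_zero b] in auto)
  also have "\<dots> = (c * C) * cmod z powr (s - 1)" using z0 by (simp add: powr_diff)
  finally show "norm (f z *\<^sub>C resolvent UNIV A z) \<le> (c * C) * cmod z powr (s - 1)" .
qed

lemma rot_stolz_shift_one_minus:
  "j < n \<Longrightarrow> z \<in> (\<lambda>z. rot n j * z) ` stolz_shift \<gamma> \<Longrightarrow> 1 - z \<in> n_stolz n \<gamma>"
  unfolding n_stolz_def by blast

lemma n_stolz_memE:
  assumes "w \<in> n_stolz n \<gamma>"
  obtains j where "j < n" "1 - w \<in> (\<lambda>z. rot n j * z) ` stolz_shift \<gamma>"
  using assms unfolding n_stolz_def by auto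

lemma n_stolz_subset_n_sector:
  assumes "0 < \<gamma>" "\<gamma> < pi / 2" "w \<in> n_stolz n \<gamma>"
  shows "1 - w \<in> n_sector n \<gamma>"
proof -
  obtain j where "j < n" "1 - w \<in> (\<lambda>z. rot n j * z) ` stolz_shift \<gamma>" using assms(3) by (rule n_stolz_memE)
  then show ?thesis
    using stolz_shift_subset_sector[OF assms(1,2)] unfolding n_sector_def by blast
qed

lemma holomorphic_on_one_minus:
  assumes "\<phi> holomorphic_on n_stolz n \<gamma>" "j < n"
  shows "(\<lambda>z. \<phi> (1 - z)) holomorphic_on (\<lambda>z. rot n j * z) ` stolz_shift \<gamma>"
proof -
  have "(\<lambda>z. 1 - z) ` (\<lambda>z. rot n j * z) ` stolz_shift \<gamma> \<subseteq> n_stolz n \<gamma>"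
    using rot_stolz_shift_one_minus[OF assms(2)] by blast
  from holomorphic_on_compose_gen[OF _ assms(1) this] show ?thesis
    by (simp add: o_def holomorphic_intros)
qed

text \<open>All that Cauchy's theorem needs for the integrand of \<open>\<phi>(T)\<close>, for all contour angles \<open>x\<close> between \<open>\<beta>\<close> and \<open>\<gamma>\<close> at
once. The set \<open>U j\<close> is the Stolz domain of angle \<open>\<gamma>\<close> in direction \<open>j\<close> without the closed domains of an angle between
\<open>\<alpha>\<close> and \<open>\<beta>\<close>.\<close>

lemma Ritt_integrand:
  fixes T A :: "'a::complex_banach \<Rightarrow>\<^sub>L 'a"
  assumes n: "n > 1" and T: "n_Ritt_of_type n \<alpha> T" and A: "A = id_blinfun - T"
    and \<beta>: "\<alpha> < \<beta>" "\<beta> < \<gamma>" "\<gamma> < pi / real n" and \<phi>: "\<phi> \<in> H0_stolz n \<gamma>"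
  defines "F \<equiv> \<lambda>z. \<phi> (1 - z) *\<^sub>C resolvent UNIV (blinfun_apply A) z"
  obtains U M s where "s > 0"
    "\<And>j. j < n \<Longrightarrow> F vec_holomorphic_on U j"
    "\<And>j z. j < n \<Longrightarrow> z \<in> U j \<Longrightarrow> z \<notin> spectrum UNIV (blinfun_apply A)"
    "\<And>j z. j < n \<Longrightarrow> z \<in> U j \<Longrightarrow> norm (F z) \<le> M * cmod z powr (s - 1)"
    "\<And>j x t. j < n \<Longrightarrow> \<beta> \<le> x \<Longrightarrow> x < \<gamma> \<Longrightarrow> 0 < t \<Longrightarrow> t \<le> 1 \<Longrightarrow>
       of_real t * stolz_arc (rot n j) x 0 \<in> U j \<and> of_real t * stolz_arc (rot n j) x 1 \<in> U j"
    "\<And>j x t. j < n \<Longrightarrow> \<beta> \<le> x \<Longrightarrow> x < \<gamma> \<Longrightarrow> 0 \<le> t \<Longrightarrow> t \<le> 1 \<Longrightarrow> stolz_arc (rot n j) x t \<in> U j"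
proof -
  have \<alpha>: "0 < \<alpha>" using T unfolding n_Ritt_of_type_def by simp
  have \<gamma>2: "\<gamma> < pi / 2" using \<beta> pi_div_le[OF n] by linarith
  define \<alpha>' where "\<alpha>' = (\<alpha> + \<beta>) / 2"
  have "\<alpha> < \<alpha>'" "\<alpha>' < \<beta>" "0 < \<alpha>'" using \<alpha> \<beta> by (auto simp: \<alpha>'_def)
  then have \<alpha>': "\<alpha> < \<alpha>'" "\<alpha>' < \<beta>" "0 < \<alpha>'" "\<alpha>' < pi / real n" using \<beta> by auto
  obtain C where C: "resolvent_dominated (blinfun_apply A) (- closed_n_stolz_shift n \<alpha>') C"
    using n_Ritt_resolvent_dominated[OF n T A \<alpha>'(1,4)] .
  have hol: "\<phi> holomorphic_on n_stolz n \<gamma>" using \<phi> unfolding H0_stolz_def by simp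
  obtain c s where cs: "s > 0" "\<And>z. z \<in> n_stolz n \<gamma> \<Longrightarrow> cmod (\<phi> z) \<le> c * cmod (1 - z) powr s"
    using \<phi> unfolding H0_stolz_def by auto
  define V where "V j = (\<lambda>z. rot n j * z) ` stolz_shift \<gamma>" for j
  define U where "U j = V j \<inter> - closed_n_stolz_shift n \<alpha>'" for j
  have V: "(\<lambda>z. \<phi> (1 - z)) holomorphic_on V j" "open (V j)" if "j < n" for j
    unfolding V_def using \<alpha> \<beta> \<gamma>2 that
    by (auto intro!: holomorphic_on_one_minus[OF hol] open_rot_image open_stolz_shift)
  show thesis
  proof (rule that[OF cs(1)])
    fix j assume j: "j < n"
    show "F vec_holomorphic_on U j"
      unfolding F_def U_def by (rule scaled_resolvent(1)[OF C V[OF j]])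
    show "z \<notin> spectrum UNIV (blinfun_apply A)" if "z \<in> U j" for z
      using C that unfolding U_def resolvent_dominated_def by auto
    show "norm (F z) \<le> (c * C) * cmod z powr (s - 1)" if "z \<in> U j" for z
      unfolding F_def
      by (rule scaled_resolvent(2)[OF C V[OF j]])
         (use that cs(2)[OF rot_stolz_shift_one_minus[OF j, of z]] in \<open>auto simp: U_def V_def\<close>)
    show "of_real t * stolz_arc (rot n j) x 0 \<in> U j \<and> of_real t * stolz_arc (rot n j) x 1 \<in> U j"
      if "\<beta> \<le> x" "x < \<gamma>" "0 < t" "t \<le> 1" for x t
      unfolding U_def V_def
      using stolz_edge_mem[of x \<gamma> t] stolz_edge_notin_closed[OF n j, of \<alpha>' x t] that \<alpha>' \<beta> \<gamma>2 by auto
    show "stolz_arc (rot n j) x t \<in> U j" if "\<beta> \<le> x" "x < \<gamma>" "0 \<le> t" "t \<le> 1" for x t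
      unfolding U_def V_def
      using stolz_arc_mem[of x \<gamma>] stolz_arc_notin_closed[OF n j, of \<alpha>' x t 1] that \<alpha>' \<beta> \<gamma>2 by auto
  qed
qed

lemma Ritt_calculus_eq_stolz_integral:
  fixes T A :: "'a::complex_banach \<Rightarrow>\<^sub>L 'a"
  assumes n: "n > 1" and T: "n_Ritt_of_type n \<alpha> T" and A: "A = id_blinfun - T"
    and \<beta>: "\<alpha> < \<beta>" "\<beta> < \<gamma>" "\<gamma> < pi / real n" and \<phi>: "\<phi> \<in> H0_stolz n \<gamma>"
  shows "Ritt_calculus n \<beta> T \<phi> = (1 / (2 * of_real pi * \<i>)) *\<^sub>C
    (\<Sum>j<n. stolz_integral (rot n j) \<beta> (\<lambda>z. \<phi> (1 - z) *\<^sub>C resolvent UNIV (blinfun_apply A) z))"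
proof -
  define F where "F z = \<phi> (1 - z) *\<^sub>C resolvent UNIV (blinfun_apply A) z" for z
  obtain U M s where s: "s > 0" and hol: "\<And>j. j < n \<Longrightarrow> F vec_holomorphic_on U j"
    and sp: "\<And>j z. j < n \<Longrightarrow> z \<in> U j \<Longrightarrow> z \<notin> spectrum UNIV (blinfun_apply A)"
    and bd: "\<And>j z. j < n \<Longrightarrow> z \<in> U j \<Longrightarrow> norm (F z) \<le> M * cmod z powr (s - 1)"
    and edge: "\<And>j x t. j < n \<Longrightarrow> \<beta> \<le> x \<Longrightarrow> x < \<gamma> \<Longrightarrow> 0 < t \<Longrightarrow> t \<le> 1 \<Longrightarrow>
       of_real t * stolz_arc (rot n j) x 0 \<in> U j \<and> of_real t * stolz_arc (rot n j) x 1 \<in> U j"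
    and arc: "\<And>j x t. j < n \<Longrightarrow> \<beta> \<le> x \<Longrightarrow> x < \<gamma> \<Longrightarrow> 0 \<le> t \<Longrightarrow> t \<le> 1 \<Longrightarrow> stolz_arc (rot n j) x t \<in> U j"
    by (rule Ritt_integrand[OF n T A \<beta> \<phi>, folded F_def]) blast
  have "vector_contour_integral (n_stolz_path n j \<beta>) (\<lambda>z. \<phi> z *\<^sub>C resolvent UNIV (blinfun_apply T) z) =
      stolz_integral (rot n j) \<beta> F" if j: "j < n" for j
  proof (rule vector_contour_integral_n_stolz_path[where U = "U j"])
    note Fc = vec_holomorphic_on_imp_continuous_on[OF hol[OF j]]
    show "\<phi> (1 - z) *\<^sub>C resolvent UNIV (blinfun_apply T) (1 - z) = - F z" if "z \<in> U j" for z
      by (simp add: F_def resolvent_one_minus[OF A sp[OF j that]] scaleC.minus_right)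
    show "(\<lambda>t. stolz_arc (rot n j) \<beta> 0 *\<^sub>C F (of_real t * stolz_arc (rot n j) \<beta> 0)) integrable_on {0..1}"
      "(\<lambda>t. stolz_arc (rot n j) \<beta> 1 *\<^sub>C F (of_real t * stolz_arc (rot n j) \<beta> 1)) integrable_on {0..1}"
      by (rule seg_improper(1)[OF s Fc _ bd[OF j]], use edge[OF j] \<beta> in auto)+
    show "(\<lambda>t. stolz_arc_dt (rot n j) \<beta> t *\<^sub>C F (stolz_arc (rot n j) \<beta> t)) integrable_on {0..1}"
      by (rule arc_integrable[OF Fc]) (use arc[OF j] \<beta> in auto)
  qed (use edge[OF j] arc[OF j] \<beta> in auto)
  then show ?thesis unfolding Ritt_calculus_def F_def[symmetric] by simp
qed

lemma Ritt_calculus_angle_independent: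
  fixes T :: "'a::complex_banach \<Rightarrow>\<^sub>L 'a"
  assumes n: "n > 1" and T: "n_Ritt_of_type n \<alpha> T"
    and \<beta>: "\<alpha> < \<beta>" "\<beta> \<le> \<beta>'" "\<beta>' < \<gamma>" "\<gamma> < pi / real n" and \<phi>: "\<phi> \<in> H0_stolz n \<gamma>"
  shows "Ritt_calculus n \<beta> T \<phi> = Ritt_calculus n \<beta>' T \<phi>"
proof -
  define A where "A = id_blinfun - T"
  define F where "F z = \<phi> (1 - z) *\<^sub>C resolvent UNIV (blinfun_apply A) z" for z
  have \<beta>\<gamma>: "\<beta> < \<gamma>" using \<beta> by simp
  have \<alpha>: "0 < \<alpha>" using T unfolding n_Ritt_of_type_def by simp
  have \<gamma>2: "\<gamma> < pi / 2" using \<beta> pi_div_le[OF n] by linarith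
  have "stolz_integral (rot n j) \<beta> F = stolz_integral (rot n j) \<beta>' F" if j: "j < n" for j
    by (rule Ritt_integrand[OF n T A_def \<beta>(1) \<beta>\<gamma> \<beta>(4) \<phi>, folded F_def],
        rule stolz_integral_angle_independent)
       (use \<alpha> \<beta> \<gamma>2 j in auto)
  moreover have "Ritt_calculus n b T \<phi> = (1 / (2 * of_real pi * \<i>)) *\<^sub>C (\<Sum>j<n. stolz_integral (rot n j) b F)"
    if "\<alpha> < b" "b < \<gamma>" for b
    unfolding F_def[abs_def] by (rule Ritt_calculus_eq_stolz_integral[OF n T A_def that \<beta>(4) \<phi>])
  ultimately show ?thesis using \<beta> by simp
qed

lemma H0_sectorD:
  assumes "f \<in> H0_sector n \<theta>"
  obtains c s where "s > 0" "f holomorphic_on n_sector n \<theta>"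
    "\<And>z. z \<in> n_sector n \<theta> \<Longrightarrow> cmod (f z) \<le> c * cmod z powr s"
    "\<And>z. z \<in> n_sector n \<theta> \<Longrightarrow> cmod (f z) \<le> c * cmod z powr (- s)"
proof -
  obtain c s where cs: "c > 0" "s > 0" "\<And>z. z \<in> n_sector n \<theta> \<Longrightarrow>
      cmod (f z) \<le> c * (cmod z powr s / (1 + cmod z powr (2 * s)))"
    and hol: "f holomorphic_on n_sector n \<theta>"
    using assms unfolding H0_sector_def by auto
  have b: "x powr s / (1 + x powr (2 * s)) \<le> x powr s" "x powr s / (1 + x powr (2 * s)) \<le> x powr (- s)"
    if "x \<ge> 0" for x :: real
  proof -
    have "x powr s / (1 + x powr (2 * s)) \<le> x powr s / 1"
      by (intro divide_left_mono) (auto intro: add_pos_nonneg)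
    then show "x powr s / (1 + x powr (2 * s)) \<le> x powr s" by simp
    show "x powr s / (1 + x powr (2 * s)) \<le> x powr (- s)"
    proof (cases "x = 0")
      case False
      have p: "x powr (2 * s) = x powr s * x powr s" by (simp flip: powr_add)
      have pos: "0 < 1 + x powr (2 * s)" by (rule add_pos_nonneg) auto
      have "x powr s / (1 + x powr (2 * s)) \<le> x powr s / (x powr (2 * s))"
        using False that pos by (intro divide_left_mono) auto
      also have "\<dots> = x powr (- s)" using False that unfolding p by (simp add: powr_minus_divide)
      finally show ?thesis .
    qed simp
  qed
  show thesis
    by (rule that[OF cs(2) hol])
       (use cs(1) b in \<open>auto intro!: order_trans[OF cs(3)] mult_left_mono\<close>)
qed

lemma n_sector_memI:
  assumes "j < n" "w \<in> sector \<theta>"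
  shows "rot n j * w \<in> n_sector n \<theta>"
  using assms unfolding n_sector_def by blast

text \<open>Here the Ritt condition is used for more than the spectral angle of \<open>A\<close>: it confines the spectrum to the Stolz
domains, so that the contour may be cut off along their arcs.\<close>

lemma sectorial_calculus_eq_stolz_integral:
  fixes T A :: "'a::complex_banach \<Rightarrow>\<^sub>L 'a"
  assumes n: "n > 1" and T: "n_Ritt_of_type n \<alpha> T" and A: "A = id_blinfun - T"
    and \<nu>: "\<alpha> < \<nu>" "\<nu> < \<theta>" "\<theta> < pi / real n" and f: "f \<in> H0_sector n \<theta>"
  shows "sectorial_calculus n \<nu> UNIV (blinfun_apply A) f = (1 / (2 * of_real pi * \<i>)) *\<^sub>C
    (\<Sum>j<n. stolz_integral (rot n j) \<nu> (\<lambda>z. f z *\<^sub>C resolvent UNIV (blinfun_apply A) z))"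
proof -
  have \<alpha>: "0 < \<alpha>" using T unfolding n_Ritt_of_type_def by simp
  have \<theta>2: "\<theta> < pi / 2" using \<nu> pi_div_le[OF n] by linarith
  define \<alpha>' where "\<alpha>' = (\<alpha> + \<nu>) / 2"
  have "\<alpha> < \<alpha>'" "\<alpha>' < \<nu>" "0 < \<alpha>'" using \<alpha> \<nu> by (auto simp: \<alpha>'_def)
  then have \<alpha>': "\<alpha> < \<alpha>'" "\<alpha>' < \<nu>" "0 < \<alpha>'" "\<alpha>' < pi / real n" using \<nu> by auto
  obtain C where C: "resolvent_dominated (blinfun_apply A) (- closed_n_stolz_shift n \<alpha>') C"
    using n_Ritt_resolvent_dominated[OF n T A \<alpha>'(1,4)] .
  obtain c s where cs: "s > 0" and hol: "f holomorphic_on n_sector n \<theta>"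
    and b: "\<And>z. z \<in> n_sector n \<theta> \<Longrightarrow> cmod (f z) \<le> c * cmod z powr s"
      "\<And>z. z \<in> n_sector n \<theta> \<Longrightarrow> cmod (f z) \<le> c * cmod z powr (- s)"
    using H0_sectorD[OF f] by metis
  have op: "open (n_sector n \<theta>)" using \<alpha> \<nu> \<theta>2 by (intro open_n_sector) auto
  define U where "U = n_sector n \<theta> \<inter> - closed_n_stolz_shift n \<alpha>'"
  define F where "F z = f z *\<^sub>C resolvent UNIV (blinfun_apply A) z" for z
  have Fh: "F vec_holomorphic_on U"
    unfolding F_def[abs_def] U_def by (rule scaled_resolvent(1)[OF C hol op])
  have Fb: "norm (F z) \<le> (c * C) * cmod z powr (s - 1)" "norm (F z) \<le> (c * C) * cmod z powr (- s - 1)"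
    if "z \<in> U" for z
    unfolding F_def by (rule scaled_resolvent(2)[OF C hol op]; use that b in \<open>auto simp: U_def\<close>)+
  have "- ray_integral (rot n j * cis \<nu>) F + ray_integral (rot n j * cis (- \<nu>)) F = stolz_integral (rot n j) \<nu> F"
    if j: "j < n" for j
  proof (rule sector_integral_eq_stolz_integral[OF cs Fh _ _ _ _ _ Fb])
    fix t :: real assume t: "0 < t"
    have "of_real t * (rot n j * cis x) \<in> U" if "\<bar>x\<bar> = \<nu>" for x
    proof -
      have "rot n j * (of_real t * cis x) \<in> n_sector n \<theta>"
        using that t j \<nu> \<theta>2 by (intro n_sector_memI cis_in_sector) auto
      then have "of_real t * (rot n j * cis x) \<in> n_sector n \<theta>" by (simp only: mult.left_commute)
      then show ?thesis
        unfolding U_def using ray_notin_closed_n_sector[of j n t \<alpha>' x] closed_n_stolz_shift_subset[of \<alpha>' n]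
          that t j \<alpha>' \<nu> \<theta>2 by auto
    qed
    from this[of \<nu>] this[of "-\<nu>"]
    show "of_real t * (rot n j * cis \<nu>) \<in> U \<and> of_real t * (rot n j * cis (- \<nu>)) \<in> U"
      using \<alpha> \<nu> by auto
  next
    fix t r :: real assume t: "0 \<le> t" "t \<le> 1" "1 \<le> r"
    obtain w where w: "w \<in> stolz_shift \<theta>" "stolz_arc (rot n j) \<nu> t = rot n j * w"
      using stolz_arc_mem[of \<nu> \<theta> "rot n j" t] \<alpha> \<nu> \<theta>2 by auto
    then have "of_real r * w \<in> sector \<theta>"
      using stolz_shift_subset_sector[of \<theta>] scaled_in_sector[of w \<theta> r] t \<alpha> \<nu> \<theta>2 by auto
    then have "rot n j * (of_real r * w) \<in> n_sector n \<theta>" by (rule n_sector_memI[OF j])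
    then have "of_real r * stolz_arc (rot n j) \<nu> t \<in> n_sector n \<theta>" by (simp only: w(2) mult.left_commute)
    then show "of_real r * stolz_arc (rot n j) \<nu> t \<in> U"
      unfolding U_def using stolz_arc_notin_closed[OF n j, of \<alpha>' \<nu> t r] t \<alpha>' \<nu> by auto
  qed (use \<alpha> \<nu> \<theta>2 in auto)
  then show ?thesis unfolding sectorial_calculus_def F_def[symmetric] by simp
qed

lemma sectorial_calculus_angle_independent:
  assumes n: "n > 1" and A: "n_sectorial n \<omega> UNIV A"
    and \<nu>: "\<omega> < \<nu>" "\<nu> \<le> \<nu>'" "\<nu>' < \<theta>" "\<theta> < pi / real n" and f: "f \<in> H0_sector n \<theta>"
  shows "sectorial_calculus n \<nu> UNIV A f = sectorial_calculus n \<nu>' UNIV A f"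
proof -
  have \<omega>: "0 < \<omega>" using A unfolding n_sectorial_def by simp
  have \<theta>2: "\<theta> < pi / 2" using \<nu> pi_div_le[OF n] by linarith
  define \<omega>' where "\<omega>' = (\<omega> + \<nu>) / 2"
  have "\<omega> < \<omega>'" "\<omega>' < \<nu>" "0 < \<omega>'" using \<omega> \<nu> by (auto simp: \<omega>'_def)
  then have \<omega>': "\<omega> < \<omega>'" "\<omega>' < \<nu>" "0 < \<omega>'" "\<omega>' < pi / real n" using \<nu> by auto
  obtain C where C: "resolvent_dominated A (- closed_n_sector n \<omega>') C"
    using n_sectorial_resolvent_dominated[OF n A \<omega>'(1,4)] .
  obtain c s where cs: "s > 0" and hol: "f holomorphic_on n_sector n \<theta>"
    and b: "\<And>z. z \<in> n_sector n \<theta> \<Longrightarrow> cmod (f z) \<le> c * cmod z powr s"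
      "\<And>z. z \<in> n_sector n \<theta> \<Longrightarrow> cmod (f z) \<le> c * cmod z powr (- s)"
    using H0_sectorD[OF f] by metis
  have op: "open (n_sector n \<theta>)" using \<omega> \<nu> \<theta>2 by (intro open_n_sector) auto
  define U where "U = n_sector n \<theta> \<inter> - closed_n_sector n \<omega>'"
  define F where "F z = f z *\<^sub>C resolvent UNIV A z" for z
  have Fh: "F vec_holomorphic_on U"
    unfolding F_def[abs_def] U_def by (rule scaled_resolvent(1)[OF C hol op])
  have Fb: "norm (F z) \<le> (c * C) * cmod z powr (s - 1)" "norm (F z) \<le> (c * C) * cmod z powr (- s - 1)"
    if "z \<in> U" for z
    unfolding F_def by (rule scaled_resolvent(2)[OF C hol op]; use that b in \<open>auto simp: U_def\<close>)+
  have ray: "of_real t * (rot n j * cis x) \<in> U" if "\<nu> \<le> \<bar>x\<bar>" "\<bar>x\<bar> \<le> \<nu>'" "0 < t" "j < n" for x t j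
  proof -
    have "rot n j * (of_real t * cis x) \<in> n_sector n \<theta>"
      using that \<nu> \<theta>2 by (intro n_sector_memI cis_in_sector) auto
    then have "of_real t * (rot n j * cis x) \<in> n_sector n \<theta>" by (simp only: mult.left_commute)
    then show ?thesis
      unfolding U_def using ray_notin_closed_n_sector[of j n t \<omega>' x] that \<omega>' \<nu> by auto
  qed
  have "ray_integral (rot n j * cis \<nu>) F = ray_integral (rot n j * cis \<nu>') F" if "j < n" for j
    by (rule ray_integral_rotate[OF cs Fh _ \<nu>(2) _ Fb]) (use ray that \<omega> \<nu> in auto)
  moreover have "ray_integral (rot n j * cis (- \<nu>')) F = ray_integral (rot n j * cis (- \<nu>)) F" if "j < n" for j
    by (rule ray_integral_rotate[OF cs Fh _ _ _ Fb]) (use ray that \<omega> \<nu> in auto)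
  ultimately show ?thesis unfolding sectorial_calculus_def F_def[symmetric] by simp
qed

section \<open>Splitting a function on all sectors\<close>

lemma sup_norm_on_upper:
  assumes "bounded (f ` S)" "z \<in> S"
  shows "cmod (f z) \<le> sup_norm_on S f"
proof -
  obtain B where "\<And>z. z \<in> S \<Longrightarrow> cmod (f z) \<le> B" using assms(1) unfolding bounded_iff by auto
  then have "bdd_above ((\<lambda>z. cmod (f z)) ` S)" unfolding bdd_above_def by auto
  then show ?thesis unfolding sup_norm_on_def using assms(2) by (rule cSUP_upper[rotated])
qed

lemma sup_norm_on_least:
  assumes "S \<noteq> {}" "\<And>z. z \<in> S \<Longrightarrow> cmod (f z) \<le> B"
  shows "sup_norm_on S f \<le> B"
  unfolding sup_norm_on_def using assms by (rule cSUP_least)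

lemma n_sector_nonempty:
  assumes "n > 0" "0 < \<theta>" "\<theta> \<le> pi"
  shows "n_sector n \<theta> \<noteq> {}"
proof -
  have "of_real 1 * cis 0 \<in> sector \<theta>" using assms by (intro cis_in_sector) auto
  then show ?thesis using n_sector_memI[OF assms(1), of _ \<theta>] by blast
qed

lemma stolz_shift_nonempty:
  assumes "0 < \<gamma>" "\<gamma> < pi / 2"
  shows "stolz_shift \<gamma> \<noteq> {}"
  using stolz_arc_mem[of "\<gamma> / 2" \<gamma> 1 0] assms by auto

lemma n_stolz_nonempty:
  assumes "n > 0" "0 < \<gamma>" "\<gamma> < pi / 2"
  shows "n_stolz n \<gamma> \<noteq> {}"
  using stolz_shift_nonempty[OF assms(2,3)] assms(1) unfolding n_stolz_def by auto

text \<open>The sectors of \<open>n_sector\<close> are disjoint open sets, so the functions obtained from \<open>sector_decomposition\<close> separately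
in the \<open>n\<close> directions together define one holomorphic function.\<close>

lemma H0_stolz_decomposition:
  assumes n: "n > 1" and \<theta>: "0 < \<theta>" "\<theta> < \<gamma>" "\<gamma> < pi / real n"
  obtains C where "C > 0"
    "\<And>\<phi>. \<phi> \<in> H0_stolz n \<gamma> \<Longrightarrow> \<exists>h\<in>H0_sector n \<theta>.
       (\<forall>z\<in>n_sector n \<theta>. cmod (h z) \<le> C * sup_norm_on (n_stolz n \<gamma>) \<phi>) \<and>
       (\<forall>j<n. \<forall>z\<in>(\<lambda>z. rot n j * z) ` stolz_shift \<theta>.
          cmod (\<phi> (1 - z) - h z) \<le> C * sup_norm_on (n_stolz n \<gamma>) \<phi> * cmod z)"
proof -
  have \<gamma>2: "\<gamma> < pi / 2" using \<theta> pi_div_le[OF n] by linarith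
  obtain C where C: "C > 0"
    and dec: "\<And>f M c s. f holomorphic_on stolz_shift \<gamma> \<Longrightarrow> 0 < s \<Longrightarrow> s \<le> 1 \<Longrightarrow>
       (\<And>z. z \<in> stolz_shift \<gamma> \<Longrightarrow> cmod (f z) \<le> M) \<Longrightarrow>
       (\<And>z. z \<in> stolz_shift \<gamma> \<Longrightarrow> cmod (f z) \<le> c * cmod z powr s) \<Longrightarrow>
       \<exists>h. sector_extension \<theta> (C * M) s f h"
    using sector_decomposition[OF \<theta>(1,2) \<gamma>2] by metis
  have "\<exists>h\<in>H0_sector n \<theta>.
       (\<forall>z\<in>n_sector n \<theta>. cmod (h z) \<le> C * sup_norm_on (n_stolz n \<gamma>) \<phi>) \<and>
       (\<forall>j<n. \<forall>z\<in>(\<lambda>z. rot n j * z) ` stolz_shift \<theta>.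
          cmod (\<phi> (1 - z) - h z) \<le> C * sup_norm_on (n_stolz n \<gamma>) \<phi> * cmod z)"
    if \<phi>: "\<phi> \<in> H0_stolz n \<gamma>" for \<phi>
  proof -
    define M where "M = sup_norm_on (n_stolz n \<gamma>) \<phi>"
    have hol: "\<phi> holomorphic_on n_stolz n \<gamma>" and bnd: "bounded (\<phi> ` n_stolz n \<gamma>)"
      using \<phi> unfolding H0_stolz_def by auto
    obtain c s0 where c: "c > 0" and s0: "s0 > 0"
      and dc: "\<And>z. z \<in> n_stolz n \<gamma> \<Longrightarrow> cmod (\<phi> z) \<le> c * cmod (1 - z) powr s0"
      using \<phi> unfolding H0_stolz_def by auto
    \<comment> \<open>On the bounded domain the exponent may be lowered to at most \<open>1\<close>, since \<open>h\<close> agrees with \<open>f\<close> only to first order.\<close>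
    define s where "s = min s0 1"
    have s: "0 < s" "s \<le> 1" "s \<le> s0" using s0 by (auto simp: s_def)
    have "\<exists>h. sector_extension \<theta> (C * M) s (\<lambda>z. \<phi> (1 - rot n j * z)) h"
      if j: "j < n" for j
    proof (rule dec[OF _ s(1,2), where c = "c * 2 powr (s0 - s)"])
      have "(\<lambda>z. rot n j * z) ` stolz_shift \<gamma> \<subseteq> (\<lambda>z. rot n j * z) ` stolz_shift \<gamma>" by simp
      from holomorphic_on_compose_gen[OF _ holomorphic_on_one_minus[OF hol j] this]
      show "(\<lambda>z. \<phi> (1 - rot n j * z)) holomorphic_on stolz_shift \<gamma>"
        by (auto simp: o_def intro!: holomorphic_intros)
      fix z assume z: "z \<in> stolz_shift \<gamma>"
      then have mem: "1 - rot n j * z \<in> n_stolz n \<gamma>" using j by (intro rot_stolz_shift_one_minus) auto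
      then show "cmod (\<phi> (1 - rot n j * z)) \<le> M" unfolding M_def by (rule sup_norm_on_upper[OF bnd])
      have "cmod z < 2" using z \<theta> \<gamma>2 by (intro norm_stolz_shift_less[of \<gamma>]) auto
      have "cmod (\<phi> (1 - rot n j * z)) \<le> c * cmod z powr s0" using dc[OF mem] by (simp add: norm_mult)
      also have "cmod z powr s0 = cmod z powr (s0 - s) * cmod z powr s" by (simp flip: powr_add)
      also have "\<dots> \<le> 2 powr (s0 - s) * cmod z powr s"
        using \<open>cmod z < 2\<close> s by (intro mult_right_mono powr_mono2) auto
      finally show "cmod (\<phi> (1 - rot n j * z)) \<le> c * 2 powr (s0 - s) * cmod z powr s"
        using c by (simp add: mult.assoc)
    qed
    then have "\<exists>H. \<forall>j<n. sector_extension \<theta> (C * M) s (\<lambda>z. \<phi> (1 - rot n j * z)) (H j)" by metis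
    then obtain H c' where H: "\<And>j. j < n \<Longrightarrow> H j holomorphic_on sector \<theta>"
        "\<And>j z. j < n \<Longrightarrow> z \<in> sector \<theta> \<Longrightarrow> cmod (H j z) \<le> C * M"
        "\<And>j z. j < n \<Longrightarrow> z \<in> sector \<theta> \<Longrightarrow> cmod (H j z) \<le> c' j * (cmod z powr s / (1 + cmod z powr (2 * s)))"
        "\<And>j z. j < n \<Longrightarrow> z \<in> stolz_shift \<theta> \<Longrightarrow> cmod (\<phi> (1 - rot n j * z) - H j z) \<le> C * M * cmod z"
      unfolding sector_extension_def by metis
    \<comment> \<open>The index of the sector containing \<open>z\<close>.\<close>
    define J where "J z = (SOME j. j < n \<and> z \<in> (\<lambda>z. rot n j * z) ` sector \<theta>)" for z
    define h where "h z = H (J z) (cnj (rot n (J z)) * z)" for z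
    have uniq: "j = k" if "j < n" "k < n" "z \<in> (\<lambda>z. rot n j * z) ` sector \<theta>" "z \<in> (\<lambda>z. rot n k * z) ` sector \<theta>" for j k z
    proof (rule cone_unique[OF that(1,2)])
      show "z \<noteq> 0" using that(3) by (auto simp: sector_def)
      show "cos \<theta> * cmod z \<le> Re (cnj (rot n j) * z)" "cos \<theta> * cmod z \<le> Re (cnj (rot n k) * z)"
        using that(3,4) \<theta> \<gamma>2 by (auto simp: in_rot_image_iff sector_eq norm_mult simp del: times_complex.sel)
    qed (use \<theta> in auto)
    have J: "J z = j" if "j < n" "z \<in> (\<lambda>z. rot n j * z) ` sector \<theta>" for j z
      using someI[of "\<lambda>j. j < n \<and> z \<in> (\<lambda>z. rot n j * z) ` sector \<theta>" j] that uniq unfolding J_def by blast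
    have h: "h (rot n j * w) = H j w" if "j < n" "w \<in> sector \<theta>" for j w
      unfolding h_def using J[of j "rot n j * w"] that by simp
    have mem: thesis if "z \<in> n_sector n \<theta>" "\<And>j w. j < n \<Longrightarrow> w \<in> sector \<theta> \<Longrightarrow> z = rot n j * w \<Longrightarrow> thesis" for z thesis
      using that unfolding n_sector_def by blast
    have hM: "cmod (h z) \<le> C * M" if "z \<in> n_sector n \<theta>" for z
      using that by (rule mem) (simp add: h H)
    have "h holomorphic_on n_sector n \<theta>"
      unfolding n_sector_def
    proof (rule holomorphic_on_UN_open)
      fix j assume "j \<in> {..<n}"
      then have j: "j < n" by simp
      show "open ((\<lambda>z. rot n j * z) ` sector \<theta>)" using \<theta> \<gamma>2 by (intro open_rot_image open_sector) auto
      have "(\<lambda>z. cnj (rot n j) * z) ` (\<lambda>z. rot n j * z) ` sector \<theta> \<subseteq> sector \<theta>" by auto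
      from holomorphic_on_compose_gen[OF _ H(1)[OF j] this]
      have "(\<lambda>z. H j (cnj (rot n j) * z)) holomorphic_on (\<lambda>z. rot n j * z) ` sector \<theta>"
        by (auto simp: o_def intro!: holomorphic_intros)
      then show "h holomorphic_on (\<lambda>z. rot n j * z) ` sector \<theta>"
        by (rule holomorphic_transform) (auto simp: h[OF j])
    qed
    moreover have "bounded (h ` n_sector n \<theta>)" unfolding bounded_iff using hM by blast
    moreover have "\<exists>c>0. \<exists>s>0. \<forall>z\<in>n_sector n \<theta>. cmod (h z) \<le> c * (cmod z powr s / (1 + cmod z powr (2 * s)))"
    proof -
      have pos: "0 < 1 + (\<Sum>j<n. \<bar>c' j\<bar>)" by (intro add_pos_nonneg sum_nonneg) auto
      have "cmod (h z) \<le> (1 + (\<Sum>j<n. \<bar>c' j\<bar>)) * (cmod z powr s / (1 + cmod z powr (2 * s)))"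
        if "z \<in> n_sector n \<theta>" for z
        using that
      proof (rule mem)
        fix j w assume j: "j < n" and w: "w \<in> sector \<theta>" "z = rot n j * w"
        have "c' j \<le> \<bar>c' j\<bar>" by simp
        also have "\<dots> \<le> (\<Sum>j<n. \<bar>c' j\<bar>)" using j by (intro member_le_sum) auto
        finally have "c' j \<le> 1 + (\<Sum>j<n. \<bar>c' j\<bar>)" by simp
        then have "c' j * (cmod w powr s / (1 + cmod w powr (2 * s))) \<le>
            (1 + (\<Sum>j<n. \<bar>c' j\<bar>)) * (cmod w powr s / (1 + cmod w powr (2 * s)))"
          by (intro mult_right_mono) (auto intro!: divide_nonneg_nonneg add_nonneg_nonneg)
        with H(3)[OF j w(1)] show ?thesis using h[OF j w(1)] w(2) by (simp add: norm_mult)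
      qed
      with pos s(1) show ?thesis by blast
    qed
    ultimately have "h \<in> H0_sector n \<theta>" unfolding H0_sector_def by blast
    moreover have "cmod (\<phi> (1 - z) - h z) \<le> C * M * cmod z"
      if j: "j < n" and z: "z \<in> (\<lambda>z. rot n j * z) ` stolz_shift \<theta>" for j z
    proof -
      obtain w where w: "w \<in> stolz_shift \<theta>" "z = rot n j * w" using z by auto
      have "w \<in> sector \<theta>" using w(1) stolz_shift_subset_sector[of \<theta>] \<theta> \<gamma>2 by auto
      then show ?thesis using H(4)[OF j w(1)] h[OF j] w(2) by (simp add: norm_mult)
    qed
    ultimately show ?thesis using hM unfolding M_def by blast
  qed
  then show thesis by (intro that[OF C])
qed

section \<open>Transfer of bounded calculi\<close>

text \<open>The Stolz domains are contained in the sectors of the same angle, and \<open>z R(z, A) = (\<lambda> - 1) R(\<lambda>, T)\<close>.\<close>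

lemma n_Ritt_imp_n_sectorial:
  fixes T A :: "'a::complex_banach \<Rightarrow>\<^sub>L 'a"
  assumes n: "n > 1" and T: "n_Ritt_of_type n \<alpha> T" and A: "A = id_blinfun - T"
  shows "n_sectorial n \<alpha> UNIV (blinfun_apply A)"
proof -
  have \<alpha>: "0 < \<alpha>" "\<alpha> < pi / real n" and Tb: "T \<in> bounded_ops"
    and sp: "spectrum UNIV (blinfun_apply T) \<subseteq> closure (n_stolz n \<alpha>)"
    and bd: "\<And>\<beta>. \<alpha> < \<beta> \<Longrightarrow> \<beta> < pi / real n \<Longrightarrow>
        bounded ((\<lambda>z. (z - 1) *\<^sub>C resolvent UNIV (blinfun_apply T) z) ` (- closure (n_stolz n \<beta>)))"
    using T unfolding n_Ritt_of_type_def by auto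
  have in_closure: "z \<in> closure (n_sector n \<beta>)"
    if "1 - z \<in> closure (n_stolz n \<beta>)" "0 < \<beta>" "\<beta> < pi / real n" for z \<beta>
  proof -
    have "\<beta> < pi / 2" using that pi_div_le[OF n] by linarith
    then have "(\<lambda>w. 1 - w) ` n_stolz n \<beta> \<subseteq> closure (n_sector n \<beta>)"
      using n_stolz_subset_n_sector[of \<beta> _ n] that closure_subset by blast
    then have "(\<lambda>w. 1 - w) ` closure (n_stolz n \<beta>) \<subseteq> closure (n_sector n \<beta>)"
      by (intro image_closure_subset continuous_intros) auto
    moreover have "z \<in> (\<lambda>w. 1 - w) ` closure (n_stolz n \<beta>)" using that(1) by (intro image_eqI[of _ _ "1 - z"]) auto
    ultimately show ?thesis by blast
  qed
  have spA: "spectrum UNIV (blinfun_apply A) \<subseteq> closure (n_sector n \<alpha>)"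
    using sp in_closure[OF _ \<alpha>] spectrum_one_minus[OF A] by blast
  have "closed_densely_defined UNIV (blinfun_apply A)"
    unfolding closed_densely_defined_def
  proof (intro conjI ballI allI)
    have "{(x, blinfun_apply A x) | x. x \<in> UNIV} = {p. blinfun_apply A (fst p) = snd p}" by auto
    moreover have "closed {p. blinfun_apply A (fst p) = snd p}"
      by (intro closed_Collect_eq continuous_intros)
    ultimately show "closed {(x, blinfun_apply A x) | x. x \<in> UNIV}" by simp
    show "blinfun_apply A (c *\<^sub>C x) = c *\<^sub>C blinfun_apply A x" for c x
      using Tb unfolding A bounded_ops_def by (simp add: blinfun.diff_left scaleC.diff_right)
  qed (simp_all add: blinfun.add_right)
  moreover have "bounded ((\<lambda>z. z *\<^sub>C resolvent UNIV (blinfun_apply A) z) ` (- closure (n_sector n \<nu>)))"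
    if \<nu>: "\<alpha> < \<nu>" "\<nu> < pi / real n" for \<nu>
  proof -
    obtain C where C: "\<And>z. z \<notin> closure (n_stolz n \<nu>) \<Longrightarrow>
        norm ((z - 1) *\<^sub>C resolvent UNIV (blinfun_apply T) z) \<le> C"
      using bd[OF \<nu>] unfolding bounded_iff by auto
    have "norm (z *\<^sub>C resolvent UNIV (blinfun_apply A) z) \<le> C" if z: "z \<notin> closure (n_sector n \<nu>)" for z
    proof -
      have "closure (n_sector n \<alpha>) \<subseteq> closure (n_sector n \<nu>)"
        using \<nu> by (intro closure_mono n_sector_mono) auto
      then have "z \<notin> spectrum UNIV (blinfun_apply A)" using spA z by blast
      from resolvent_one_minus[OF A this] C[of "1 - z"] show ?thesis
        using in_closure[of z \<nu>] z \<alpha> \<nu> by (auto simp: norm_scaleC)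
    qed
    then show ?thesis unfolding bounded_iff by auto
  qed
  ultimately show ?thesis using \<alpha> spA unfolding n_sectorial_def by blast
qed

lemma sectorial_bounded_calculus_of_Ritt:
  fixes T A :: "'a::complex_banach \<Rightarrow>\<^sub>L 'a"
  assumes n: "n > 1" and A: "A = id_blinfun - T" and \<gamma>: "0 < \<gamma>" "\<gamma> < pi / real n"
    and calc: "Ritt_bounded_calculus n \<gamma> T"
  shows "sectorial_bounded_calculus n \<gamma> UNIV (blinfun_apply A)"
proof -
  have \<gamma>2: "\<gamma> < pi / 2" using \<gamma> pi_div_le[OF n] by linarith
  obtain \<alpha> K where \<alpha>: "0 < \<alpha>" "\<alpha> < \<gamma>" and T: "n_Ritt_of_type n \<alpha> T" and K: "K > 0"
    and bound: "\<And>\<phi> \<beta>. \<phi> \<in> H0_stolz n \<gamma> \<Longrightarrow> \<alpha> < \<beta> \<Longrightarrow> \<beta> < \<gamma> \<Longrightarrow>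
        norm (Ritt_calculus n \<beta> T \<phi>) \<le> K * sup_norm_on (n_stolz n \<gamma>) \<phi>"
    using calc unfolding Ritt_bounded_calculus_def by metis
  have "norm (sectorial_calculus n \<nu> UNIV (blinfun_apply A) f) \<le> K * sup_norm_on (n_sector n \<gamma>) f"
    if f: "f \<in> H0_sector n \<gamma>" and \<nu>: "\<alpha> < \<nu>" "\<nu> < \<gamma>" for f \<nu>
  proof -
    define \<phi> where "\<phi> w = f (1 - w)" for w
    have sub: "1 - w \<in> n_sector n \<gamma>" if "w \<in> n_stolz n \<gamma>" for w
      using n_stolz_subset_n_sector[OF \<gamma>(1) \<gamma>2 that] .
    have bnd: "bounded (f ` n_sector n \<gamma>)" using f unfolding H0_sector_def by simp
    obtain c s where cs: "s > 0" and hol: "f holomorphic_on n_sector n \<gamma>"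
      and b: "\<And>z. z \<in> n_sector n \<gamma> \<Longrightarrow> cmod (f z) \<le> c * cmod z powr s"
      using H0_sectorD[OF f] by metis
    have "\<phi> \<in> H0_stolz n \<gamma>"
      unfolding H0_stolz_def mem_Collect_eq
    proof (intro conjI)
      have "(\<lambda>w. 1 - w) ` n_stolz n \<gamma> \<subseteq> n_sector n \<gamma>" using sub by blast
      from holomorphic_on_compose_gen[OF _ hol this] show "\<phi> holomorphic_on n_stolz n \<gamma>"
        by (simp add: o_def holomorphic_intros \<phi>_def[abs_def])
      show "bounded (\<phi> ` n_stolz n \<gamma>)"
        by (rule bounded_subset[OF bnd]) (use sub in \<open>auto simp: \<phi>_def\<close>)
      have "cmod (\<phi> w) \<le> max c 1 * cmod (1 - w) powr s" if "w \<in> n_stolz n \<gamma>" for w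
        unfolding \<phi>_def using b[OF sub[OF that]]
        by (rule order_trans) (intro mult_right_mono, auto)
      moreover have "max c 1 > 0" by simp
      ultimately show "\<exists>c>0. \<exists>s>0. \<forall>w\<in>n_stolz n \<gamma>. cmod (\<phi> w) \<le> c * cmod (1 - w) powr s"
        using cs by blast
    qed
    note \<phi> = this
    have "sectorial_calculus n \<nu> UNIV (blinfun_apply A) f = Ritt_calculus n \<nu> T \<phi>"
      using sectorial_calculus_eq_stolz_integral[OF n T A \<nu> \<gamma>(2) f]
        Ritt_calculus_eq_stolz_integral[OF n T A \<nu> \<gamma>(2) \<phi>] by (simp add: \<phi>_def)
    also have "norm \<dots> \<le> K * sup_norm_on (n_stolz n \<gamma>) \<phi>" by (rule bound[OF \<phi> \<nu>])
    also have "sup_norm_on (n_stolz n \<gamma>) \<phi> \<le> sup_norm_on (n_sector n \<gamma>) f"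
      by (rule sup_norm_on_least[OF n_stolz_nonempty])
         (use n \<gamma> \<gamma>2 sub in \<open>auto simp: \<phi>_def intro!: sup_norm_on_upper[OF bnd]\<close>)
    finally show ?thesis using K by simp
  qed
  then show ?thesis
    unfolding sectorial_bounded_calculus_def
    using \<alpha> K n_Ritt_imp_n_sectorial[OF n T A] by blast
qed

lemma H0_sector_mono:
  assumes "f \<in> H0_sector n \<theta>'" "\<theta> \<le> \<theta>'"
  shows "f \<in> H0_sector n \<theta>"
proof -
  have sub: "n_sector n \<theta> \<subseteq> n_sector n \<theta>'" by (rule n_sector_mono[OF assms(2)])
  have "f holomorphic_on n_sector n \<theta>" "bounded (f ` n_sector n \<theta>)"
    using assms(1) sub unfolding H0_sector_def
    by (auto intro: holomorphic_on_subset bounded_subset image_mono)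
  moreover have "\<exists>c>0. \<exists>s>0. \<forall>z\<in>n_sector n \<theta>. cmod (f z) \<le> c * (cmod z powr s / (1 + cmod z powr (2 * s)))"
    using assms(1) sub unfolding H0_sector_def by blast
  ultimately show ?thesis unfolding H0_sector_def by blast
qed

text \<open>The angles are ordered as \<open>\<omega> < \<nu>1 < \<theta> \<le> max \<theta> \<alpha> < \<nu>0 < \<theta>' < \<gamma>\<close>. The contour of angle \<open>\<nu>0\<close> serves to split \<open>\<phi>(T)\<close>,
which requires \<open>\<alpha> < \<nu>0\<close> and a function \<open>h\<close> on the sectors of angle \<open>\<theta>'\<close>. Then \<open>h(A)\<close> is moved to the
contour of angle \<open>\<nu>1\<close>, where the hypothesis applies to the restriction of \<open>h\<close> to the sectors of angle \<open>\<theta>\<close>.\<close>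

lemma Ritt_bounded_calculus_of_sectorial:
  fixes T A :: "'a::complex_banach \<Rightarrow>\<^sub>L 'a"
  assumes n: "n > 1" and T: "n_Ritt_of_type n \<alpha> T" and A: "A = id_blinfun - T"
    and \<theta>: "0 < \<theta>" and \<gamma>: "max \<theta> \<alpha> < \<gamma>" "\<gamma> < pi / real n"
    and calc: "sectorial_bounded_calculus n \<theta> UNIV (blinfun_apply A)"
  shows "Ritt_bounded_calculus n \<gamma> T"
proof -
  have \<gamma>2: "\<gamma> < pi / 2" using \<gamma> pi_div_le[OF n] by linarith
  have \<alpha>: "0 < \<alpha>" using T unfolding n_Ritt_of_type_def by simp
  obtain \<omega> C0 where \<omega>: "0 < \<omega>" "\<omega> < \<theta>" and sec: "n_sectorial n \<omega> UNIV (blinfun_apply A)" and C0: "C0 > 0"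
    and bound: "\<And>f \<nu>. f \<in> H0_sector n \<theta> \<Longrightarrow> \<omega> < \<nu> \<Longrightarrow> \<nu> < \<theta> \<Longrightarrow>
        norm (sectorial_calculus n \<nu> UNIV (blinfun_apply A) f) \<le> C0 * sup_norm_on (n_sector n \<theta>) f"
    using calc unfolding sectorial_bounded_calculus_def by metis
  define \<theta>' where "\<theta>' = (max \<theta> \<alpha> + \<gamma>) / 2"
  have \<theta>': "\<theta> < \<theta>'" "\<alpha> < \<theta>'" "\<theta>' < \<gamma>" using \<gamma> by (auto simp: \<theta>'_def)
  define \<nu>0 where "\<nu>0 = (max \<theta> \<alpha> + \<theta>') / 2"
  have \<nu>0: "\<theta> < \<nu>0" "\<alpha> < \<nu>0" "\<nu>0 < \<theta>'" using \<theta>' by (auto simp: \<nu>0_def)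
  define \<nu>1 where "\<nu>1 = (\<omega> + \<theta>) / 2"
  have \<nu>1: "\<omega> < \<nu>1" "\<nu>1 < \<theta>" using \<omega> by (auto simp: \<nu>1_def)
  define \<alpha>' where "\<alpha>' = (\<alpha> + \<nu>0) / 2"
  have "\<alpha> < \<alpha>'" "\<alpha>' < \<nu>0" "0 < \<alpha>'" using \<alpha> \<nu>0 by (auto simp: \<alpha>'_def)
  then have \<alpha>': "\<alpha> < \<alpha>'" "\<alpha>' < \<nu>0" "0 < \<alpha>'" "\<alpha>' < pi / real n" using \<nu>0 \<theta>' \<gamma> by auto
  have \<theta>'n: "\<theta>' < pi / real n" "\<theta>' < pi / 2" "\<nu>0 < pi / real n" "\<nu>0 < pi / 2" using \<nu>0 \<theta>' \<gamma> \<gamma>2 by auto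
  obtain R where R: "resolvent_dominated (blinfun_apply A) (- closed_n_stolz_shift n \<alpha>') R"
    using n_Ritt_resolvent_dominated[OF n T A \<alpha>'(1,4)] .
  have R0: "R \<ge> 0" using R unfolding resolvent_dominated_def by simp
  obtain C where C: "C > 0" and dec:
    "\<And>\<phi>. \<phi> \<in> H0_stolz n \<gamma> \<Longrightarrow> \<exists>h\<in>H0_sector n \<theta>'.
       (\<forall>z\<in>n_sector n \<theta>'. cmod (h z) \<le> C * sup_norm_on (n_stolz n \<gamma>) \<phi>) \<and>
       (\<forall>j<n. \<forall>z\<in>(\<lambda>z. rot n j * z) ` stolz_shift \<theta>'.
          cmod (\<phi> (1 - z) - h z) \<le> C * sup_norm_on (n_stolz n \<gamma>) \<phi> * cmod z)"
    by (rule H0_stolz_decomposition[OF n order_less_trans[OF \<theta> \<theta>'(1)] \<theta>'(3) \<gamma>(2)]) blast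
  define K where "K = C0 * C + real n * ((2 + 2 * pi) * (C * R))"
  have K: "K > 0" unfolding K_def using C0 C R0 by (intro add_pos_nonneg) auto
  define k where "k = 1 / (2 * of_real pi * \<i>)"
  have k: "cmod k \<le> 1" using pi_ge_two by (simp add: k_def norm_divide norm_mult divide_le_eq)
  have main: "norm (Ritt_calculus n \<nu>0 T \<phi>) \<le> K * sup_norm_on (n_stolz n \<gamma>) \<phi>" if \<phi>: "\<phi> \<in> H0_stolz n \<gamma>" for \<phi>
  proof -
    define M where "M = sup_norm_on (n_stolz n \<gamma>) \<phi>"
    obtain h where h: "h \<in> H0_sector n \<theta>'" and hM: "\<And>z. z \<in> n_sector n \<theta>' \<Longrightarrow> cmod (h z) \<le> C * M"
      and gM: "\<And>j z. j < n \<Longrightarrow> z \<in> (\<lambda>z. rot n j * z) ` stolz_shift \<theta>' \<Longrightarrow>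
          cmod (\<phi> (1 - z) - h z) \<le> C * M * cmod z"
      using dec[OF \<phi>] unfolding M_def by blast
    have M: "M \<ge> 0"
    proof -
      obtain z where "z \<in> n_sector n \<theta>'" using n_sector_nonempty[of n \<theta>'] n \<theta> \<theta>' \<theta>'n by fastforce
      then have "0 \<le> C * M" using hM norm_ge_zero order_trans by blast
      then show ?thesis using C by (simp add: zero_le_mult_iff)
    qed
    have hol: "\<phi> holomorphic_on n_stolz n \<gamma>" using \<phi> unfolding H0_stolz_def by simp
    obtain c s where cs: "s > 0" and hhol: "h holomorphic_on n_sector n \<theta>'"
      and hb: "\<And>z. z \<in> n_sector n \<theta>' \<Longrightarrow> cmod (h z) \<le> c * cmod z powr s"
      using H0_sectorD[OF h] by metis
    define Rz where "Rz = resolvent UNIV (blinfun_apply A)"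
    define F where "F z = h z *\<^sub>C Rz z" for z
    define G where "G z = (\<phi> (1 - z) - h z) *\<^sub>C Rz z" for z
    have piece: "stolz_integral (rot n j) \<nu>0 (\<lambda>z. \<phi> (1 - z) *\<^sub>C Rz z) =
          stolz_integral (rot n j) \<nu>0 F + stolz_integral (rot n j) \<nu>0 G
        \<and> norm (stolz_integral (rot n j) \<nu>0 G) \<le> (2 + 2 * pi) * (C * M * R)"
      if j: "j < n" for j
    proof -
      define V where "V = (\<lambda>z. rot n j * z) ` stolz_shift \<theta>'"
      define U where "U = V \<inter> - closed_n_stolz_shift n \<alpha>'"
      have VS: "V \<subseteq> n_sector n \<theta>'"
        unfolding V_def n_sector_def using j stolz_shift_subset_sector[of \<theta>'] \<theta> \<theta>' \<theta>'n by fastforce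
      have V\<gamma>: "V \<subseteq> (\<lambda>z. rot n j * z) ` stolz_shift \<gamma>"
        unfolding V_def using \<theta> \<theta>' \<gamma>2 by (intro image_mono stolz_shift_mono) auto
      have oV: "open V" unfolding V_def using \<theta> \<theta>' \<theta>'n by (intro open_rot_image open_stolz_shift) auto
      have hV: "h holomorphic_on V" by (rule holomorphic_on_subset[OF hhol VS])
      have gV: "(\<lambda>z. \<phi> (1 - z) - h z) holomorphic_on V"
        by (intro holomorphic_on_diff hV holomorphic_on_subset[OF holomorphic_on_one_minus[OF hol j] V\<gamma>])
      have Fc: "continuous_on U F" and Gc: "continuous_on U G"
        unfolding F_def[abs_def] G_def[abs_def] U_def Rz_def
        by (rule vec_holomorphic_on_imp_continuous_on, rule scaled_resolvent(1)[OF R _ oV], fact hV gV)+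
      have Fb: "norm (F z) \<le> (c * R) * cmod z powr (s - 1)" if "z \<in> U" for z
        unfolding F_def Rz_def using that VS
        by (intro scaled_resolvent(2)[OF R hV oV] hb) (auto simp: U_def)
      have Gb: "norm (G z) \<le> (C * M * R) * cmod z powr (1 - 1)" if "z \<in> U" for z
        unfolding G_def Rz_def using that gM[OF j, of z]
        by (intro scaled_resolvent(2)[OF R gV oV]) (auto simp: U_def V_def)
      have U0: "0 \<notin> U" using R unfolding U_def resolvent_dominated_def by auto
      have Gb': "norm (G z) \<le> C * M * R" if "z \<in> U" for z
        using Gb[OF that] that U0 by (cases "z = 0") auto
      have edge: "of_real t * stolz_arc (rot n j) \<nu>0 0 \<in> U \<and> of_real t * stolz_arc (rot n j) \<nu>0 1 \<in> U"
        if "0 < t" "t \<le> 1" for t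
        unfolding U_def V_def
        using stolz_edge_mem[of \<nu>0 \<theta>' t] stolz_edge_notin_closed[OF n j, of \<alpha>' \<nu>0 t] that \<alpha>' \<nu>0 \<theta>'n by auto
      have arc: "stolz_arc (rot n j) \<nu>0 t \<in> U" if "0 \<le> t" "t \<le> 1" for t
        unfolding U_def V_def
        using stolz_arc_mem[of \<nu>0 \<theta>'] stolz_arc_notin_closed[OF n j, of \<alpha>' \<nu>0 t 1] that \<alpha>' \<nu>0 \<theta>'n by auto
      have "(\<lambda>z. \<phi> (1 - z) *\<^sub>C Rz z) = (\<lambda>z. F z + G z)"
        by (simp add: F_def G_def fun_eq_iff flip: scaleC_add_left)
      then have "stolz_integral (rot n j) \<nu>0 (\<lambda>z. \<phi> (1 - z) *\<^sub>C Rz z) =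
          stolz_integral (rot n j) \<nu>0 F + stolz_integral (rot n j) \<nu>0 G"
        using stolz_integral_add[OF cs zero_less_one Fc Gc edge arc Fb Gb] by simp
      moreover have "norm (stolz_integral (rot n j) \<nu>0 G) \<le> (2 + 2 * pi) * (C * M * R)"
        by (rule norm_stolz_integral_le[OF Gc _ _ _ edge arc Gb' _ U0])
           (use \<alpha>' \<theta>'n C M R0 in auto)
      ultimately show ?thesis by blast
    qed
    have "Ritt_calculus n \<nu>0 T \<phi> = k *\<^sub>C (\<Sum>j<n. stolz_integral (rot n j) \<nu>0 (\<lambda>z. \<phi> (1 - z) *\<^sub>C Rz z))"
      unfolding k_def Rz_def using \<nu>0 \<theta>' by (intro Ritt_calculus_eq_stolz_integral[OF n T A _ _ \<gamma>(2) \<phi>]) auto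
    also have "\<dots> = k *\<^sub>C (\<Sum>j<n. stolz_integral (rot n j) \<nu>0 F) + k *\<^sub>C (\<Sum>j<n. stolz_integral (rot n j) \<nu>0 G)"
      using piece by (simp add: sum.distrib scaleC_add_right)
    also have "k *\<^sub>C (\<Sum>j<n. stolz_integral (rot n j) \<nu>0 F) = sectorial_calculus n \<nu>0 UNIV (blinfun_apply A) h"
      unfolding k_def F_def[abs_def] Rz_def
      by (rule sectorial_calculus_eq_stolz_integral[OF n T A \<nu>0(2,3) \<theta>'n(1) h, symmetric])
    also have "\<dots> = sectorial_calculus n \<nu>1 UNIV (blinfun_apply A) h"
      by (rule sectorial_calculus_angle_independent[OF n sec \<nu>1(1) _ \<nu>0(3) \<theta>'n(1) h, symmetric])
         (use \<nu>0 \<nu>1 in auto)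
    finally have eq: "Ritt_calculus n \<nu>0 T \<phi> = sectorial_calculus n \<nu>1 UNIV (blinfun_apply A) h +
        k *\<^sub>C (\<Sum>j<n. stolz_integral (rot n j) \<nu>0 G)" .
    have h\<theta>: "h \<in> H0_sector n \<theta>" using H0_sector_mono[OF h] \<theta>' by simp
    have "norm (sectorial_calculus n \<nu>1 UNIV (blinfun_apply A) h) \<le> C0 * sup_norm_on (n_sector n \<theta>) h"
      by (rule bound[OF h\<theta> \<nu>1])
    also have "\<dots> \<le> C0 * (C * M)"
    proof (intro mult_left_mono sup_norm_on_least n_sector_nonempty)
      show "cmod (h z) \<le> C * M" if "z \<in> n_sector n \<theta>" for z
        using that n_sector_mono[of \<theta> \<theta>' n] \<theta>' by (intro hM) auto
    qed (use n \<theta> \<theta>' \<theta>'n C0 in auto)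
    finally have 1: "norm (sectorial_calculus n \<nu>1 UNIV (blinfun_apply A) h) \<le> C0 * (C * M)" .
    have "norm (\<Sum>j<n. stolz_integral (rot n j) \<nu>0 G) \<le> (\<Sum>j<n. (2 + 2 * pi) * (C * M * R))"
      using piece by (intro sum_norm_le) auto
    then have "norm (\<Sum>j<n. stolz_integral (rot n j) \<nu>0 G) \<le> real n * ((2 + 2 * pi) * (C * M * R))" by simp
    then have "cmod k * norm (\<Sum>j<n. stolz_integral (rot n j) \<nu>0 G) \<le> 1 * (real n * ((2 + 2 * pi) * (C * M * R)))"
      using k by (intro mult_mono) auto
    then have 2: "norm (k *\<^sub>C (\<Sum>j<n. stolz_integral (rot n j) \<nu>0 G)) \<le> real n * ((2 + 2 * pi) * (C * M * R))"
      by (simp add: norm_scaleC)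
    have "norm (Ritt_calculus n \<nu>0 T \<phi>) \<le> C0 * (C * M) + real n * ((2 + 2 * pi) * (C * M * R))"
      unfolding eq by (intro norm_triangle_le add_mono 1 2)
    also have "\<dots> = K * M" by (simp add: K_def algebra_simps)
    finally show ?thesis unfolding M_def .
  qed
  have "norm (Ritt_calculus n \<beta> T \<phi>) \<le> K * sup_norm_on (n_stolz n \<gamma>) \<phi>"
    if \<phi>: "\<phi> \<in> H0_stolz n \<gamma>" and \<beta>: "\<alpha> < \<beta>" "\<beta> < \<gamma>" for \<phi> \<beta>
  proof -
    have "Ritt_calculus n \<beta> T \<phi> = Ritt_calculus n \<nu>0 T \<phi>"
    proof (cases "\<beta> \<le> \<nu>0")
      case True
      then show ?thesis
        using \<beta> \<nu>0 \<theta>' by (intro Ritt_calculus_angle_independent[OF n T _ _ _ \<gamma>(2) \<phi>]) auto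
    next
      case False
      then show ?thesis
        using \<beta> \<nu>0 \<theta>' by (intro Ritt_calculus_angle_independent[OF n T _ _ _ \<gamma>(2) \<phi>, symmetric]) auto
    qed
    then show ?thesis using main[OF \<phi>] by simp
  qed
  then show ?thesis
    unfolding Ritt_bounded_calculus_def using \<alpha> \<gamma> T K by (metis max_less_iff_conj)
qed

theorem theorem4p1:
  fixes n :: nat and T A :: "'a::complex_banach \<Rightarrow>\<^sub>L 'a"
  assumes "n > 1" and "n_Ritt n T" and "A = id_blinfun - T"
  shows "(\<exists>\<gamma>. 0 < \<gamma> \<and> \<gamma> < pi / real n \<and> Ritt_bounded_calculus n \<gamma> T) \<longleftrightarrow>
         (\<exists>\<theta>. 0 < \<theta> \<and> \<theta> < pi / real n \<and> sectorial_bounded_calculus n \<theta> UNIV (blinfun_apply A))"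
proof
  assume "\<exists>\<gamma>. 0 < \<gamma> \<and> \<gamma> < pi / real n \<and> Ritt_bounded_calculus n \<gamma> T"
  then show "\<exists>\<theta>. 0 < \<theta> \<and> \<theta> < pi / real n \<and> sectorial_bounded_calculus n \<theta> UNIV (blinfun_apply A)"
    using sectorial_bounded_calculus_of_Ritt[OF assms(1,3)] by blast
next
  assume "\<exists>\<theta>. 0 < \<theta> \<and> \<theta> < pi / real n \<and> sectorial_bounded_calculus n \<theta> UNIV (blinfun_apply A)"
  then obtain \<theta> where \<theta>: "0 < \<theta>" "\<theta> < pi / real n"
      "sectorial_bounded_calculus n \<theta> UNIV (blinfun_apply A)" by blast
  obtain \<alpha> where \<alpha>: "0 < \<alpha>" "\<alpha> < pi / real n" "n_Ritt_of_type n \<alpha> T"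
    using assms(2) unfolding n_Ritt_def by blast
  obtain \<gamma> where \<gamma>: "max \<theta> \<alpha> < \<gamma>" "\<gamma> < pi / real n"
    using dense[of "max \<theta> \<alpha>" "pi / real n"] \<theta> \<alpha> by auto
  have "Ritt_bounded_calculus n \<gamma> T"
    by (rule Ritt_bounded_calculus_of_sectorial[OF assms(1) \<alpha>(3) assms(3) \<theta>(1) \<gamma> \<theta>(3)])
  moreover have "0 < \<gamma>" using \<gamma>(1) \<theta>(1) by auto
  ultimately show "\<exists>\<gamma>. 0 < \<gamma> \<and> \<gamma> < pi / real n \<and> Ritt_bounded_calculus n \<gamma> T"
    using \<gamma>(2) by blast
qed

end
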